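(* Let $\epsilon_n\ge0$, $\epsilon_n\to0$, and let $\{W_i\}$ be i.i.d. with law $\lambda_0\in\mathcal{P}(\mathcal{W})$. For each $n$ and $\vec w\in\mathcal{W}^n$ let $(\hat x^n_1(\vec w),\dots,\hat x^n_n(\vec w))$ be an $\epsilon_n$-Nash equilibrium with type vector $\vec w$, each $\hat x^n_i$ universally measurable, and let $\mu_n=\frac1n\sum_{i=1}^n\delta_{(W_i,\hat x^n_i(W_1,\dots,W_n))}$. Then for every measurable $A\subset\mathcal{P}(\mathcal{W}\times\mathcal{X})$: $$\limsup_{n\to\infty}\frac1n\log\mathbb{P}(\mu_n\in A)\le-\inf\{H(m^w|\lambda_0):m\in\overline{A}\cap\mathcal{M}\},$$ $$\liminf_{n\to\infty}\frac1n\log\mathbb{P}(\mu_n\in A)\ge-\inf\{H(\lambda|\lambda_0):\lambda\in\mathcal{P}(\mathcal{W}),\ \mathcal{M}(\lambda)\subset A^\circ\}.$$ Moreover, if $\mathcal{M}(\lambda)$ is a singleton for every $\lambda\ll\lambda_0$, then $$\liminf_{n\to\infty}\frac1n\log\mathbb{P}(\mu_n\in A)\ge-\inf\{H(m^w|\lambda_0):m\in A^\circ\cap\mathcal{M}\}.$$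
   Context: Standing assumptions: $\mathcal{X}$ compact metric space, $\mathcal{W}$ complete separable metric space; $\mathcal{P}(S)$ = Borel probability measures on $S$ with the weak topology. $\mathcal{C}$ maps $w$ to a nonempty closed $\mathcal{C}(w)\subset\mathcal{X}$, continuous in the sense that $\mathrm{Gr}(\mathcal{C})=\{(w,x):x\in\mathcal{C}(w)\}$ is closed and whenever $w_n\to w$, $x\in\mathcal{C}(w)$ there exist $n_k$, $x_{n_k}\in\mathcal{C}(w_{n_k})$ with $x_{n_k}\to x$. $F:\mathcal{P}(\mathcal{W}\times\mathcal{X})\times\mathcal{W}\times\mathcal{X}\to\mathbb{R}$ bounded continuous. For $\epsilon\ge0$, an $\epsilon$-Nash equilibrium with type vector $(w_1,\dots,w_n)$ is $(x_1,\dots,x_n)$ with $x_i\in\mathcal{C}(w_i)$ and, with $m=\frac1n\sum_k\delta_{(w_k,x_k)}$, $F(m,w_i,x_i)-\inf_{y\in\mathcal{C}(w_i)}F(m+\frac1n(\delta_{(w_i,y)}-\delta_{(w_i,x_i)}),w_i,y)\le\epsilon$ for all $i$. $m^w$ = first marginal. $\mathcal{M}(\lambda)$ = set of $m$ with $m^w=\lambda$ such that for $m$-a.e. $(w,x)$, $x\in\mathcal{C}(w)$ and $F(m,w,x)=\inf_{y\in\mathcal{C}(w)}F(m,w,y)$; $\mathcal{M}=\bigcup_\lambda\mathcal{M}(\lambda)$. $H$ = relative entropy ($+\infty$ unless absolutely continuous); $\inf\emptyset=\infty$. *)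

theory Defs
  imports "HOL-Probability.Probability"
begin

definition Pr :: "'a::topological_space measure set" where
  "Pr = {m. sets m = sets (borel :: 'a measure) \<and> prob_space m}"

definition weak_top :: "'a::metric_space measure topology" where
  "weak_top = subtopology
     (topology_generated_by
        {{m. (\<integral>x. f x \<partial>m) \<in> U} | (f :: 'a \<Rightarrow> real) U.
           continuous_on UNIV f \<and> bounded (range f) \<and> open U})
     Pr"

definition weak_borel :: "'a::metric_space measure set set" where
  "weak_borel = sigma_sets Pr {U. openin weak_top U}"

definition wmarg :: "('w::topological_space \<times> 'x::topological_space) measure \<Rightarrow> 'w measure" where
  "wmarg m = distr m borel fst"

text \<open>Relative entropy H(nu | mu) = integral of f log f d mu with f = d nu / d mu if
  nu << mu, and +infinity otherwise (also +infinity if f log f is not integrable;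
  since f log f is bounded below this is the value of the integral).\<close>
definition rel_entropy :: "'a measure \<Rightarrow> 'a measure \<Rightarrow> ereal" where
  "rel_entropy \<nu> \<mu> =
     (let f = (\<lambda>x. enn2real (RN_deriv \<mu> \<nu> x)) in
      if sets \<nu> = sets \<mu> \<and> absolutely_continuous \<mu> \<nu>
         \<and> integrable \<mu> (\<lambda>x. f x * ln (f x))
      then ereal (\<integral>x. f x * ln (f x) \<partial>\<mu>) else \<infinity>)"

definition empirical :: "nat \<Rightarrow> (nat \<Rightarrow> 'a::topological_space) \<Rightarrow> 'a measure" where
  "empirical n p = distr (measure_pmf (pmf_of_set {..<n})) borel p"

definition univ_measurable :: "'a measure \<Rightarrow> 'b measure \<Rightarrow> ('a \<Rightarrow> 'b) \<Rightarrow> bool" where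
  "univ_measurable M N f \<longleftrightarrow>
     (\<forall>\<mu>. sets \<mu> = sets M \<and> prob_space \<mu> \<longrightarrow> f \<in> measurable (completion \<mu>) N)"

definition cont_corr :: "('w::metric_space \<Rightarrow> 'x::metric_space set) \<Rightarrow> bool" where
  "cont_corr C \<longleftrightarrow>
     closed {(w, x). x \<in> C w} \<and>
     (\<forall>w wn x. wn \<longlonglongrightarrow> w \<and> x \<in> C w \<longrightarrow>
        (\<exists>r xs. strict_mono r \<and> (\<forall>k. xs k \<in> C (wn (r k))) \<and> xs \<longlonglongrightarrow> x))"

text \<open>epsilon-Nash equilibrium x (indices 0..n-1) with type vector w.  The
  perturbed measure m + (1/n)(delta_(w_i,y) - delta_(w_i,x_i)) is the empirical
  measure of the profile with x_i replaced by y.\<close>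
definition eps_nash ::
  "('w::metric_space \<Rightarrow> 'x::metric_space set) \<Rightarrow>
   (('w \<times> 'x) measure \<Rightarrow> 'w \<Rightarrow> 'x \<Rightarrow> real) \<Rightarrow> real \<Rightarrow> nat \<Rightarrow>
   (nat \<Rightarrow> 'w) \<Rightarrow> (nat \<Rightarrow> 'x) \<Rightarrow> bool" where
  "eps_nash C F eps n w x \<longleftrightarrow>
     (\<forall>i<n. x i \<in> C (w i)) \<and>
     (\<forall>i<n. F (empirical n (\<lambda>j. (w j, x j))) (w i) (x i)
            - (INF y\<in>C (w i). F (empirical n (\<lambda>j. (w j, (x(i := y)) j))) (w i) y) \<le> eps)"

definition MFE ::
  "('w::metric_space \<Rightarrow> 'x::metric_space set) \<Rightarrow>
   (('w \<times> 'x) measure \<Rightarrow> 'w \<Rightarrow> 'x \<Rightarrow> real) \<Rightarrow> 'w measure \<Rightarrow> ('w \<times> 'x) measure set" where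
  "MFE C F lam = {m \<in> Pr. wmarg m = lam \<and>
      (AE wx in m. snd wx \<in> C (fst wx) \<and>
         F m (fst wx) (snd wx) = (INF y\<in>C (fst wx). F m (fst wx) y))}"

definition MFE_all ::
  "('w::metric_space \<Rightarrow> 'x::metric_space set) \<Rightarrow>
   (('w \<times> 'x) measure \<Rightarrow> 'w \<Rightarrow> 'x \<Rightarrow> real) \<Rightarrow> ('w \<times> 'x) measure set" where
  "MFE_all C F = (\<Union>lam\<in>Pr. MFE C F lam)"

definition nlog :: "nat \<Rightarrow> real \<Rightarrow> ereal" where
  "nlog n p = (if p = 0 then - \<infinity> else ereal (ln p / real n))"

end

theory Submission
  imports Defs
begin

text \<open>
  Since the action space is compact, exponential tightness of the empirical type measures makes the
  law of \<open>\<mu>\<^sub>n\<close> exponentially tight, and everything reduces to finite covers by weak neighbourhoods of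
  points \<open>m\<close>. If \<open>m\<close> is not a mean-field equilibrium, some point of its support admits a strictly
  profitable deviation; by continuity of \<open>F\<close> and lower hemicontinuity of \<open>C\<close> the deviation persists near
  \<open>m\<close>, so for large \<open>n\<close> a whole neighbourhood contains no empirical measure of an \<open>\<epsilon>\<^sub>n\<close>-equilibrium.
  If \<open>m\<close> is an equilibrium, a half-space given by the Donsker--Varadhan formula and Chernoff's bound
  give the rate \<open>H(m\<^sup>w|\<lambda>\<^sub>0)\<close>. The same covering argument under \<open>\<lambda>\<close> in place of \<open>\<lambda>\<^sub>0\<close> shows that \<open>\<mu>\<^sub>n\<close> lies in
  \<open>A\<close> with probability tending to 1 whenever all equilibria with marginal \<open>\<lambda>\<close> lie in the interior, and the
  density \<open>d\<lambda>\<^sup>n/d\<lambda>\<^sub>0\<^sup>n\<close>, controlled by the weak law of large numbers, transfers this to \<open>\<lambda>\<^sub>0\<close>.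
\<close>

subsection \<open>The weak topology\<close>

text \<open>Three obstacles shape the argument. The weak topology is given only by generating sets,
  so no sequences are extracted: a measure is sent to its family of integrals in a product of real
  lines, Tychonoff's theorem gives compactness there, and a Riesz representation of tight
  functionals shows that limit points are again measures. The strategies are only universally
  measurable, so events are controlled through measurable covers of sets of type vectors and
  measured in completed product spaces. A deviating player also moves the empirical measure, by mass
  1/n, so the profit of a deviation is made uniform over two independent measures from one
  neighbourhood, which the perturbed profile does not leave for large n. Finite covers cost a
  constant factor; rates are therefore kept strictly above their targets, and the gap absorbs the
  constant. Both bounds rest on one separation property, some f in \<open>Cb\<close> with
  \<open>dv f (wmarg m) l > c\<close>: it comes from the entropy when \<open>l\<close> is
  \<open>lam0\<close>, and from \<open>wmarg m \<noteq> l\<close> with c = 0 in the law of large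
  numbers behind the lower bound.\<close>

definition Cb :: "('a::metric_space \<Rightarrow> real) set" where
  "Cb = {f. continuous_on UNIV f \<and> bounded (range f)}"

lemma CbI: "continuous_on UNIV f \<Longrightarrow> (\<And>x. \<bar>f x\<bar> \<le> B) \<Longrightarrow> f \<in> Cb"
  unfolding Cb_def bounded_iff by auto

lemma CbE:
  assumes "f \<in> Cb"
  obtains B where "B > 0" "\<And>x. \<bar>f x\<bar> \<le> B" "continuous_on UNIV f"
  using assms unfolding Cb_def bounded_pos by auto

lemma Cb_add: "f \<in> Cb \<Longrightarrow> g \<in> Cb \<Longrightarrow> (\<lambda>x. f x + g x) \<in> Cb"
  by (elim CbE, rule_tac B="B+Ba" in CbI)
     (auto intro!: continuous_intros order_trans[OF abs_triangle_ineq] add_mono)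

lemma Cb_cmult: "f \<in> Cb \<Longrightarrow> (\<lambda>x. c * f x) \<in> Cb"
  by (elim CbE, rule_tac B="\<bar>c\<bar> * B" in CbI)
     (auto intro!: continuous_intros mult_left_mono simp: abs_mult)

lemma Cb_const: "(\<lambda>_. c) \<in> Cb"
  by (rule CbI[of _ "\<bar>c\<bar>"]) auto

lemma Cb_diff: "f \<in> Cb \<Longrightarrow> g \<in> Cb \<Longrightarrow> (\<lambda>x. f x - g x) \<in> Cb"
  using Cb_add[OF _ Cb_cmult[of g "-1"], of f] by simp

lemma Cb_sum: "(\<And>i. i \<in> I \<Longrightarrow> f i \<in> Cb) \<Longrightarrow> (\<lambda>x. \<Sum>i\<in>I. f i x) \<in> Cb"
  by (induction I rule: infinite_finite_induct) (auto simp: Cb_const Cb_add)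

lemma Cb_measurable: "f \<in> Cb \<Longrightarrow> f \<in> borel_measurable borel"
  by (auto simp: Cb_def intro: borel_measurable_continuous_onI)

lemma PrD: "m \<in> Pr \<Longrightarrow> sets m = sets borel" "m \<in> Pr \<Longrightarrow> prob_space m"
  by (auto simp: Pr_def)

lemma Pr_space: "m \<in> Pr \<Longrightarrow> space m = UNIV"
  using sets_eq_imp_space_eq[of m borel] by (auto simp: Pr_def)

lemma Cb_integrable:
  assumes "sets m = sets borel" "finite_measure m" "f \<in> Cb"
  shows "integrable m f"
proof -
  interpret finite_measure m by fact
  obtain B where B: "\<And>x. \<bar>f x\<bar> \<le> B" using assms(3) by (elim CbE) auto
  have "f \<in> borel_measurable m"
    using Cb_measurable[OF assms(3)] measurable_cong_sets[OF assms(1) refl] by blast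
  then show ?thesis
    using B by (intro integrable_const_bound[where B=B]) auto
qed

lemma Pr_integrable: "m \<in> Pr \<Longrightarrow> f \<in> Cb \<Longrightarrow> integrable m f"
  by (auto simp: Pr_def intro!: Cb_integrable prob_space.finite_measure)

lemma topspace_weak_top [simp]: "topspace weak_top = Pr"
proof -
  have "UNIV \<in> {{m. (\<integral>x. f x \<partial>m) \<in> U} | (f :: 'a \<Rightarrow> real) U.
           continuous_on UNIV f \<and> bounded (range f) \<and> open U}"
    by (rule CollectI, rule exI[of _ "\<lambda>_. 0"], rule exI[of _ UNIV]) auto
  then show ?thesis
    unfolding weak_top_def topspace_subtopology topology_generated_by_topspace by blast
qed

lemma openin_weak_top_integral:
  assumes "f \<in> Cb" "open U"
  shows "openin weak_top {m \<in> Pr. (\<integral>x. f x \<partial>m) \<in> U}"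
proof -
  have "openin (topology_generated_by
        {{m. (\<integral>x. f x \<partial>m) \<in> U} | (f :: 'a \<Rightarrow> real) U.
           continuous_on UNIV f \<and> bounded (range f) \<and> open U}) {m. (\<integral>x. f x \<partial>m) \<in> U}"
    using assms by (intro topology_generated_by_Basis) (auto simp: Cb_def)
  then show ?thesis
    unfolding weak_top_def openin_subtopology by blast
qed

text \<open>Having such a neighbourhood at each point is stable under unions and finite
  intersections: unite the test functions and take the smaller tolerance. The induction follows the
  generation of the topology.\<close>

lemma weak_top_nbhd:
  assumes "openin weak_top U" "m \<in> U"
  obtains J \<eta> where "finite J" "J \<subseteq> Cb" "\<eta> > 0"
    "\<And>m'. m' \<in> Pr \<Longrightarrow> (\<And>f. f \<in> J \<Longrightarrow> \<bar>(\<integral>x. f x \<partial>m') - (\<integral>x. f x \<partial>m)\<bar> < \<eta>) \<Longrightarrow> m' \<in> U"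
proof -
  let ?S = "{{m. (\<integral>x. f x \<partial>m) \<in> U} | (f :: 'a \<Rightarrow> real) U.
           continuous_on UNIV f \<and> bounded (range f) \<and> open U}"
  \<comment> \<open>The inductive claim ranges over all measures, because the generating sets are
    not confined to \<open>Pr\<close>; the restriction enters only with \<open>V \<inter> Pr\<close>
    at the end.\<close>
  let ?P = "\<lambda>U. \<exists>J \<eta>. finite J \<and> J \<subseteq> Cb \<and> \<eta> > 0 \<and>
    (\<forall>m'. (\<forall>f\<in>J. \<bar>(\<integral>x. f x \<partial>m') - (\<integral>x. f x \<partial>m)\<bar> < \<eta>) \<longrightarrow> m' \<in> U)"
  obtain V where V: "openin (topology_generated_by ?S) V" "U = V \<inter> Pr"
    using assms(1) unfolding weak_top_def openin_subtopology by blast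
  have "generate_topology_on ?S V" using V(1) by (simp add: openin_topology_generated_by_iff)
  then have "m \<in> V \<Longrightarrow> ?P V"
  proof (induction rule: generate_topology_on.induct)
    case Empty then show ?case by simp
  next
    case (Int a b)
    then obtain J \<eta> J' \<eta>' where J: "finite J" "J \<subseteq> Cb" "\<eta> > 0"
      "\<And>m'. (\<And>f. f \<in> J \<Longrightarrow> \<bar>(\<integral>x. f x \<partial>m') - (\<integral>x. f x \<partial>m)\<bar> < \<eta>) \<Longrightarrow> m' \<in> a"
      and J': "finite J'" "J' \<subseteq> Cb" "\<eta>' > 0"
      "\<And>m'. (\<And>f. f \<in> J' \<Longrightarrow> \<bar>(\<integral>x. f x \<partial>m') - (\<integral>x. f x \<partial>m)\<bar> < \<eta>') \<Longrightarrow> m' \<in> b"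
      by (metis (no_types, lifting) IntE)
    show ?case
      by (rule exI[of _ "J \<union> J'"], rule exI[of _ "min \<eta> \<eta>'"])
         (use J J' in \<open>auto\<close>)
  next
    case (UN K)
    then obtain k where "k \<in> K" "m \<in> k" by blast
    with UN.IH[of k] obtain J \<eta> where "finite J" "J \<subseteq> Cb" "\<eta> > 0"
      "\<forall>m'. (\<forall>f\<in>J. \<bar>(\<integral>x. f x \<partial>m') - (\<integral>x. f x \<partial>m)\<bar> < \<eta>) \<longrightarrow> m' \<in> k" by auto
    with \<open>k \<in> K\<close> show ?case by blast
  next
    case (Basis s)
    then obtain f U where f: "s = {m. (\<integral>x. f x \<partial>m) \<in> U}" "f \<in> Cb" "open U"
      by (auto simp: Cb_def)
    then obtain e where "e > 0" "\<And>y. \<bar>y - (\<integral>x. f x \<partial>m)\<bar> < e \<Longrightarrow> y \<in> U"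
      using Basis(2) by (auto simp: open_dist dist_real_def)
    then show ?case
      using f by (intro exI[of _ "{f}"] exI[of _ e]) auto
  qed
  with assms(2) V(2) obtain J \<eta> where "finite J" "J \<subseteq> Cb" "\<eta> > 0"
    "\<forall>m'. (\<forall>f\<in>J. \<bar>(\<integral>x. f x \<partial>m') - (\<integral>x. f x \<partial>m)\<bar> < \<eta>) \<longrightarrow> m' \<in> V" by auto
  then show thesis
    using V(2) by (intro that[of J \<eta>]) auto
qed

text \<open>The coordinates outside \<open>Cb\<close> are set to 0 so that the weak topology becomes the one
  pulled back from the product topology along \<open>wint\<close>.\<close>
definition wint :: "'a::metric_space measure \<Rightarrow> ('a \<Rightarrow> real) \<Rightarrow> real" where
  "wint m f = (if f \<in> Cb then (\<integral>x. f x \<partial>m) else 0)"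

lemma open_coordinate: "open V \<Longrightarrow> open {\<phi> :: 'i \<Rightarrow> real. \<phi> f \<in> V}"
  using open_vimage[of V "\<lambda>\<phi>. \<phi> f"] by (simp add: vimage_def)

text \<open>Reduces compactness of a set of measures to compactness of its image under
  \<open>wint\<close>. Each point contributes a box in finitely many coordinates, and
  \<open>Q\<close> is the union of these boxes.\<close>

lemma weak_top_pullback:
  assumes "openin weak_top U"
  obtains Q where "open Q" "U = {m \<in> Pr. wint m \<in> Q}"
proof -
  have "\<exists>Q. open Q \<and> wint m \<in> Q \<and> {m' \<in> Pr. wint m' \<in> Q} \<subseteq> U" if m: "m \<in> U" for m
  proof -
    obtain J \<eta> where J: "finite J" "J \<subseteq> Cb" "\<eta> > 0"
      "\<And>m'. m' \<in> Pr \<Longrightarrow> (\<And>f. f \<in> J \<Longrightarrow> \<bar>(\<integral>x. f x \<partial>m') - (\<integral>x. f x \<partial>m)\<bar> < \<eta>) \<Longrightarrow> m' \<in> U"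
      using weak_top_nbhd[OF assms m] by blast
    let ?Q = "\<Inter>f\<in>J. {\<phi>. \<phi> f \<in> ball (wint m f) \<eta>}"
    show ?thesis
    proof (intro exI[of _ ?Q] conjI)
      show "open ?Q" using J(1) by (intro open_INT ballI open_coordinate) auto
      show "{m' \<in> Pr. wint m' \<in> ?Q} \<subseteq> U"
        using J(2) by (auto intro!: J(4) simp: wint_def dist_real_def abs_minus_commute subset_iff)
    qed (use J in auto)
  qed
  then obtain Q where Q: "\<And>m. m \<in> U \<Longrightarrow> open (Q m) \<and> wint m \<in> Q m \<and> {m' \<in> Pr. wint m' \<in> Q m} \<subseteq> U"
    by metis
  have "U \<subseteq> Pr" using openin_subset[OF assms] by simp
  with Q have "U = {m \<in> Pr. wint m \<in> (\<Union>m\<in>U. Q m)}" by blast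
  moreover have "open (\<Union>m\<in>U. Q m)" using Q by blast
  ultimately show thesis using that by blast
qed

lemma compactin_weak_topI:
  assumes "K \<subseteq> Pr" "compact (wint ` K)"
  shows "compactin weak_top K"
  unfolding compactin_def
proof (intro conjI allI impI)
  show "K \<subseteq> topspace weak_top" using assms by simp
  fix \<U> :: "'a measure set set" assume U: "Ball \<U> (openin weak_top) \<and> K \<subseteq> \<Union> \<U>"
  have "\<forall>U\<in>\<U>. \<exists>Q. open Q \<and> U = {m \<in> Pr. wint m \<in> Q}"
    using U weak_top_pullback by metis
  then obtain Q where Q: "\<And>U. U \<in> \<U> \<Longrightarrow> open (Q U) \<and> U = {m \<in> Pr. wint m \<in> Q U}" by metis
  have "wint ` K \<subseteq> (\<Union>U\<in>\<U>. Q U)"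
  proof
    fix y assume "y \<in> wint ` K"
    then obtain m where m: "m \<in> K" "y = wint m" by blast
    then obtain U where "U \<in> \<U>" "m \<in> U" using U by blast
    with Q[of U] m show "y \<in> (\<Union>U\<in>\<U>. Q U)" by blast
  qed
  then obtain D where D: "D \<subseteq> \<U>" "finite D" "wint ` K \<subseteq> (\<Union>U\<in>D. Q U)"
    using compactE_image[OF assms(2), of \<U> Q] Q by blast
  have "K \<subseteq> \<Union>D"
  proof
    fix m assume "m \<in> K"
    then obtain U where "U \<in> D" "wint m \<in> Q U" using D by blast
    with Q[of U] D \<open>m \<in> K\<close> assms(1) show "m \<in> \<Union>D" by blast
  qed
  with D show "\<exists>\<F>. finite \<F> \<and> \<F> \<subseteq> \<U> \<and> K \<subseteq> \<Union> \<F>" by blast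
qed

subsection \<open>Compactness of tight sets\<close>

lemma Cb_max0: "f \<in> Cb \<Longrightarrow> (\<lambda>x. max 0 (f x)) \<in> Cb"
  by (elim CbE, rule_tac B=B in CbI)
     (auto intro!: continuous_on_max continuous_on_const intro: order_trans[OF _ abs_ge_self]
       simp: abs_le_iff)

lemma Cb_min:
  assumes "f \<in> Cb"
  shows "(\<lambda>x. min c (f x)) \<in> Cb"
proof -
  obtain B where B: "\<And>x. \<bar>f x\<bar> \<le> B" "continuous_on UNIV f" using CbE[OF assms] by metis
  have "\<bar>min c (f x)\<bar> \<le> max \<bar>c\<bar> B" for x using B(1)[of x] by linarith
  then show ?thesis by (intro CbI continuous_on_min continuous_on_const B(2))
qed

text \<open>Continuous approximations from below of the indicator of \<open>U\<close>, steeper as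
  \<open>N\<close> grows. The case \<open>UNIV\<close> is separate because \<open>infdist\<close> to
  the empty complement is 0 by convention.\<close>

definition tent :: "nat \<Rightarrow> 'a::metric_space set \<Rightarrow> 'a \<Rightarrow> real" where
  "tent N U x = (if U = UNIV then 1 else min 1 (real N * infdist x (- U)))"

lemma tent_Cb: "tent N U \<in> Cb"
proof (cases "U = UNIV")
  case True then show ?thesis by (auto simp: tent_def[abs_def] Cb_const)
next
  case False
  then show ?thesis
    unfolding tent_def[abs_def]
    by (auto intro!: CbI[where B=1] continuous_intros simp: abs_le_iff infdist_nonneg
        intro: order_trans[of _ 0])
qed

lemma tent_bounds: "0 \<le> tent N U x" "tent N U x \<le> 1"
  by (auto simp: tent_def infdist_nonneg)

lemma tent_outside: "x \<notin> U \<Longrightarrow> tent N U x = 0"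
  by (auto simp: tent_def)

lemma tent_mono: "N \<le> N' \<Longrightarrow> tent N U x \<le> tent N' U x"
  unfolding tent_def by (simp del: min.bounded_iff add: min.mono mult_right_mono infdist_nonneg)

text \<open>The distance to the complement is positive at a point of an open set, so the limit 1 is
  attained from some index on, not only approached.\<close>

lemma tent_eventually:
  assumes "open U" "x \<in> U"
  shows "\<exists>N. \<forall>n\<ge>N. tent n U x = 1"
proof (cases "U = UNIV")
  case True then show ?thesis by (simp add: tent_def)
next
  case False
  then have pos: "infdist x (- U) > 0"
    using assms infdist_pos_not_in_closed[of "- U" x] by (auto simp: closed_Compl)
  obtain N where "inverse (infdist x (-U)) \<le> real N" using real_arch_simple by blast
  then have "1 \<le> real n * infdist x (- U)" if "n \<ge> N" for n
    using pos that by (smt (verit) field_class.field_inverse mult_right_mono of_nat_mono)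
  then show ?thesis using False by (auto simp: tent_def min_def)
qed

section \<open>Riesz representation of tight positive functionals\<close>

text \<open>Models a limit of integrals against measures from a tight family. The assumption
  \<open>tight\<close> is what remains of \<open>measure m (- T j) \<le> 1 / real (Suc j)\<close>
  when only integrals of continuous functions are visible; it supplies the countable additivity that
  linearity and positivity alone do not give.\<close>

locale tight_functional =
  fixes \<phi> :: "('b::metric_space \<Rightarrow> real) \<Rightarrow> real" and T :: "nat \<Rightarrow> 'b set"
  assumes add: "f \<in> Cb \<Longrightarrow> g \<in> Cb \<Longrightarrow> \<phi> (\<lambda>x. f x + g x) = \<phi> f + \<phi> g"
    and cmult: "f \<in> Cb \<Longrightarrow> \<phi> (\<lambda>x. c * f x) = c * \<phi> f"
    and pos: "f \<in> Cb \<Longrightarrow> (\<And>x. 0 \<le> f x) \<Longrightarrow> 0 \<le> \<phi> f"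
    and one: "\<phi> (\<lambda>_. 1) = 1"
    and compactT: "compact (T j)"
    and tight: "f \<in> Cb \<Longrightarrow> (\<And>x. 0 \<le> f x) \<Longrightarrow> (\<And>x. f x \<le> 1) \<Longrightarrow>
       (\<And>x. x \<in> T j \<Longrightarrow> f x \<le> \<eta>) \<Longrightarrow> 0 \<le> \<eta> \<Longrightarrow> \<phi> f \<le> \<eta> + 1 / real (Suc j)"
begin

lemma diff: "f \<in> Cb \<Longrightarrow> g \<in> Cb \<Longrightarrow> \<phi> (\<lambda>x. f x - g x) = \<phi> f - \<phi> g"
  using add[OF _ Cb_cmult[of g "-1"], of f] cmult[of g "-1"] by simp

lemma mono: "f \<in> Cb \<Longrightarrow> g \<in> Cb \<Longrightarrow> (\<And>x. f x \<le> g x) \<Longrightarrow> \<phi> f \<le> \<phi> g"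
  using pos[OF Cb_diff[of g f]] diff[of g f] by simp

lemma \<phi>_sum: "finite I \<Longrightarrow> (\<And>i. i \<in> I \<Longrightarrow> f i \<in> Cb) \<Longrightarrow> \<phi> (\<lambda>x. \<Sum>i\<in>I. f i x) = (\<Sum>i\<in>I. \<phi> (f i))"
proof (induction I rule: finite_induct)
  case empty then show ?case using cmult[OF Cb_const, of 0 0] by simp
next
  case (insert i I)
  then have "\<phi> (\<lambda>x. f i x + (\<Sum>i\<in>I. f i x)) = \<phi> (f i) + (\<Sum>i\<in>I. \<phi> (f i))"
    by (subst add) (auto intro: Cb_sum)
  then show ?case using insert by simp
qed

definition below :: "'b set \<Rightarrow> ('b \<Rightarrow> real) set" where
  "below U = {f \<in> Cb. \<forall>x. 0 \<le> f x \<and> f x \<le> 1 \<and> (x \<notin> U \<longrightarrow> f x = 0)}"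

text \<open>The content that Riesz's construction assigns to an open set, with test functions that
  need not have compact support.\<close>

definition open_content :: "'b set \<Rightarrow> real" where
  "open_content U = (SUP f\<in>below U. \<phi> f)"

lemma below_zero: "(\<lambda>_. 0) \<in> below U"
  by (auto simp: below_def Cb_const)

lemma \<phi>_below_le_1: "f \<in> below U \<Longrightarrow> \<phi> f \<le> 1"
  using mono[of f "\<lambda>_. 1"] one by (auto simp: below_def Cb_const)

lemma bdd_below_fun: "bdd_above (\<phi> ` below U)"
  by (rule bdd_aboveI2[where M=1]) (rule \<phi>_below_le_1)

lemma open_content_ge: "f \<in> below U \<Longrightarrow> \<phi> f \<le> open_content U"
  unfolding open_content_def by (rule cSUP_upper[OF _ bdd_below_fun])

lemma open_content_le: "(\<And>f. f \<in> below U \<Longrightarrow> \<phi> f \<le> b) \<Longrightarrow> open_content U \<le> b"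
  unfolding open_content_def using below_zero by (intro cSUP_least) auto

lemma open_content_nonneg: "0 \<le> open_content U"
  using open_content_ge[OF below_zero, of U] cmult[OF Cb_const, of 0 0] by simp

lemma open_content_mono: "U \<subseteq> V \<Longrightarrow> open_content U \<le> open_content V"
  by (rule open_content_le, rule open_content_ge) (auto simp: below_def)

lemma open_content_empty: "open_content {} = 0"
proof -
  have "below {} = {\<lambda>_. 0}" using below_zero[of "{}"] by (auto simp: below_def)
  then show ?thesis using cmult[OF Cb_const, of 0 0] by (simp add: open_content_def)
qed

lemma open_content_UNIV: "open_content UNIV = 1"
proof (rule antisym)
  show "open_content UNIV \<le> 1" by (rule open_content_le) (rule \<phi>_below_le_1)
  show "1 \<le> open_content UNIV" using open_content_ge[of "\<lambda>_. 1" UNIV] one by (auto simp: below_def Cb_const)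
qed

text \<open>Dini's theorem on \<open>T j\<close> replaces the compact supports of the usual Riesz argument.\<close>
lemma open_content_UN:
  fixes U :: "nat \<Rightarrow> 'b set"
  assumes "\<And>i. open (U i)"
  shows "ennreal (open_content (\<Union>i. U i)) \<le> (\<Sum>i. ennreal (open_content (U i)))"
proof -
  have key: "ennreal (\<phi> f) \<le> (\<Sum>i. ennreal (open_content (U i))) + ennreal e"
    if f: "f \<in> below (\<Union>i. U i)" and e: "e > 0" for f e
  proof -
    have fC: "f \<in> Cb" and f01: "\<And>x. 0 \<le> f x" "\<And>x. f x \<le> 1" and f0: "\<And>x. x \<notin> (\<Union>i. U i) \<Longrightarrow> f x = 0"
      using f by (auto simp: below_def)
    obtain j where j: "1 / real (Suc j) < e / 2" using e
      by (metis half_gt_zero nat_approx_posE)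
    \<comment> \<open>One index limits the number of tents and sets their steepness, so
      \<open>h\<close> increases in \<open>N\<close> and the sets \<open>V N\<close> form an
      increasing cover.\<close>
    define h where "h N x = (\<Sum>i<N. tent N (U i) x)" for N x
    have hC: "h N \<in> Cb" for N unfolding h_def by (rule Cb_sum) (rule tent_Cb)
    have hmono: "h N x \<le> h N' x" if "N \<le> N'" for N N' x
      unfolding h_def using that
      by (intro order_trans[OF sum_mono[OF tent_mono[OF that]] sum_mono2]) (auto simp: tent_bounds)
    define V where "V N = {x. f x - h N x < e / 2}" for N
    have Vopen: "open (V N)" for N
      unfolding V_def using Cb_diff[OF fC hC[of N]]
      by (intro open_Collect_less) (auto simp: Cb_def intro: continuous_intros)
    have cover: "T j \<subseteq> (\<Union>N. V N)"
    proof
      fix x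
      show "x \<in> (\<Union>N. V N)"
      proof (cases "x \<in> (\<Union>i. U i)")
        case True
        then obtain i where i: "x \<in> U i" by blast
        obtain N0 where N0: "\<forall>n\<ge>N0. tent n (U i) x = 1" using tent_eventually[OF assms i] by blast
        let ?N = "max N0 (Suc i)"
        have "tent ?N (U i) x \<le> h ?N x"
          unfolding h_def by (rule member_le_sum) (auto simp: tent_bounds)
        then have "x \<in> V ?N" using N0 f01(2)[of x] e by (simp add: V_def)
        then show ?thesis by blast
      next
        case False
        then have "x \<in> V 0" using f0[of x] e by (simp add: V_def h_def)
        then show ?thesis by blast
      qed
    qed
    obtain D where D: "finite D" "T j \<subseteq> (\<Union>N\<in>D. V N)"
      using compactE_image[OF compactT[of j], of UNIV V] Vopen cover by auto
    define N where "N = Max (insert 0 D)"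
    have "V N' \<subseteq> V N" if "N' \<in> D" for N'
    proof -
      have "N' \<le> N" using that D by (simp add: N_def)
      from hmono[OF this] show ?thesis unfolding V_def by (auto, smt (verit))
    qed
    then have TV: "T j \<subseteq> V N" using D by blast
    \<comment> \<open>\<open>g\<close> is the part of \<open>f\<close> left over by
      \<open>h N\<close>. It is at most \<open>e/2\<close> on \<open>T j\<close>, and
      \<open>tight\<close> charges only \<open>1 / real (Suc j)\<close> for the rest of the
      space.\<close>
    define g where "g x = max 0 (f x - h N x)" for x
    have gC: "g \<in> Cb" unfolding g_def by (intro Cb_max0 Cb_diff fC hC)
    have h0: "0 \<le> h N x" for x unfolding h_def by (intro sum_nonneg) (simp add: tent_bounds)
    have "\<phi> g \<le> e/2 + 1 / real (Suc j)"
    proof (rule tight[OF gC])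
      show "0 \<le> g x" for x by (simp add: g_def)
      show "g x \<le> 1" for x using f01(2)[of x] h0[of x] by (simp add: g_def)
      show "g x \<le> e/2" if "x \<in> T j" for x using subsetD[OF TV that] e unfolding g_def V_def max_def by simp
    qed (use e in auto)
    moreover have "\<phi> f \<le> \<phi> (\<lambda>x. h N x + g x)"
      by (rule mono[OF fC Cb_add[OF hC gC]]) (simp add: g_def)
    moreover have "\<phi> (\<lambda>x. h N x + g x) = \<phi> (h N) + \<phi> g" by (rule add[OF hC gC])
    moreover have "\<phi> (h N) = (\<Sum>i<N. \<phi> (tent N (U i)))"
      unfolding h_def by (rule \<phi>_sum) (auto simp: tent_Cb)
    moreover have "\<dots> \<le> (\<Sum>i<N. open_content (U i))"
      by (intro sum_mono open_content_ge) (auto simp: below_def tent_Cb tent_bounds tent_outside)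
    ultimately have "\<phi> f \<le> (\<Sum>i<N. open_content (U i)) + e" using j by linarith
    then have "ennreal (\<phi> f) \<le> ennreal ((\<Sum>i<N. open_content (U i)) + e)" by (rule ennreal_leI)
    also have "\<dots> = (\<Sum>i<N. ennreal (open_content (U i))) + ennreal e"
      using e by (subst ennreal_plus) (auto simp: sum_nonneg open_content_nonneg sum_ennreal)
    also have "\<dots> \<le> (\<Sum>i. ennreal (open_content (U i))) + ennreal e"
      by (intro add_right_mono sum_le_suminf) auto
    finally show ?thesis .
  qed
  show ?thesis
  proof (cases "(\<Sum>i. ennreal (open_content (U i))) = \<infinity>")
    case True then show ?thesis by simp
  next
    case False
    then obtain s where s: "s \<ge> 0" "(\<Sum>i. ennreal (open_content (U i))) = ennreal s"
      by (cases "(\<Sum>i. ennreal (open_content (U i)))") auto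
    have "open_content (\<Union>i. U i) \<le> s"
    proof (rule open_content_le)
      fix f assume f: "f \<in> below (\<Union>i. U i)"
      show "\<phi> f \<le> s"
      proof (rule field_le_epsilon)
        fix e :: real assume "e > 0"
        from key[OF f this] have "ennreal (\<phi> f) \<le> ennreal (s + e)"
          using s \<open>e > 0\<close> by (simp add: ennreal_plus)
        then show "\<phi> f \<le> s + e" using s \<open>e > 0\<close> by (subst (asm) ennreal_le_iff) auto
      qed
    qed
    then show ?thesis using s by (simp add: ennreal_leI)
  qed
qed

definition outer :: "'b set \<Rightarrow> ennreal" where
  "outer E = (INF U\<in>{U. open U \<and> E \<subseteq> U}. ennreal (open_content U))"

lemma outer_le: "open U \<Longrightarrow> E \<subseteq> U \<Longrightarrow> outer E \<le> ennreal (open_content U)"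
  unfolding outer_def by (rule INF_lower) auto

lemma outer_ge: "(\<And>U. open U \<Longrightarrow> E \<subseteq> U \<Longrightarrow> b \<le> ennreal (open_content U)) \<Longrightarrow> b \<le> outer E"
  unfolding outer_def by (rule INF_greatest) auto

lemma outer_open: "open U \<Longrightarrow> outer U = ennreal (open_content U)"
  by (intro antisym outer_le outer_ge ennreal_leI open_content_mono) auto

lemma outer_mono: "A \<subseteq> B \<Longrightarrow> outer A \<le> outer B"
  by (rule outer_ge, rule outer_le) auto

lemma outer_le_1: "outer E \<le> 1"
  using outer_le[of UNIV E] by (simp add: open_content_UNIV)

text \<open>Finiteness of \<open>outer E\<close>, from the bound by 1, makes it strictly smaller
  than its enlargement by \<open>e\<close>.\<close>

lemma outer_approx:
  assumes "e > 0"
  obtains U where "open U" "E \<subseteq> U" "ennreal (open_content U) \<le> outer E + ennreal e"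
proof -
  have "outer E < outer E + ennreal e"
    using le_less_trans[OF outer_le_1[of E] ennreal_one_less_top] assms
    by (cases "outer E") (auto simp flip: ennreal_plus simp: ennreal_less_iff)
  then show thesis
    using that unfolding outer_def INF_less_iff by (auto intro: less_imp_le)
qed

lemma outer_UN: "outer (\<Union>i. E i) \<le> (\<Sum>i. outer (E i))"
proof (rule ennreal_le_epsilon)
  fix e :: real assume e: "e > 0"
  have "\<exists>U. open U \<and> E i \<subseteq> U \<and> ennreal (open_content U) \<le> outer (E i) + ennreal (e * (1/2)^Suc i)" for i
    by (rule outer_approx[of "e * (1/2)^Suc i" "E i"]) (use e in auto)
  then obtain U where U: "\<And>i. open (U i)" "\<And>i. E i \<subseteq> U i"
    "\<And>i. ennreal (open_content (U i)) \<le> outer (E i) + ennreal (e * (1/2)^Suc i)" by metis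
  have "outer (\<Union>i. E i) \<le> ennreal (open_content (\<Union>i. U i))"
    using U by (intro outer_le) blast+
  also have "\<dots> \<le> (\<Sum>i. ennreal (open_content (U i)))" by (rule open_content_UN[OF U(1)])
  also have "\<dots> \<le> (\<Sum>i. outer (E i) + ennreal (e * (1/2)^Suc i))"
    by (intro suminf_le U) auto
  also have "\<dots> = (\<Sum>i. outer (E i)) + (\<Sum>i. ennreal (e * (1/2)^Suc i))"
    by (subst suminf_add) auto
  also have "(\<Sum>i. ennreal (e * (1/2)^Suc i)) = ennreal (e * 1)"
    using sums_mult[OF power_half_series, of e] e
    by (intro suminf_ennreal_eq) auto
  finally show "outer (\<Union>i. E i) \<le> (\<Sum>i. outer (E i)) + ennreal e" by simp
qed

lemma outer_empty: "outer {} = 0"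
  using outer_open[of "{}"] open_content_empty by simp

lemma outer_measure_space: "outer_measure_space (Pow UNIV) outer"
  unfolding outer_measure_space_def positive_def increasing_def countably_subadditive_def
  using outer_UN outer_mono outer_empty by auto

text \<open>Caratheodory's inequality for open sets. A test function \<open>f\<close> for
  \<open>V \<inter> U\<close> is added to a test function for a neighbourhood of
  \<open>V - U\<close>; without compact supports the two may overlap, but only where
  \<open>f\<close> is small.\<close>

lemma outer_open_split:
  assumes U: "open U"
  shows "outer (E \<inter> U) + outer (E - U) \<le> outer E"
proof (rule outer_ge)
  fix V assume V: "open V" "E \<subseteq> V"
  have real: "open_content (V \<inter> U) + enn2real (outer (V - U)) \<le> open_content V"
  proof (rule field_le_epsilon)
    fix e :: real assume e: "e > 0"
    define d where "d = e / 2"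
    have d: "d > 0" using e by (simp add: d_def)
    have "\<phi> f + enn2real (outer (V - U)) \<le> (1 + d) * open_content V" if f: "f \<in> below (V \<inter> U)" for f
    proof -
      \<comment> \<open>On \<open>V'\<close> the function \<open>f\<close> stays below
        \<open>d\<close>, and off \<open>V'\<close> the function \<open>g\<close> vanishes, so
        \<open>f + g \<le> 1 + d\<close> everywhere; dividing by \<open>1 + d\<close> gives an
        admissible function for \<open>V\<close>.\<close>
      define V' where "V' = V \<inter> {x. f x < d}"
      have fC: "f \<in> Cb" using f by (simp add: below_def)
      have V'o: "open V'" unfolding V'_def using fC V
        by (intro open_Int open_Collect_less) (auto simp: Cb_def)
      have "V - U \<subseteq> V'" using f d by (auto simp: V'_def below_def)
      then have "enn2real (outer (V - U)) \<le> open_content V'"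
        using outer_le[OF V'o, of "V - U"] by (simp add: open_content_nonneg enn2real_leI)
      moreover have "open_content V' \<le> (1 + d) * open_content V - \<phi> f"
      proof (rule open_content_le)
        fix g assume g: "g \<in> below V'"
        have gC: "g \<in> Cb" using g by (simp add: below_def)
        have "(\<lambda>x. (1/(1+d)) * (f x + g x)) \<in> below V"
        proof -
          have "(1/(1+d)) * (f x + g x) \<le> 1" for x
          proof (cases "x \<in> V'")
            case True
            then have "f x < d" "g x \<le> 1" using g by (auto simp: V'_def below_def)
            then show ?thesis using d by (simp add: field_simps)
          next
            case False
            then have "g x = 0" "f x \<le> 1" using f g by (auto simp: below_def)
            then show ?thesis using d by (simp add: field_simps)
          qed
          moreover have "f x = 0 \<and> g x = 0" if "x \<notin> V" for x
            using that f g by (auto simp: below_def V'_def)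
          moreover have "0 \<le> (1/(1+d)) * (f x + g x)" for x
            using f g d by (auto simp: below_def)
          ultimately show ?thesis
            using Cb_cmult[OF Cb_add[OF fC gC], of "1/(1+d)"] by (auto simp: below_def)
        qed
        from open_content_ge[OF this] have "(1/(1+d)) * (\<phi> f + \<phi> g) \<le> open_content V"
          by (simp only: cmult[OF Cb_add[OF fC gC]] add[OF fC gC])
        then show "\<phi> g \<le> (1 + d) * open_content V - \<phi> f" using d by (simp add: field_simps)
      qed
      ultimately show ?thesis by linarith
    qed
    then have "open_content (V \<inter> U) \<le> (1 + d) * open_content V - enn2real (outer (V - U))"
      by (intro open_content_le) (simp add: algebra_simps)
    moreover have "open_content V \<le> 1" using open_content_mono[of V UNIV] open_content_UNIV by simp
    then have "d * open_content V \<le> d" using mult_left_mono[of "open_content V" 1 d] d by simp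
    moreover have "(1 + d) * open_content V = open_content V + d * open_content V" by (simp add: algebra_simps)
    ultimately show "open_content (V \<inter> U) + enn2real (outer (V - U)) \<le> open_content V + e"
      using d e unfolding d_def by linarith
  qed
  have fin: "outer (V - U) < top"
    using outer_le_1[of "V - U"] by (simp add: le_less_trans)
  have "outer (E \<inter> U) + outer (E - U) \<le> outer (V \<inter> U) + outer (V - U)"
    using V by (intro add_mono outer_mono) auto
  also have "\<dots> = ennreal (open_content (V \<inter> U)) + ennreal (enn2real (outer (V - U)))"
    using fin V U by (simp add: outer_open open_Int)
  also have "\<dots> \<le> ennreal (open_content V)"
    using ennreal_leI[OF real] by (simp add: open_content_nonneg ennreal_plus)
  finally show "outer (E \<inter> U) + outer (E - U) \<le> ennreal (open_content V)" .
qed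

lemma open_lambda_system:
  assumes "open U"
  shows "U \<in> lambda_system UNIV (Pow UNIV) outer"
proof -
  interpret sigma_algebra UNIV "Pow (UNIV :: 'b set)" by (rule sigma_algebra_Pow)
  have "outer E \<le> outer (E \<inter> U) + outer (E - U)" for E
  proof -
    let ?F = "\<lambda>i::nat. if i = 0 then E \<inter> U else if i = 1 then E - U else {}"
    have "outer E = outer (\<Union>i. ?F i)" by (rule arg_cong[of _ _ outer]) (auto split: if_splits)
    also have "\<dots> \<le> (\<Sum>i. outer (?F i))" by (rule outer_UN)
    also have "\<dots> = (\<Sum>i\<in>{0,1}. outer (?F i))"
      by (rule suminf_finite) (auto simp: outer_empty)
    finally show ?thesis by simp
  qed
  then have "outer (E \<inter> U) + outer (E - U) = outer E" for E
    by (rule antisym[OF outer_open_split[OF assms]])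
  then show ?thesis unfolding lambda_system_eq by simp
qed

definition riesz :: "'b measure" where
  "riesz = measure_of UNIV (sets borel) outer"

text \<open>Caratheodory's measurable sets form a sigma-algebra that contains the open sets, hence
  all Borel sets.\<close>

lemma measure_space_riesz: "measure_space UNIV (sets (borel :: 'b measure)) outer"
proof -
  interpret sigma_algebra UNIV "Pow (UNIV :: 'b set)" by (rule sigma_algebra_Pow)
  let ?L = "lambda_system UNIV (Pow UNIV) outer"
  have ms: "measure_space UNIV ?L outer"
    by (rule caratheodory_lemma[OF outer_measure_space])
  then have "sigma_algebra UNIV ?L" by (simp add: measure_space_def)
  then have "sigma_sets UNIV {S :: 'b set. open S} \<subseteq> ?L"
    by (rule sigma_algebra.sigma_sets_subset) (use open_lambda_system in blast)
  then have "sets (borel :: 'b measure) \<subseteq> ?L" by (simp add: borel_def)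
  then show ?thesis
    using measure_down[OF ms] sets.sigma_algebra_axioms[of "borel :: 'b measure"] by simp
qed

lemma sets_riesz [simp]: "sets riesz = sets borel" 
  and space_riesz [simp]: "space riesz = UNIV"
  unfolding riesz_def using sets.sigma_sets_eq[of "borel :: 'b measure"] by auto

lemma emeasure_riesz: "A \<in> sets borel \<Longrightarrow> emeasure riesz A = outer A"
  using measure_space_riesz unfolding riesz_def
  by (intro emeasure_measure_of_sigma) (auto simp: measure_space_def)

lemma prob_space_riesz: "prob_space riesz"
  by (rule prob_spaceI) (simp add: emeasure_riesz outer_open open_content_UNIV)

lemma riesz_Pr: "riesz \<in> Pr"
  using prob_space_riesz by (simp add: Pr_def)

lemma measure_riesz_open: "open U \<Longrightarrow> measure riesz U = open_content U"
  by (simp add: measure_def emeasure_riesz outer_open open_content_nonneg)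

text \<open>Layer cake: \<open>N * f x\<close> is the sum of slices \<open>g k x\<close> of height
  1, and slice \<open>k\<close> lies between the indicators of \<open>G (Suc k)\<close> and
  \<open>G k\<close>. Passing from one to the other shifts the index once and costs at most
  \<open>1 / N\<close>.\<close>

lemma \<phi>_le_integral:
  assumes fC: "f \<in> Cb" and f01: "\<And>x. 0 \<le> f x" "\<And>x. f x \<le> 1"
  shows "\<phi> f \<le> (\<integral>x. f x \<partial>riesz)"
proof (rule field_le_epsilon)
  fix e :: real assume e: "e > 0"
  interpret prob_space riesz by (rule prob_space_riesz)
  obtain n where n: "1 / real (Suc n) < e" using e by (metis nat_approx_posE)
  define N where "N = real (Suc n)"
  have N: "N > 0" by (simp add: N_def)
  define g where "g k x = min 1 (max 0 (N * f x - real k))" for k x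
  have gC: "g k \<in> Cb" for k
    unfolding g_def by (intro Cb_min Cb_max0 Cb_diff Cb_cmult Cb_const fC)
  define G where "G k = {x. N * f x > real k}" for k
  have Gopen: "open (G k)" for k
    unfolding G_def using fC by (intro open_Collect_less) (auto simp: Cb_def intro!: continuous_intros)
  have gb: "g k \<in> below (G k)" for k
    using gC by (auto simp: below_def g_def G_def)
  have telescope: "(\<Sum>k<m. min 1 (max 0 (t - real k))) = min (real m) t" if "t \<ge> 0" for m and t :: real
    using that by (induction m) (auto simp: min_def max_def)
  have sum_g: "N * f x = (\<Sum>k<Suc n. g k x)" for x
    using telescope[of "N * f x" "Suc n"] f01[of x] N
    by (simp add: g_def N_def min_def mult_le_cancel_left1 del: sum.lessThan_Suc of_nat_Suc)
  have "N * \<phi> f = (\<Sum>k<Suc n. \<phi> (g k))"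
    using \<phi>_sum[of "{..<Suc n}" g] gC cmult[OF fC, of N] sum_g by simp
  also have "\<dots> \<le> (\<Sum>k<Suc n. measure riesz (G k))"
    by (intro sum_mono) (simp add: measure_riesz_open[OF Gopen] open_content_ge[OF gb])
  \<comment> \<open>The set \<open>G 0\<close> is bounded by the total mass 1; this is the source of
    the error \<open>1 / N\<close>.\<close>
  also have "\<dots> \<le> 1 + (\<Sum>k<n. measure riesz (G (Suc k)))"
    unfolding sum.lessThan_Suc_shift by (intro add_right_mono) simp
  also have "(\<Sum>k<n. measure riesz (G (Suc k))) \<le> (\<Sum>k<n. \<integral>x. g k x \<partial>riesz)"
  proof (rule sum_mono)
    fix k
    have "measure riesz (G (Suc k)) = (\<integral>x. indicator (G (Suc k)) x \<partial>riesz)"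
      using Gopen by simp
    also have "\<dots> \<le> (\<integral>x. g k x \<partial>riesz)"
    proof (rule integral_mono)
      show "integrable riesz (indicator (G (Suc k)) :: _ \<Rightarrow> real)"
        using Gopen by (intro integrable_real_indicator) (auto simp: less_top[symmetric])
      show "integrable riesz (g k)" by (rule Pr_integrable[OF riesz_Pr gC])
    qed (auto simp: indicator_def G_def g_def)
    finally show "measure riesz (G (Suc k)) \<le> (\<integral>x. g k x \<partial>riesz)" .
  qed
  also have "(\<Sum>k<n. \<integral>x. g k x \<partial>riesz) \<le> (\<Sum>k<Suc n. \<integral>x. g k x \<partial>riesz)"
    by (auto intro!: Bochner_Integration.integral_nonneg simp: g_def)
  also have "(\<Sum>k<Suc n. \<integral>x. g k x \<partial>riesz) = N * (\<integral>x. f x \<partial>riesz)"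
    using Pr_integrable[OF riesz_Pr gC]
    by (subst Bochner_Integration.integral_sum[symmetric]) (auto simp only: sum_g[symmetric] integral_mult_right_zero)
  finally have "\<phi> f \<le> (\<integral>x. f x \<partial>riesz) + 1 / N" using N by (simp add: field_simps)
  then show "\<phi> f \<le> (\<integral>x. f x \<partial>riesz) + e" using n by (simp add: N_def)
qed

text \<open>The reverse inequality is the previous lemma for \<open>1 - f\<close>; a general
  \<open>f\<close> is first moved into the unit interval by an affine map.\<close>

lemma \<phi>_eq_integral:
  assumes fC: "f \<in> Cb"
  shows "\<phi> f = (\<integral>x. f x \<partial>riesz)"
proof -
  interpret prob_space riesz by (rule prob_space_riesz)
  have unit: "\<phi> f = (\<integral>x. f x \<partial>riesz)"
    if fC: "f \<in> Cb" and f01: "\<And>x. 0 \<le> f x" "\<And>x. f x \<le> 1" for f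
  proof (rule antisym)
    show "\<phi> f \<le> (\<integral>x. f x \<partial>riesz)" by (rule \<phi>_le_integral[OF that])
    have "\<phi> (\<lambda>x. 1 - f x) \<le> (\<integral>x. 1 - f x \<partial>riesz)"
      using f01 by (intro \<phi>_le_integral Cb_diff Cb_const fC) auto
    then show "(\<integral>x. f x \<partial>riesz) \<le> \<phi> f"
      using diff[OF Cb_const fC, of 1] one Pr_integrable[OF riesz_Pr fC]
      using prob_space by simp
  qed
  obtain B where B: "B > 0" "\<And>x. \<bar>f x\<bar> \<le> B" using fC by (elim CbE) auto
  let ?g = "\<lambda>x. (1 / (2*B)) * (f x + B)"
  have gC: "?g \<in> Cb" by (intro Cb_cmult Cb_add Cb_const fC)
  have "\<phi> ?g = (\<integral>x. ?g x \<partial>riesz)"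
  proof (rule unit[OF gC])
    fix x show "0 \<le> ?g x" "?g x \<le> 1" using B(1) B(2)[of x] by (auto simp: field_simps abs_le_iff)
  qed
  moreover have "\<phi> ?g = (1/(2*B)) * (\<phi> f + B)"
    using cmult[OF Cb_add[OF fC Cb_const], of "1/(2*B)" B] add[OF fC Cb_const, of B]
      cmult[OF Cb_const, of B 1] one by simp
  moreover have "(\<integral>x. ?g x \<partial>riesz) = (1/(2*B)) * ((\<integral>x. f x \<partial>riesz) + B)"
    using Pr_integrable[OF riesz_Pr fC] prob_space by simp
  ultimately show ?thesis using B by simp
qed

text \<open>Tightness is recovered with the same constants, so the representing measure belongs to
  the very family whose limits are taken. Closedness of that family depends on this.\<close>

lemma riesz_tight: "measure riesz (- T j) \<le> 1 / real (Suc j)"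
proof -
  have op: "open (- T j)" using compactT[of j] by (simp add: compact_imp_closed open_Compl)
  have "open_content (- T j) \<le> 0 + 1 / real (Suc j)"
    by (rule open_content_le, rule tight) (auto simp: below_def)
  then show ?thesis by (simp add: measure_riesz_open[OF op])
qed

end

section \<open>Weak compactness of tight families\<close>

definition tight_set :: "(nat \<Rightarrow> 'a::metric_space set) \<Rightarrow> 'a measure set" where
  "tight_set T = {m \<in> Pr. \<forall>j. measure m (- T j) \<le> 1 / real (Suc j)}"

lemma Pr_integral_tight:
  assumes m: "m \<in> tight_set T" and T: "compact (T j)" and f: "f \<in> Cb" "\<And>x. f x \<le> 1"
    "\<And>x. x \<in> T j \<Longrightarrow> f x \<le> \<eta>" "0 \<le> \<eta>"
  shows "(\<integral>x. f x \<partial>m) \<le> \<eta> + 1 / real (Suc j)"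
proof -
  have mP: "m \<in> Pr" using m by (simp add: tight_set_def)
  interpret prob_space m by (rule PrD(2)[OF mP])
  have S: "- T j \<in> sets m" using T PrD(1)[OF mP] by (simp add: compact_imp_closed)
  have "(\<integral>x. f x \<partial>m) \<le> (\<integral>x. \<eta> + indicator (- T j) x \<partial>m)"
  proof (rule integral_mono)
    show "integrable m f" by (rule Pr_integrable[OF mP f(1)])
    show "integrable m (\<lambda>x. \<eta> + indicator (- T j) x)"
      using S by (auto simp: less_top[symmetric])
    show "f x \<le> \<eta> + indicator (- T j) x" for x
      using f(2)[of x] f(3)[of x] f(4) by (cases "x \<in> T j") auto
  qed
  also have "\<dots> = \<eta> + measure m (- T j)"
    using S prob_space by (subst Bochner_Integration.integral_add) (auto simp: less_top[symmetric])
  finally show ?thesis using m by (auto simp: tight_set_def intro: order_trans)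
qed

lemma closed_coordinate_eq:
  fixes F G :: "('i \<Rightarrow> real) \<Rightarrow> real"
  assumes "continuous_on UNIV F" "continuous_on UNIV G"
  shows "closed {\<phi>. F \<phi> = G \<phi>}" "closed {\<phi>. F \<phi> \<le> G \<phi>}"
  using assms by (auto intro: closed_Collect_eq closed_Collect_le)

text \<open>Each assumption of \<open>tight_functional\<close>, for fixed test functions, is a
  closed condition on finitely many coordinates; limit points of integral functionals inherit it
  through this lemma.\<close>

lemma closure_inherit:
  assumes "closed {\<phi>. P \<phi>}" "\<And>m. m \<in> K \<Longrightarrow> P (e m)" "\<phi> \<in> closure (e ` K)"
  shows "P \<phi>"
proof -
  have "e ` K \<subseteq> {\<phi>. P \<phi>}" using assms(2) by auto
  from closure_minimal[OF this assms(1)] assms(3) show ?thesis by auto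
qed

text \<open>The compactness half of Prokhorov's theorem. The image under \<open>wint\<close> is
  closed, since its limit points are represented by \<open>riesz\<close>, and it lies in a product
  of compact intervals.\<close>

theorem compactin_tight_set:
  fixes T :: "nat \<Rightarrow> 'a::metric_space set"
  assumes T: "\<And>j. compact (T j)"
  shows "compactin weak_top (tight_set T)"
proof (rule compactin_weak_topI)
  let ?K = "tight_set T"
  show KPr: "?K \<subseteq> Pr" by (auto simp: tight_set_def)
  note [continuous_intros] = continuous_on_product_coordinates
  have "wint ` ?K = closure (wint ` ?K)"
  proof (rule antisym[OF closure_subset subsetI])
    fix \<phi> assume \<phi>: "\<phi> \<in> closure (wint ` ?K)"
    note inh = closure_inherit[OF _ _ \<phi>]
    have int: "integrable m f" if "m \<in> ?K" "f \<in> Cb" for m f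
      using that KPr by (auto intro: Pr_integrable)
    interpret tight_functional \<phi> T
    proof
      fix f g :: "'a \<Rightarrow> real" assume f: "f \<in> Cb" and g: "g \<in> Cb"
      show "\<phi> (\<lambda>x. f x + g x) = \<phi> f + \<phi> g"
        by (rule inh[where P="\<lambda>\<phi>. \<phi> (\<lambda>x. f x + g x) = \<phi> f + \<phi> g"])
           (auto simp: wint_def f g Cb_add int intro!: closed_coordinate_eq continuous_intros)
    next
      fix f :: "'a \<Rightarrow> real" and c assume f: "f \<in> Cb"
      show "\<phi> (\<lambda>x. c * f x) = c * \<phi> f"
        by (rule inh[where P="\<lambda>\<phi>. \<phi> (\<lambda>x. c * f x) = c * \<phi> f"])
           (auto simp: wint_def f Cb_cmult int intro!: closed_coordinate_eq continuous_intros)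
    next
      fix f :: "'a \<Rightarrow> real" assume f: "f \<in> Cb" "\<And>x. 0 \<le> f x"
      show "0 \<le> \<phi> f"
        by (rule inh[where P="\<lambda>\<phi>. 0 \<le> \<phi> f"])
           (auto simp: wint_def f int intro!: closed_coordinate_eq continuous_intros)
    next
      show "\<phi> (\<lambda>_. 1) = 1"
        by (rule inh[where P="\<lambda>\<phi>. \<phi> (\<lambda>_. 1) = 1"])
           (auto simp: wint_def Cb_const tight_set_def Pr_def prob_space.prob_space
             intro!: closed_coordinate_eq continuous_intros)
    next
      fix f :: "'a \<Rightarrow> real" and j \<eta>
      assume f: "f \<in> Cb" "\<And>x. 0 \<le> f x" "\<And>x. f x \<le> 1" "\<And>x. x \<in> T j \<Longrightarrow> f x \<le> \<eta>" "0 \<le> \<eta>"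
      show "\<phi> f \<le> \<eta> + 1 / real (Suc j)"
        by (rule inh[where P="\<lambda>\<phi>. \<phi> f \<le> \<eta> + 1 / real (Suc j)"])
           (use Pr_integral_tight[OF _ T f(1,3,4,5)] in
             \<open>auto simp: wint_def f(1) intro!: closed_coordinate_eq continuous_intros\<close>)
    qed (rule T)
    \<comment> \<open>Coordinates outside \<open>Cb\<close> carry no information; the default 0
      makes \<open>\<phi>\<close> and \<open>wint riesz\<close> agree there too.\<close>
    have out: "\<phi> f = 0" if "f \<notin> Cb" for f
      by (rule inh[where P="\<lambda>\<phi>. \<phi> f = 0"])
         (auto simp: wint_def that intro!: closed_coordinate_eq continuous_intros)
    have "\<phi> = wint riesz" using \<phi>_eq_integral out by (auto simp: wint_def fun_eq_iff)
    moreover have "riesz \<in> ?K" using riesz_Pr riesz_tight by (simp add: tight_set_def)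
    ultimately show "\<phi> \<in> wint ` ?K" by blast
  qed
  then have cl: "closed (wint ` ?K)" by (metis closed_closure)
  obtain b :: "('a \<Rightarrow> real) \<Rightarrow> real" where b: "\<And>f x. f \<in> Cb \<Longrightarrow> \<bar>f x\<bar> \<le> b f" 
    by (metis CbE)
  let ?I = "\<lambda>f. if f \<in> Cb then {- b f..b f} else {0}"
  have "compactin (product_topology (\<lambda>_. euclidean) UNIV) (PiE UNIV ?I)"
    by (subst compactin_PiE) auto
  then have "compact (PiE UNIV ?I)" by (simp add: euclidean_product_topology)
  moreover have "wint ` ?K \<subseteq> PiE UNIV ?I"
  proof (rule image_subsetI)
    fix m assume m: "m \<in> ?K"
    then have mP: "m \<in> Pr" using KPr by blast
    interpret prob_space m by (rule PrD(2)[OF mP])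
    have "\<bar>\<integral>x. f x \<partial>m\<bar> \<le> b f" if "f \<in> Cb" for f
    proof -
      have "\<bar>\<integral>x. f x \<partial>m\<bar> \<le> (\<integral>x. \<bar>f x\<bar> \<partial>m)" by (rule integral_abs_bound)
      also have "\<dots> \<le> (\<integral>x. b f \<partial>m)"
        using b[OF that] Pr_integrable[OF mP that] by (intro integral_mono) auto
      finally show ?thesis by (simp add: prob_space)
    qed
    then show "wint m \<in> PiE UNIV ?I" by (auto simp: wint_def abs_le_iff minus_le_iff)
  qed
  ultimately show "compact (wint ` ?K)"
    using compact_Int_closed[OF _ cl, of "PiE UNIV ?I"] by (simp only: Int_absorb1)
qed

subsection \<open>Relative entropy\<close>

text \<open>The sum dominates both measures, so a single approximation in its L1 norm serves both at
  once.\<close>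

definition sum_meas :: "'a measure \<Rightarrow> 'a measure \<Rightarrow> 'a measure" where
  "sum_meas M N = measure_of (space M) (sets M) (\<lambda>A. emeasure M A + emeasure N A)"

lemma sets_sum_meas [simp]: "sets (sum_meas M N) = sets M"
  unfolding sum_meas_def by simp

lemma emeasure_sum_meas:
  assumes "sets N = sets M" "A \<in> sets M"
  shows "emeasure (sum_meas M N) A = emeasure M A + emeasure N A"
  unfolding sum_meas_def
proof (rule emeasure_measure_of_sigma)
  show "sigma_algebra (space M) (sets M)" by (rule sets.sigma_algebra_axioms)
  show "positive (sets M) (\<lambda>A. emeasure M A + emeasure N A)" by (simp add: positive_def)
  show "countably_additive (sets M) (\<lambda>A. emeasure M A + emeasure N A)"
  proof (rule countably_additiveI)
    fix A :: "nat \<Rightarrow> 'a set" assume "range A \<subseteq> sets M" "disjoint_family A"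
    then show "(\<Sum>i. emeasure M (A i) + emeasure N (A i)) = emeasure M (\<Union> (range A)) + emeasure N (\<Union> (range A))"
      using assms(1) by (subst suminf_add[symmetric]) (auto simp: suminf_emeasure)
  qed
qed fact

lemma finite_sum_meas:
  assumes "sets N = sets M" "finite_measure M" "finite_measure N"
  shows "finite_measure (sum_meas M N)"
proof (rule finite_measureI)
  have "space (sum_meas M N) = space M" "space N = space M"
    using assms(1) sets_sum_meas[of M N] by (blast dest: sets_eq_imp_space_eq)+
  then show "emeasure (sum_meas M N) (space (sum_meas M N)) \<noteq> \<infinity>"
    using assms emeasure_sum_meas[OF assms(1), of "space M"]
    by (metis ennreal_add_eq_top finite_measure.emeasure_finite infinity_ennreal_def sets.top)
qed

text \<open>Outer regularity replaces a Borel set by an open one, and tents approximate the open set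
  by dominated convergence; sums and limits follow by induction over integrable functions.\<close>

lemma L1_dense_Cb:
  fixes \<kappa> :: "'a::polish_space measure"
  assumes \<kappa>: "sets \<kappa> = sets borel" "finite_measure \<kappa>" and f: "integrable \<kappa> f" and e: "e > 0"
  shows "\<exists>g\<in>Cb. (\<integral>x. \<bar>f x - g x\<bar> \<partial>\<kappa>) < (e::real)"
proof -
  interpret finite_measure \<kappa> by fact
  note Cint = Cb_integrable[OF \<kappa>]
  have "\<forall>e>0. \<exists>g\<in>Cb. (\<integral>x. \<bar>f x - g x\<bar> \<partial>\<kappa>) < e"
    using f
  proof (induction rule: integrable_induct)
    case (base A c)
    show ?case
    proof (intro allI impI)
      fix e :: real assume e: "e > 0"
      \<comment> \<open>Two errors of size \<open>d\<close> get multiplied by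
        \<open>\<bar>c\<bar>\<close>; the summand 1 avoids a division by zero.\<close>
      define d where "d = e / (2 * (\<bar>c\<bar> + 1))"
      have d: "d > 0" using e by (simp add: d_def)
      have "emeasure \<kappa> A < emeasure \<kappa> A + ennreal d"
        using d by (simp add: emeasure_eq_measure ennreal_less_iff flip: ennreal_plus)
      moreover have "emeasure \<kappa> A = (INF U \<in> {U. A \<subseteq> U \<and> open U}. emeasure \<kappa> U)"
        using base \<kappa> by (intro outer_regular) (auto simp: emeasure_eq_measure)
      ultimately obtain U where U: "A \<subseteq> U" "open U" "emeasure \<kappa> U < emeasure \<kappa> A + ennreal d"
        by (auto simp: INF_less_iff)
      have Us: "U \<in> sets \<kappa>" using U \<kappa> by simp
      have mU: "measure \<kappa> U - measure \<kappa> A < d"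
        using U(3) d by (simp add: emeasure_eq_measure ennreal_less_iff flip: ennreal_plus)
      have "(\<lambda>N. \<integral>x. \<bar>indicator U x - tent N U x\<bar> \<partial>\<kappa>) \<longlonglongrightarrow> (\<integral>x. 0 \<partial>\<kappa>)"
      proof (rule integral_dominated_convergence[where w="\<lambda>_. 1"])
        show "(\<lambda>x. \<bar>indicator U x - tent N U x\<bar>) \<in> borel_measurable \<kappa>" for N
          using Us Cint[OF tent_Cb] by (auto intro!: borel_measurable_abs borel_measurable_diff)
        show "AE x in \<kappa>. (\<lambda>N. \<bar>indicator U x - tent N U x\<bar>) \<longlonglongrightarrow> 0"
        proof (rule AE_I2, rule tendsto_eventually)
          fix x
          show "\<forall>\<^sub>F N in sequentially. \<bar>indicator U x - tent N U x\<bar> = 0"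
            using tent_eventually[OF U(2), of x] tent_outside[of x U]
            by (cases "x \<in> U") (auto simp: eventually_sequentially)
        qed
        show "AE x in \<kappa>. norm \<bar>indicator U x - tent N U x\<bar> \<le> 1" for N
          using tent_bounds[of N U] by (auto simp: indicator_def tent_outside)
      qed auto
      then have "\<forall>\<^sub>F N in sequentially. (\<integral>x. \<bar>indicator U x - tent N U x\<bar> \<partial>\<kappa>) < d"
        using d by (auto dest!: order_tendstoD(2)[where a=d])
      then obtain N where N: "(\<integral>x. \<bar>indicator U x - tent N U x\<bar> \<partial>\<kappa>) < d"
        by (auto simp: eventually_sequentially)
      have iU: "integrable \<kappa> (indicator U :: _ \<Rightarrow> real)" "integrable \<kappa> (indicator A :: _ \<Rightarrow> real)"
        using Us base(1) by (auto simp: emeasure_eq_measure)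
      note it = Cint[OF tent_Cb, of N U]
      have "(\<integral>x. \<bar>indicator A x *\<^sub>R c - c * tent N U x\<bar> \<partial>\<kappa>)
          \<le> (\<integral>x. \<bar>c\<bar> * ((indicator U x - indicator A x) + \<bar>indicator U x - tent N U x\<bar>) \<partial>\<kappa>)"
      proof (rule integral_mono)
        show "integrable \<kappa> (\<lambda>x. \<bar>indicator A x *\<^sub>R c - c * tent N U x\<bar>)"
          using iU it by (auto intro!: integrable_abs)
        show "integrable \<kappa> (\<lambda>x. \<bar>c\<bar> * ((indicator U x - indicator A x) + \<bar>indicator U x - tent N U x\<bar>))"
          using iU it by (intro integrable_mult_right Bochner_Integration.integrable_add
             Bochner_Integration.integrable_diff integrable_abs)
        fix x
        have "indicator A x *\<^sub>R c - c * tent N U x = c * (indicator A x - tent N U x)"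
          by (simp add: algebra_simps)
        then have "\<bar>indicator A x *\<^sub>R c - c * tent N U x\<bar> = \<bar>c\<bar> * \<bar>indicator A x - tent N U x\<bar>"
          by (simp add: abs_mult)
        also have "\<dots> \<le> \<bar>c\<bar> * ((indicator U x - indicator A x) + \<bar>indicator U x - tent N U x\<bar>)"
          using U(1) by (intro mult_left_mono) (auto simp: indicator_def)
        finally show "\<bar>indicator A x *\<^sub>R c - c * tent N U x\<bar>
          \<le> \<bar>c\<bar> * ((indicator U x - indicator A x) + \<bar>indicator U x - tent N U x\<bar>)" .
      qed
      also have "\<dots> = \<bar>c\<bar> * ((measure \<kappa> U - measure \<kappa> A) + (\<integral>x. \<bar>indicator U x - tent N U x\<bar> \<partial>\<kappa>))"
        using iU it Us base(1) by simp
      also have "\<dots> \<le> \<bar>c\<bar> * (d + d)" using mU N by (intro mult_left_mono add_mono) auto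
      also have "\<dots> < (\<bar>c\<bar> + 1) * (2 * d)" using d by (simp add: algebra_simps)
      also have "\<dots> = e" unfolding d_def by (simp add: field_simps add_nonneg_eq_0_iff)
      finally show "\<exists>g\<in>Cb. (\<integral>x. \<bar>indicator A x *\<^sub>R c - g x\<bar> \<partial>\<kappa>) < e"
        using Cb_cmult[OF tent_Cb, of c N U] by (intro bexI)
    qed
  next
    case (add f g)
    show ?case
    proof (intro allI impI)
      fix e :: real assume "e > 0"
      then obtain f' g' where f': "f' \<in> Cb" "(\<integral>x. \<bar>f x - f' x\<bar> \<partial>\<kappa>) < e/2"
        and g': "g' \<in> Cb" "(\<integral>x. \<bar>g x - g' x\<bar> \<partial>\<kappa>) < e/2"
        using add.IH half_gt_zero by metis
      note i = add.hyps(1,2) Cint[OF f'(1)] Cint[OF g'(1)]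
      have "(\<integral>x. \<bar>f x + g x - (f' x + g' x)\<bar> \<partial>\<kappa>) \<le> (\<integral>x. \<bar>f x - f' x\<bar> + \<bar>g x - g' x\<bar> \<partial>\<kappa>)"
        using i by (intro integral_mono) auto
      also have "\<dots> < e" using f' g' i by simp
      finally show "\<exists>h\<in>Cb. (\<integral>x. \<bar>f x + g x - h x\<bar> \<partial>\<kappa>) < e"
        using Cb_add[OF f'(1) g'(1)] by (intro bexI)
    qed
  next
    case (lim f s)
    show ?case
    proof (intro allI impI)
      fix e :: real assume e: "e > 0"
      have "(\<lambda>i. \<integral>x. \<bar>f x - s i x\<bar> \<partial>\<kappa>) \<longlonglongrightarrow> (\<integral>x. 0 \<partial>\<kappa>)"
      proof (rule integral_dominated_convergence[where w="\<lambda>x. 3 * \<bar>f x\<bar>"])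
        show "AE x in \<kappa>. (\<lambda>i. \<bar>f x - s i x\<bar>) \<longlonglongrightarrow> 0"
          using lim by (auto intro!: AE_I2 tendsto_eq_intros)
        show "AE x in \<kappa>. norm \<bar>f x - s i x\<bar> \<le> 3 * \<bar>f x\<bar>" for i
        proof (rule AE_I2)
          fix x assume "x \<in> space \<kappa>"
          from lim.hyps(3)[OF this, of i] show "norm \<bar>f x - s i x\<bar> \<le> 3 * \<bar>f x\<bar>" by simp
        qed
      qed (use lim in \<open>auto\<close>)
      then have "\<forall>\<^sub>F i in sequentially. (\<integral>x. \<bar>f x - s i x\<bar> \<partial>\<kappa>) < e/2"
        using e by (auto dest!: order_tendstoD(2)[where a="e/2"])
      then obtain i where i: "(\<integral>x. \<bar>f x - s i x\<bar> \<partial>\<kappa>) < e/2" by (auto simp: eventually_sequentially)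
      obtain g where g: "g \<in> Cb" "(\<integral>x. \<bar>s i x - g x\<bar> \<partial>\<kappa>) < e/2" using lim.IH e half_gt_zero by metis
      note int = lim.hyps(1)[of i] lim.hyps(4) Cint[OF g(1)]
      have "(\<integral>x. \<bar>f x - g x\<bar> \<partial>\<kappa>) \<le> (\<integral>x. \<bar>f x - s i x\<bar> + \<bar>s i x - g x\<bar> \<partial>\<kappa>)"
        using int by (intro integral_mono) auto
      also have "\<dots> < e" using i g int by simp
      finally show "\<exists>h\<in>Cb. (\<integral>x. \<bar>f x - h x\<bar> \<partial>\<kappa>) < e" using g by blast
    qed
  qed
  with e show ?thesis by blast
qed

lemma bounded_integrable:
  assumes "m \<in> Pr" "f \<in> borel_measurable borel" "\<And>x. \<bar>f x :: real\<bar> \<le> B"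
  shows "integrable m f"
proof -
  interpret prob_space m using assms(1) by (rule PrD)
  show ?thesis
    using assms PrD(1)[OF assms(1)]
    by (intro integrable_const_bound[where B=B]) (auto cong: measurable_cong_sets)
qed

text \<open>Clipping the approximant to the range of \<open>f\<close> does not increase its distance
  from \<open>f\<close> and keeps the uniform bound \<open>B\<close>, which later controls
  \<open>exp (g x)\<close>.\<close>

lemma L1_dense_Cb_two:
  fixes m l :: "'a::polish_space measure"
  assumes m: "m \<in> Pr" and l: "l \<in> Pr" and f: "f \<in> borel_measurable borel" "\<And>x. \<bar>f x\<bar> \<le> B"
    and e: "e > 0"
  obtains g where "g \<in> Cb" "\<And>x. \<bar>g x\<bar> \<le> B"
    "(\<integral>x. \<bar>f x - g x\<bar> \<partial>m) < e" "(\<integral>x. \<bar>f x - g x\<bar> \<partial>l) < e"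
proof -
  let ?k = "sum_meas m l"
  have sets: "sets l = sets m" "sets ?k = sets borel" using m l by (auto simp: Pr_def)
  have fin: "finite_measure ?k"
    using m l by (intro finite_sum_meas) (auto simp: Pr_def prob_space.finite_measure)
  interpret finite_measure ?k by fact
  have "integrable ?k f"
    using f sets by (intro integrable_const_bound[where B=B]) (auto cong: measurable_cong_sets)
  from L1_dense_Cb[OF sets(2) fin this e] obtain g0 where g0: "g0 \<in> Cb" "(\<integral>x. \<bar>f x - g0 x\<bar> \<partial>?k) < e" by blast
  define g where "g x = max (-B) (min B (g0 x))" for x
  have B: "B \<ge> 0" using f(2)[of undefined] by linarith
  have gb: "\<bar>g x\<bar> \<le> B" for x using B by (auto simp: g_def)
  have gC: "g \<in> Cb"
  proof (rule CbI[OF _ gb])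
    show "continuous_on UNIV g" using g0(1) unfolding g_def[abs_def] Cb_def
      by (intro continuous_on_max continuous_on_min continuous_on_const) auto
  qed
  have le: "\<bar>f x - g x\<bar> \<le> \<bar>f x - g0 x\<bar>" for x using f(2)[of x] by (auto simp: g_def)
  have gm: "(\<lambda>x. \<bar>f x - g x\<bar>) \<in> borel_measurable borel"
    using f(1) Cb_measurable[OF gC] by measurable
  have fg: "integrable ?k (\<lambda>x. \<bar>f x - g x\<bar>)"
    using \<open>integrable ?k f\<close> Cb_integrable[OF sets(2) fin gC] by auto
  have "(\<integral>x. \<bar>f x - g x\<bar> \<partial>?k) \<le> (\<integral>x. \<bar>f x - g0 x\<bar> \<partial>?k)"
    using \<open>integrable ?k f\<close> Cb_integrable[OF sets(2) fin g0(1)] fg le by (intro integral_mono) auto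
  also note g0(2)
  finally have ke: "(\<integral>x. \<bar>f x - g x\<bar> \<partial>?k) < e" .
  have part: "(\<integral>x. \<bar>f x - g x\<bar> \<partial>n) < e"
    if n: "sets n = sets borel" "n \<in> Pr" and nk: "\<And>A. A \<in> sets borel \<Longrightarrow> emeasure n A \<le> emeasure ?k A" for n
  proof -
    have "n \<le> ?k"
      using n(1) sets nk by (subst le_measure) auto
    then have "(\<integral>\<^sup>+x. ennreal \<bar>f x - g x\<bar> \<partial>n) \<le> (\<integral>\<^sup>+x. ennreal \<bar>f x - g x\<bar> \<partial>?k)"
      using n(1) sets by (intro nn_integral_mono_measure) auto
    also have "\<dots> = ennreal (\<integral>x. \<bar>f x - g x\<bar> \<partial>?k)" by (intro nn_integral_eq_integral fg) auto
    finally have "(\<integral>\<^sup>+x. ennreal \<bar>f x - g x\<bar> \<partial>n) \<le> ennreal (\<integral>x. \<bar>f x - g x\<bar> \<partial>?k)" .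
    moreover have "(\<integral>\<^sup>+x. ennreal \<bar>f x - g x\<bar> \<partial>n) = ennreal (\<integral>x. \<bar>f x - g x\<bar> \<partial>n)"
    proof (intro nn_integral_eq_integral bounded_integrable[OF n(2) gm, of "2*B"])
      show "\<bar>\<bar>f x - g x\<bar>\<bar> \<le> 2 * B" for x using f(2)[of x] gb[of x] by linarith
    qed auto
    ultimately show ?thesis using ke by (simp add: ennreal_le_iff)
  qed
  show thesis
    by (rule that[OF gC gb]; rule part) (use m l sets in \<open>auto simp: emeasure_sum_meas Pr_def\<close>)
qed

section \<open>The Donsker-Varadhan functional\<close>

definition dv :: "('a \<Rightarrow> real) \<Rightarrow> 'a measure \<Rightarrow> 'a measure \<Rightarrow> real" where
  "dv f m l = (\<integral>x. f x \<partial>m) - ln (\<integral>x. exp (f x) \<partial>l)"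

lemma exp_diff_le:
  fixes a b B :: real
  assumes "a \<le> B" "b \<le> B"
  shows "\<bar>exp a - exp b\<bar> \<le> exp B * \<bar>a - b\<bar>"
proof -
  have *: "exp a - exp b \<le> exp B * (a - b)" if "b \<le> a" "a \<le> B" for a b :: real
  proof -
    have "1 - (a - b) \<le> exp (b - a)" using exp_ge_add_one_self[of "b - a"] by linarith
    then have "exp a * (1 - (a - b)) \<le> exp a * exp (b - a)" by (intro mult_left_mono) auto
    then have "exp a - exp b \<le> exp a * (a - b)" by (simp add: exp_diff algebra_simps)
    also have "\<dots> \<le> exp B * (a - b)" using that by (intro mult_right_mono) auto
    finally show ?thesis .
  qed
  from *[of b a] *[of a b] assms show ?thesis by (cases "b \<le> a") auto
qed

text \<open>Under a common uniform bound, \<open>dv\<close> is continuous for simultaneous L1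
  convergence under \<open>m\<close> and \<open>l\<close>, so a bounded Borel test function can be
  made continuous.\<close>

lemma dv_bounded_to_Cb:
  fixes m l :: "'a::polish_space measure"
  assumes m: "m \<in> Pr" and l: "l \<in> Pr" and f: "f \<in> borel_measurable borel" "\<And>x. \<bar>f x\<bar> \<le> B"
    and c: "dv f m l > c"
  shows "\<exists>g\<in>Cb. dv g m l > c"
proof -
  interpret m: prob_space m using m by (rule PrD)
  interpret l: prob_space l using l by (rule PrD)
  define d where "d = dv f m l - c"
  \<comment> \<open>The integral under \<open>m\<close> loses less than \<open>e\<close>, the
    logarithm at most \<open>exp (2*B) * e\<close>: one factor \<open>exp B\<close> is the Lipschitz
    constant of the exponential, the other bounds the reciprocal of its mean. This \<open>e\<close>
    makes the total \<open>d / 2\<close>.\<close>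
  define e where "e = d / (2 * (exp (2*B) + 1))"
  have B: "B \<ge> 0" using f(2)[of undefined] by linarith
  have den: "2 * (exp (2*B) + 1) > 0" by (simp add: add_pos_pos)
  have e: "e > 0" using c den by (simp add: e_def d_def)
  obtain g where g: "g \<in> Cb" "\<And>x. \<bar>g x\<bar> \<le> B"
    "(\<integral>x. \<bar>f x - g x\<bar> \<partial>m) < e" "(\<integral>x. \<bar>f x - g x\<bar> \<partial>l) < e"
    using L1_dense_Cb_two[OF m l f e] by blast
  have expi: "integrable l (\<lambda>x. exp (h x))"
    if "h \<in> borel_measurable borel" "\<And>x. \<bar>h x\<bar> \<le> B" for h :: "'a \<Rightarrow> real"
    using that by (intro bounded_integrable[OF l, where B="exp B"]) (auto simp: abs_le_iff)
  note fm = bounded_integrable[OF m f] bounded_integrable[OF l f] expi[OF f]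
  note gm = Pr_integrable[OF m g(1)] Pr_integrable[OF l g(1)] expi[OF Cb_measurable[OF g(1)] g(2)]
  have "(\<integral>x. f x \<partial>m) - (\<integral>x. g x \<partial>m) = (\<integral>x. f x - g x \<partial>m)" using fm gm by simp
  also have "\<dots> \<le> (\<integral>x. \<bar>f x - g x\<bar> \<partial>m)" using fm gm by (intro integral_mono) auto
  finally have 1: "(\<integral>x. f x \<partial>m) - (\<integral>x. g x \<partial>m) < e" using g(3) by simp
  have "(\<integral>x. exp (g x) \<partial>l) - (\<integral>x. exp (f x) \<partial>l) = (\<integral>x. exp (g x) - exp (f x) \<partial>l)"
    using fm gm by simp
  also have "\<dots> \<le> (\<integral>x. exp B * \<bar>f x - g x\<bar> \<partial>l)"
  proof (rule integral_mono)
    fix x show "exp (g x) - exp (f x) \<le> exp B * \<bar>f x - g x\<bar>"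
      using exp_diff_le[of "g x" B "f x"] f(2)[of x] g(2)[of x] by (simp add: abs_minus_commute abs_le_iff)
  qed (use fm gm in auto)
  also have "\<dots> \<le> exp B * e" using g(4) by simp
  finally have 2: "(\<integral>x. exp (g x) \<partial>l) - (\<integral>x. exp (f x) \<partial>l) \<le> exp B * e" .
  have lower: "(\<integral>x. exp (h x) \<partial>l) \<ge> exp (-B)"
    if "integrable l (\<lambda>x. exp (h x))" "\<And>x. \<bar>h x\<bar> \<le> B" for h
  proof -
    have "(\<integral>x. exp (-B) \<partial>l) \<le> (\<integral>x. exp (h x) \<partial>l)"
      using that by (intro integral_mono) (auto simp: abs_le_iff minus_le_iff)
    then show ?thesis using l.prob_space by simp
  qed
  have a: "(\<integral>x. exp (f x) \<partial>l) \<ge> exp (-B)" using lower fm f by blast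
  have a': "(\<integral>x. exp (g x) \<partial>l) \<ge> exp (-B)" using lower gm g by blast
  have apos: "(\<integral>x. exp (f x) \<partial>l) > 0" "(\<integral>x. exp (g x) \<partial>l) > 0"
    using a a' by (auto intro: less_le_trans[OF exp_gt_zero])
  have "ln (\<integral>x. exp (g x) \<partial>l) - ln (\<integral>x. exp (f x) \<partial>l)
      \<le> ((\<integral>x. exp (g x) \<partial>l) - (\<integral>x. exp (f x) \<partial>l)) / (\<integral>x. exp (f x) \<partial>l)"
    by (rule ln_diff_le) (use apos in auto)
  also have "\<dots> \<le> (exp B * e) / (\<integral>x. exp (f x) \<partial>l)"
    using 2 apos by (intro divide_right_mono) auto
  also have "\<dots> \<le> (exp B * e) / exp (-B)"
    using a e apos by (intro divide_left_mono) auto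
  also have "\<dots> = exp (2*B) * e" by (simp add: exp_minus field_simps flip: exp_add)
  finally have "dv f m l - dv g m l < e + exp (2*B) * e" using 1 by (simp add: dv_def)
  also have "\<dots> = d / 2"
  proof -
    have "e + exp (2*B) * e = (2 * (exp (2*B) + 1)) * e / 2" by (simp add: algebra_simps)
    also have "(2 * (exp (2*B) + 1)) * e = d" using den unfolding e_def by simp
    finally show ?thesis .
  qed
  also have "\<dots> < d" using c by (simp add: d_def)
  finally show ?thesis using g(1) by (auto simp: d_def)
qed

lemma Pr_density:
  fixes m l :: "'a::metric_space measure"
  assumes m: "m \<in> Pr" and l: "l \<in> Pr" and AC: "absolutely_continuous l m"
  defines "h \<equiv> \<lambda>x. enn2real (RN_deriv l m x)"
  shows "h \<in> borel_measurable borel" "m = density l (\<lambda>x. ennreal (h x))"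
proof -
  interpret m: prob_space m using m by (rule PrD)
  interpret l: prob_space l using l by (rule PrD)
  have sets: "sets m = sets borel" "sets l = sets borel" using m l by (auto simp: Pr_def)
  have hm: "h \<in> borel_measurable l" unfolding h_def by measurable
  then show "h \<in> borel_measurable borel" using sets by (simp cong: measurable_cong_sets)
  have "AE x in l. RN_deriv l m x = ennreal (h x)"
    using l.RN_deriv_finite[OF _ AC] sets m.sigma_finite_measure_axioms
    by (auto simp: h_def less_top)
  then have "density l (RN_deriv l m) = density l h"
    using hm by (intro density_cong) auto
  then show "m = density l (\<lambda>x. ennreal (h x))" using l.density_RN_deriv[OF AC] sets by simp
qed

text \<open>One half of the Donsker--Varadhan formula: \<open>rel_entropy m l\<close> is the supremum of \<open>dv f m l\<close> over \<open>Cb\<close>.\<close>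
lemma rel_entropy_imp_dv:
  fixes m l :: "'a::polish_space measure"
  assumes m: "m \<in> Pr" and l: "l \<in> Pr" and H: "rel_entropy m l > ereal c"
  shows "\<exists>f\<in>Cb. dv f m l > c"
proof -
  interpret m: prob_space m using m by (rule PrD)
  interpret l: prob_space l using l by (rule PrD)
  have sets: "sets m = sets borel" "sets l = sets borel" using m l by (auto simp: Pr_def)
  show ?thesis
  proof (cases "absolutely_continuous l m")
    case False
    then obtain N where N: "N \<in> null_sets l" "N \<notin> null_sets m"
      by (auto simp: absolutely_continuous_def)
    then have Ns: "N \<in> sets borel" "measure m N > 0" "measure l N = 0"
      using sets by (auto simp: null_sets_def m.emeasure_eq_measure l.emeasure_eq_measure zero_less_measure_iff)
    \<comment> \<open>Since \<open>N\<close> is null for \<open>l\<close>, the exponential mean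
      stays 1 for every multiple of its indicator; this multiple has integral
      \<open>\<bar>c\<bar> + 1\<close> under \<open>m\<close>.\<close>
    define t where "t = (\<bar>c\<bar> + 1) / measure m N"
    define f where "f x = t * indicator N x" for x :: 'a
    have "(\<integral>x. f x \<partial>m) = t * measure m N" unfolding f_def using Ns sets by simp
    moreover have "(\<integral>x. exp (f x) \<partial>l) = (\<integral>x. 1 \<partial>l)"
    proof (rule integral_cong_AE)
      show "AE x in l. exp (f x) = 1"
        using AE_not_in[OF N(1)] by eventually_elim (simp add: f_def)
    qed (use Ns sets in \<open>auto simp: f_def\<close>)
    ultimately have "dv f m l = \<bar>c\<bar> + 1" using Ns by (simp add: dv_def t_def l.prob_space)
    moreover have "f \<in> borel_measurable borel" unfolding f_def using Ns by measurable
    moreover have "\<bar>f x\<bar> \<le> \<bar>t\<bar>" for x by (auto simp: f_def indicator_def)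
    ultimately show ?thesis by (intro dv_bounded_to_Cb[OF m l, of f "\<bar>t\<bar>"]) auto
  next
    case AC: True
    define h where "h = (\<lambda>x. enn2real (RN_deriv l m x))"
    have hb: "h \<in> borel_measurable borel" and dens: "m = density l (\<lambda>x. ennreal (h x))"
      unfolding h_def by (rule Pr_density[OF m l AC])+
    have hm: "h \<in> borel_measurable l" using hb sets by (simp cong: measurable_cong_sets)
    have h0: "h x \<ge> 0" for x by (simp add: h_def)
    have inth: "(\<integral>x. f x \<partial>m) = (\<integral>x. h x * f x \<partial>l)" if "f \<in> borel_measurable borel" for f :: "'a \<Rightarrow> real"
      unfolding dens using that hm h0 sets by (subst integral_density) (auto cong: measurable_cong_sets)
    have hint: "integrable l h" "(\<integral>x. h x \<partial>l) = 1"
    proof -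
      have "(\<integral>\<^sup>+x. ennreal (h x) \<partial>l) = emeasure (density l h) (space l)"
        using hm by (subst emeasure_density) (auto intro!: nn_integral_cong simp: indicator_def)
      also have "\<dots> = 1" using m.emeasure_space_1 sets_eq_imp_space_eq[of m l] sets dens by simp
      finally have *: "(\<integral>\<^sup>+x. ennreal (h x) \<partial>l) = ennreal 1" by simp
      from nn_integral_eq_integrable[THEN iffD1, OF _ _ _ this] show "integrable l h" "(\<integral>x. h x \<partial>l) = 1"
        using hm h0 by auto
    qed
    show ?thesis
    proof (rule ccontr)
      assume "\<not> ?thesis"
      then have no: "dv f m l \<le> c" if "f \<in> Cb" for f using that by force
      \<comment> \<open>The optimal test function is the logarithm of the density; truncating the
        density to \<open>[1/(k+1), k+1]\<close> makes it bounded. The lower cut adds at most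
        \<open>1/(k+1)\<close> to the exponential mean.\<close>
      define s where "s k x = max (1 / real (Suc k)) (min (h x) (real (Suc k)))" for k x
      define f where "f k x = ln (s k x)" for k x
      have spos: "s k x > 0" for k x unfolding s_def by (rule less_le_trans[OF _ max.cobounded1]) simp
      have sb: "1 / real (Suc k) \<le> s k x" "s k x \<le> real (Suc k)" for k x
      proof -
        have "1 / real (Suc k) \<le> 1" "1 \<le> real (Suc k)" by simp_all
        then show "1 / real (Suc k) \<le> s k x" "s k x \<le> real (Suc k)" unfolding s_def by linarith+
      qed
      have sm: "s k \<in> borel_measurable borel" for k unfolding s_def using hb by measurable
      have fm: "f k \<in> borel_measurable borel" for k unfolding f_def using sm by measurable
      have fb: "\<bar>f k x\<bar> \<le> ln (real (Suc k))" for k x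
      proof -
        have "f k x \<le> ln (real (Suc k))" unfolding f_def using spos sb by (subst ln_le_cancel_iff) auto
        moreover have "ln (1 / real (Suc k)) \<le> f k x" unfolding f_def using spos sb by (subst ln_le_cancel_iff) auto
        ultimately show ?thesis by (simp add: ln_div abs_le_iff)
      qed
      have dvf: "dv (f k) m l \<le> c" for k
        using dv_bounded_to_Cb[OF m l fm fb] no by (meson not_le)
      have hf: "integrable l (\<lambda>x. h x * f k x)" for k
      proof (rule Bochner_Integration.integrable_bound)
        show "integrable l (\<lambda>x. ln (real (Suc k)) * h x)" using hint by simp
        show "(\<lambda>x. h x * f k x) \<in> borel_measurable l"
          using hm fm[of k] sets by (auto cong: measurable_cong_sets)
        show "AE x in l. norm (h x * f k x) \<le> norm (ln (real (Suc k)) * h x)"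
          using fb[of k] h0
          by (intro AE_I2) (simp add: abs_mult mult.commute[of _ "h _"] mult_left_mono del: of_nat_Suc)
      qed
      have upper: "(\<integral>x. h x * f k x \<partial>l) \<le> c + 1 / real (Suc k)" for k
      proof -
        have "(\<integral>x. exp (f k x) \<partial>l) = (\<integral>x. s k x \<partial>l)" using spos by (simp add: f_def)
        also have "\<dots> \<le> (\<integral>x. h x + 1 / real (Suc k) \<partial>l)"
        proof (rule integral_mono)
          show "integrable l (s k)"
            using sm sb spos by (intro bounded_integrable[OF l, of _ "real (Suc k)"]) (auto simp: less_imp_le abs_of_pos)
          show "s k x \<le> h x + 1 / real (Suc k)" for x
            unfolding s_def using h0[of x]
            by (intro max.boundedI order_trans[OF min.cobounded1]) (simp_all del: of_nat_Suc)
        qed (use hint in auto)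
        also have "\<dots> = 1 + 1 / real (Suc k)" using hint l.prob_space by simp
        finally have le: "(\<integral>x. exp (f k x) \<partial>l) \<le> 1 + 1 / real (Suc k)" .
        have "(\<integral>x. 1 / real (Suc k) \<partial>l) \<le> (\<integral>x. exp (f k x) \<partial>l)"
        proof (rule integral_mono)
          show "integrable l (\<lambda>x. exp (f k x))"
            using sm sb spos by (intro bounded_integrable[OF l, of _ "real (Suc k)"]) (auto simp: f_def less_imp_le abs_of_pos)
          show "1 / real (Suc k) \<le> exp (f k x)" for x using sb(1)[of k x] spos by (simp add: f_def)
        qed simp
        then have "0 < (\<integral>x. exp (f k x) \<partial>l)"
          using l.prob_space by (simp add: less_le_trans[rotated])
        then have "ln (\<integral>x. exp (f k x) \<partial>l) \<le> ln (1 + 1 / real (Suc k))" using le by (simp add: add_pos_pos)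
        also have "\<dots> \<le> 1 / real (Suc k)" by (intro ln_add_one_self_le_self) simp
        finally show ?thesis using dvf[of k] inth[OF fm[of k]] by (simp add: dv_def)
      qed
      \<comment> \<open>The summand 1 makes the integrands nonnegative, because
        \<open>x * ln x \<ge> -1\<close>, as Fatou's lemma requires.\<close>
      let ?u = "\<lambda>k x. ennreal (h x * f k x + 1)"
      let ?v = "\<lambda>x. h x * ln (h x)"
      have xlnx: "x * ln x \<ge> -1" if "x \<ge> 0" for x :: real
      proof (cases "x = 0")
        case False
        then have "ln (1/x) \<le> 1/x - 1" using that by (intro ln_le_minus_one) auto
        then have "x * ln (1/x) \<le> x * (1/x - 1)" using that by (intro mult_left_mono) auto
        then show ?thesis using that False by (simp add: ln_div algebra_simps)
      qed simp
      \<comment> \<open>Where \<open>h x \<le> 1\<close>, truncation can only raise a positive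
        density, so the bound for \<open>x * ln x\<close> carries over; elsewhere the truncated
        logarithm is nonnegative.\<close>
      have hf1: "0 \<le> h x * f k x + 1" for k x
      proof (cases "h x \<le> 1")
        case True
        have "h x * f k x \<ge> h x * ln (h x)"
        proof (cases "h x = 0")
          case False
          then have "h x \<le> s k x" using True h0[of x] by (auto simp: s_def)
          then have "ln (h x) \<le> f k x" unfolding f_def using False h0[of x] by (subst ln_le_cancel_iff) (auto simp: spos)
          then show ?thesis using h0[of x] by (intro mult_left_mono)
        qed simp
        then show ?thesis using xlnx[OF h0[of x]] by simp
      next
        case False
        then have "1 \<le> s k x" by (auto simp: s_def)
        then have "0 \<le> f k x" by (simp add: f_def)
        then show ?thesis using h0[of x] by simp
      qed
      have lim: "(\<lambda>k. h x * f k x) \<longlonglongrightarrow> ?v x" for x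
      proof (cases "h x = 0")
        case False
        then have hp: "h x > 0" using h0[of x] by simp
        obtain K where K: "1 / h x \<le> real K" "h x \<le> real K"
          using real_arch_simple[of "max (1 / h x) (h x)"] by auto
        have "s k x = h x" if "k \<ge> K" for k
        proof -
          have k: "1 / h x \<le> real (Suc k)" "h x \<le> real (Suc k)" using K that by (auto intro: order_trans)
          then have "1 / real (Suc k) \<le> h x" using hp by (simp add: field_simps)
          then show ?thesis using k by (simp add: s_def min_absorb1 max_absorb2)
        qed
        then show ?thesis by (intro tendsto_eventually eventually_sequentiallyI[of K]) (simp add: f_def)
      qed simp
      have "(\<integral>\<^sup>+x. ennreal (?v x + 1) \<partial>l) = (\<integral>\<^sup>+x. liminf (\<lambda>k. ?u k x) \<partial>l)"
      proof (rule nn_integral_cong)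
        fix x
        have "(\<lambda>k. ?u k x) \<longlonglongrightarrow> ennreal (?v x + 1)"
          by (intro tendsto_ennrealI tendsto_add lim tendsto_const)
        then show "ennreal (?v x + 1) = liminf (\<lambda>k. ?u k x)"
          using lim_imp_Liminf[OF sequentially_bot] by metis
      qed
      also have "\<dots> \<le> liminf (\<lambda>k. \<integral>\<^sup>+x. ?u k x \<partial>l)"
        using hf by (intro nn_integral_liminf) auto
      also have "\<dots> \<le> liminf (\<lambda>k. ennreal (c + 1 / real (Suc k) + 1))"
      proof (rule Liminf_mono, rule always_eventually, rule allI)
        fix k
        have "(\<integral>\<^sup>+x. ?u k x \<partial>l) = ennreal (\<integral>x. h x * f k x + 1 \<partial>l)"
          using hf hf1 by (intro nn_integral_eq_integral) auto
        also have "(\<integral>x. h x * f k x + 1 \<partial>l) \<le> c + 1 / real (Suc k) + 1"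
          using hf upper[of k] l.prob_space by simp
        finally show "(\<integral>\<^sup>+x. ?u k x \<partial>l) \<le> ennreal (c + 1 / real (Suc k) + 1)" by (simp add: ennreal_leI)
      qed
      also have "\<dots> = ennreal (c + 0 + 1)"
        by (intro lim_imp_Liminf sequentially_bot tendsto_ennrealI tendsto_intros LIMSEQ_inverse_real_of_nat[unfolded inverse_eq_divide])
      finally have bound: "(\<integral>\<^sup>+x. ennreal (?v x + 1) \<partial>l) \<le> ennreal (c + 1)" by simp
      have v1: "?v x + 1 \<ge> 0" for x using xlnx[OF h0[of x]] by simp
      have "integrable l (\<lambda>x. ?v x + 1)"
        using hm v1 bound by (intro integrableI_bounded) (auto simp: le_less_trans)
      then have "integrable l (\<lambda>x. (?v x + 1) - 1)" by (intro Bochner_Integration.integrable_diff) auto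
      then have vi: "integrable l ?v" by simp
      have "ennreal (\<integral>x. ?v x + 1 \<partial>l) \<le> ennreal (c + 1)"
        using bound v1 \<open>integrable l (\<lambda>x. ?v x + 1)\<close> by (subst nn_integral_eq_integral[symmetric]) auto
      moreover have "(\<integral>x. ?v x + 1 \<partial>l) = (\<integral>x. ?v x \<partial>l) + 1" using vi l.prob_space by simp
      moreover have "0 \<le> (\<integral>x. ?v x + 1 \<partial>l)" using v1 by (intro Bochner_Integration.integral_nonneg) auto
      \<comment> \<open>\<open>ennreal\<close> sends negative numbers to 0, so the return to real
        integrals needs the sign of \<open>c + 1\<close>.\<close>
      moreover have "c + 1 \<ge> 0"
      proof (rule field_le_epsilon)
        fix e :: real assume "e > 0"
        then obtain k where "1 / real (Suc k) < e" by (metis nat_approx_posE)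
        moreover have "0 \<le> (\<integral>x. h x * f k x + 1 \<partial>l)"
          using hf1 by (intro Bochner_Integration.integral_nonneg)
        ultimately show "0 \<le> c + 1 + e" using hf[of k] upper[of k] l.prob_space by simp
      qed
      ultimately have "(\<integral>x. ?v x \<partial>l) \<le> c" by (simp add: ennreal_le_iff)
      \<comment> \<open>The integrability \<open>vi\<close> excludes the default value \<infinity>
        of \<open>rel_entropy\<close>.\<close>
      moreover have "rel_entropy m l = ereal (\<integral>x. ?v x \<partial>l)"
        using vi AC sets unfolding rel_entropy_def Let_def h_def by simp
      ultimately show False using H by simp
    qed
  qed
qed

lemma exp_le_quadratic:
  fixes x :: real
  assumes "\<bar>x\<bar> \<le> 1"
  shows "exp x \<le> 1 + x + x\<^sup>2"
proof (cases "x \<ge> 0")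
  case True then show ?thesis using assms by (intro exp_bound) auto
next
  case False
  define y where "y = - x"
  have y: "y > 0" using False by (simp add: y_def)
  have "1 - y + y\<^sup>2 = (1 - y / 2)\<^sup>2 + 3 / 4 * y\<^sup>2" by (simp add: power2_eq_square algebra_simps)
  also have "\<dots> > 0" using y by (intro add_nonneg_pos) auto
  finally have q: "1 - y + y\<^sup>2 > 0" .
  have "1 \<le> (1 + y) * (1 - y + y\<^sup>2)" using y by (simp add: algebra_simps power2_eq_square)
  also have "\<dots> \<le> exp y * (1 - y + y\<^sup>2)"
    using exp_ge_add_one_self[of y] q by (intro mult_right_mono) auto
  finally have "exp (- y) \<le> 1 - y + y\<^sup>2" by (simp add: exp_minus field_simps)
  then show ?thesis by (simp add: y_def)
qed

text \<open>At \<open>s = 0\<close> the expression vanishes and has derivative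
  \<open>a - (\<integral>x. f x \<partial>l) > 0\<close>; the estimate
  \<open>exp x \<le> 1 + x + x^2\<close> makes this quantitative.\<close>

lemma small_scale:
  fixes f :: "'a::metric_space \<Rightarrow> real"
  assumes l: "l \<in> Pr" and f: "f \<in> borel_measurable borel" "\<And>x. \<bar>f x\<bar> \<le> B0"
    and a: "a > (\<integral>x. f x \<partial>l)"
  shows "\<exists>s>0. s * a - ln (\<integral>x. exp (s * f x) \<partial>l) > 0"
proof -
  interpret l: prob_space l using l by (rule PrD)
  define D where "D = a - (\<integral>x. f x \<partial>l)"
  have D: "D > 0" using a by (simp add: D_def)
  define B where "B = \<bar>B0\<bar> + 1"
  have B: "B > 0" "\<And>x. \<bar>f x\<bar> \<le> B"
    unfolding B_def by simp (meson f(2) abs_ge_self order_trans less_add_one less_imp_le)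
  \<comment> \<open>The first bound gives \<open>\<bar>s * f x\<bar> \<le> 1\<close>, as the
    quadratic estimate requires; the second keeps the quadratic error at most half of the linear
    gain \<open>s * D\<close>.\<close>
  define s where "s = min (1 / B) (D / (2 * B^2))"
  have s: "s > 0" using B D by (simp add: s_def)
  have "s * B \<le> (1 / B) * B" unfolding s_def using B by (intro mult_right_mono) auto
  then have s2: "s * B \<le> 1" using B by simp
  have "s * B^2 \<le> (D / (2 * B^2)) * B^2" unfolding s_def using B by (intro mult_right_mono) auto
  then have s3: "s * B^2 \<le> D / 2" using B by simp
  note fi = bounded_integrable[OF l f(1) B(2)]
  have ei: "integrable l (\<lambda>x. exp (s * f x))"
    using f(1) B s
    by (intro bounded_integrable[OF l, where B="exp (s * B)"]) (auto simp: abs_le_iff mult_left_mono)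
  have "(\<integral>x. exp (s * f x) \<partial>l) \<le> (\<integral>x. 1 + s * f x + (s * B)^2 \<partial>l)"
  proof (rule integral_mono[OF ei])
    fix x
    have ab: "\<bar>s * f x\<bar> \<le> s * B" using B(2)[of x] s by (simp add: abs_mult mult_left_mono)
    then have "exp (s * f x) \<le> 1 + s * f x + (s * f x)\<^sup>2"
      using s2 by (intro exp_le_quadratic) simp
    also have "(s * f x)\<^sup>2 \<le> (s * B)\<^sup>2" using ab by (metis abs_le_square_iff abs_of_nonneg order_trans abs_ge_zero)
    finally show "exp (s * f x) \<le> 1 + s * f x + (s * B)\<^sup>2" by simp
  qed (use fi in simp)
  also have "\<dots> = 1 + s * (\<integral>x. f x \<partial>l) + (s * B)^2" using fi l.prob_space by simp
  finally have le: "(\<integral>x. exp (s * f x) \<partial>l) \<le> 1 + (s * (\<integral>x. f x \<partial>l) + (s * B)^2)" by simp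
  have "(\<integral>x. exp (- (s * B)) \<partial>l) \<le> (\<integral>x. exp (s * f x) \<partial>l)"
  proof (rule integral_mono[OF _ ei])
    fix x show "exp (- (s * B)) \<le> exp (s * f x)"
      using B(2)[of x] s mult_left_mono[of "-B" "f x" s] by (simp add: abs_le_iff)
  qed auto
  then have pos: "0 < (\<integral>x. exp (s * f x) \<partial>l)" using l.prob_space by (simp add: less_le_trans[rotated])
  have "ln (\<integral>x. exp (s * f x) \<partial>l) \<le> (\<integral>x. exp (s * f x) \<partial>l) - 1" by (rule ln_le_minus_one[OF pos])
  also have "\<dots> \<le> s * (\<integral>x. f x \<partial>l) + (s * B)^2" using le by simp
  also have "(s * B)^2 \<le> s * (D / 2)" using mult_left_mono[OF s3, of s] s by (simp add: power2_eq_square algebra_simps)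
  finally have "s * a - ln (\<integral>x. exp (s * f x) \<partial>l) \<ge> s * D - s * (D/2)"
    by (simp add: D_def algebra_simps)
  moreover have "s * D - s * (D/2) > 0" using s D by simp
  ultimately show ?thesis using s by (intro exI[of _ s]) auto
qed

text \<open>Strict positivity of the entropy of distinct laws, in dual form. Some \<open>g\<close>
  in \<open>Cb\<close> has different means; after a change of sign the mean under \<open>m\<close>
  is the larger one, and a small multiple has positive \<open>dv\<close>.\<close>

lemma dv_separates:
  fixes m l :: "'a::polish_space measure"
  assumes m: "m \<in> Pr" and l: "l \<in> Pr" and ne: "m \<noteq> l"
  shows "\<exists>f\<in>Cb. dv f m l > 0"
proof -
  interpret m: prob_space m using m by (rule PrD)
  interpret l: prob_space l using l by (rule PrD)
  have sets: "sets m = sets borel" "sets l = sets borel" using m l by (auto simp: Pr_def)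
  have "\<exists>A\<in>sets borel. measure m A \<noteq> measure l A"
  proof (rule ccontr)
    assume "\<not> ?thesis"
    then have "m = l" using sets
      by (intro measure_eqI) (auto simp: m.emeasure_eq_measure l.emeasure_eq_measure)
    with ne show False by simp
  qed
  then obtain A where A: "A \<in> sets borel" "measure m A \<noteq> measure l A" by blast
  define d where "d = \<bar>measure m A - measure l A\<bar>"
  have "(indicator A :: _ \<Rightarrow> real) \<in> borel_measurable borel" using A by simp
  then obtain g where g: "g \<in> Cb" "(\<integral>x. \<bar>indicator A x - g x\<bar> \<partial>m) < d/2" "(\<integral>x. \<bar>indicator A x - g x\<bar> \<partial>l) < d/2"
    using L1_dense_Cb_two[OF m l, of "indicator A" 1 "d/2"] A by (auto simp: d_def indicator_def)
  have close: "\<bar>measure n A - (\<integral>x. g x \<partial>n)\<bar> \<le> (\<integral>x. \<bar>indicator A x - g x\<bar> \<partial>n)" if n: "n \<in> Pr" for n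
  proof -
    interpret n: prob_space n using n by (rule PrD)
    have i: "integrable n (indicator A :: _ \<Rightarrow> real)" "integrable n g" "A \<in> sets n"
      using A PrD(1)[OF n] Pr_integrable[OF n g(1)] by (auto simp: less_top[symmetric])
    then have "measure n A - (\<integral>x. g x \<partial>n) = (\<integral>x. indicator A x - g x \<partial>n)"
      by (subst Bochner_Integration.integral_diff) auto
    then show ?thesis using integral_abs_bound[of n "\<lambda>x. indicator A x - g x"] by simp
  qed
  have "(\<integral>x. g x \<partial>m) \<noteq> (\<integral>x. g x \<partial>l)"
  proof
    assume "(\<integral>x. g x \<partial>m) = (\<integral>x. g x \<partial>l)"
    then show False using close[OF m] close[OF l] g(2,3) unfolding d_def abs_le_iff by (smt (verit) field_sum_of_halves)
  qed
  then have "\<exists>f\<in>Cb. (\<integral>x. f x \<partial>m) > (\<integral>x. f x \<partial>l)"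
    using g(1) Cb_cmult[OF g(1), of "-1"]
    by (cases "(\<integral>x. g x \<partial>m) > (\<integral>x. g x \<partial>l)") (auto intro: bexI[of _ g] bexI[of _ "\<lambda>x. -1 * g x"])
  then obtain f where f: "f \<in> Cb" "(\<integral>x. f x \<partial>m) > (\<integral>x. f x \<partial>l)" by blast
  obtain B where "\<And>x. \<bar>f x\<bar> \<le> B" using CbE[OF f(1)] by metis
  from small_scale[OF l Cb_measurable[OF f(1)] this f(2)]
  obtain s where "s > 0" "s * (\<integral>x. f x \<partial>m) - ln (\<integral>x. exp (s * f x) \<partial>l) > 0" by blast
  then show ?thesis using Cb_cmult[OF f(1), of s]
    by (intro bexI[of _ "\<lambda>x. s * f x"]) (auto simp: dv_def)
qed

subsection \<open>Independent samples\<close>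

abbreviation (input) iid :: "nat \<Rightarrow> 'a measure \<Rightarrow> (nat \<Rightarrow> 'a) measure" where
  "iid n l \<equiv> PiM {..<n} (\<lambda>_. l)"

lemma prob_space_iid: "l \<in> Pr \<Longrightarrow> prob_space (iid n l)"
  by (intro prob_space_PiM) (auto simp: Pr_def)

lemma sets_iid: "l \<in> Pr \<Longrightarrow> sets (iid n l) = sets (iid n borel)"
  by (intro sets_PiM_cong) (auto simp: Pr_def)

lemma space_iid: "l \<in> Pr \<Longrightarrow> space (iid n l) = PiE {..<n} (\<lambda>_. UNIV)"
  by (auto simp: space_PiM Pr_space)

lemma measurable_iid_component:
  assumes "l \<in> Pr" "f \<in> borel_measurable borel" "i < n"
  shows "(\<lambda>w. f (w i)) \<in> borel_measurable (iid n l)"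
proof -
  have "f \<in> borel_measurable l" using assms by (auto simp: Pr_def cong: measurable_cong_sets)
  then show ?thesis using assms(3) by (intro measurable_PiM_component_rev) auto
qed

lemma nn_integral_iid_prod:
  assumes l: "l \<in> Pr" and f: "\<And>i. f i \<in> borel_measurable borel"
  shows "(\<integral>\<^sup>+w. (\<Prod>i<n. f i (w i)) \<partial>iid n l) = (\<Prod>i<n. \<integral>\<^sup>+x. f i x \<partial>l)"
proof -
  interpret l: prob_space l using l by (rule PrD)
  interpret product_sigma_finite "\<lambda>_::nat. l" by standard
  show ?thesis
    using f PrD(1)[OF l] by (intro product_nn_integral_prod) (auto cong: measurable_cong_sets)
qed

text \<open>Markov's inequality for the product of the factors \<open>exp (f (w i) - a)\<close>,
  whose expectation factorises by independence.\<close>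

lemma chernoff:
  fixes l :: "'a::metric_space measure" and n :: nat and a :: real
  assumes l: "l \<in> Pr" and f: "f \<in> borel_measurable borel" "\<And>x. \<bar>f x\<bar> \<le> B"
  defines "S \<equiv> {w \<in> space (iid n l). (\<Sum>i<n. f (w i)) \<ge> real n * a}"
  shows "S \<in> sets (iid n l)" "measure (iid n l) S \<le> exp (- (real n * (a - ln (\<integral>x. exp (f x) \<partial>l))))"
proof -
  interpret l: prob_space l using l by (rule PrD)
  interpret Q: prob_space "iid n l" by (rule prob_space_iid[OF l])
  have em: "(\<lambda>x. ennreal (exp (f x - a))) \<in> borel_measurable borel" using f(1) by measurable
  have [measurable]: "(\<lambda>w. f (w i)) \<in> borel_measurable (iid n l)" if "i < n" for i
    by (rule measurable_iid_component[OF l f(1) that])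
  show S: "S \<in> sets (iid n l)" unfolding S_def by measurable
  let ?E = "\<integral>x. exp (f x) \<partial>l"
  have ei: "integrable l (\<lambda>x. exp (f x))"
    using f by (intro bounded_integrable[OF l, where B="exp B"]) (auto simp: abs_le_iff)
  have "(\<integral>x. exp (-B) \<partial>l) \<le> ?E"
    using f(2) ei by (intro integral_mono) (auto simp: abs_le_iff minus_le_iff)
  then have E: "?E > 0" using l.prob_space by (simp add: less_le_trans[rotated])
  have "emeasure (iid n l) S = (\<integral>\<^sup>+w. indicator S w \<partial>iid n l)" using S by simp
  also have "\<dots> \<le> (\<integral>\<^sup>+w. (\<Prod>i<n. ennreal (exp (f (w i) - a))) \<partial>iid n l)"
  proof (rule nn_integral_mono)
    fix w
    have eq: "(\<Prod>i<n. ennreal (exp (f (w i) - a))) = ennreal (exp ((\<Sum>i<n. f (w i)) - real n * a))"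
      by (simp add: prod_ennreal exp_sum[symmetric] sum_subtractf)
    show "indicator S w \<le> (\<Prod>i<n. ennreal (exp (f (w i) - a)))"
      unfolding eq by (auto simp: indicator_def S_def)
  qed
  also have "\<dots> = (\<Prod>i<n. \<integral>\<^sup>+x. ennreal (exp (f x - a)) \<partial>l)"
    using f(1) by (intro nn_integral_iid_prod[OF l, of "\<lambda>_ x. ennreal (exp (f x - a))"] em)
  also have "(\<integral>\<^sup>+x. ennreal (exp (f x - a)) \<partial>l) = ennreal (exp (ln ?E - a))"
  proof -
    have "(\<integral>\<^sup>+x. ennreal (exp (f x - a)) \<partial>l) = ennreal (\<integral>x. exp (f x) / exp a \<partial>l)"
      using ei by (subst nn_integral_eq_integral[symmetric]) (auto simp: exp_diff)
    also have "(\<integral>x. exp (f x) / exp a \<partial>l) = exp (ln ?E - a)" using E by (simp add: exp_diff)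
    finally show ?thesis .
  qed
  also have "(\<Prod>i<n. ennreal (exp (ln ?E - a))) = ennreal (exp (- (real n * (a - ln ?E))))"
    by (simp add: ennreal_power exp_of_nat_mult[symmetric] algebra_simps)
  finally show "measure (iid n l) S \<le> exp (- (real n * (a - ln ?E)))"
    by (simp add: Q.emeasure_eq_measure ennreal_le_iff)
qed

text \<open>For each \<open>j\<close> Chernoff's bound controls how often the sample leaves
  \<open>K j\<close>. The compact sets are so large that the bounds stay summable in
  \<open>j\<close> after \<open>exp (- (real n * L))\<close> is split off, so one exceptional set
  serves every \<open>j\<close>.\<close>

lemma exp_tight:
  fixes l :: "'a::polish_space measure"
  assumes l: "l \<in> Pr" and L: "L \<ge> 0"
  obtains K Z where "\<And>j. compact (K j :: 'a set)"
    "\<And>n. n \<ge> 1 \<Longrightarrow> Z n \<in> sets (iid n l)"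
    "\<And>n. n \<ge> 1 \<Longrightarrow> measure (iid n l) (Z n) \<le> exp (- (real n * L))"
    "\<And>n w j. n \<ge> 1 \<Longrightarrow> w \<in> space (iid n l) \<Longrightarrow> w \<notin> Z n \<Longrightarrow>
       (\<Sum>i<n. indicator (- K j) (w i)) / real n \<le> 1 / real (Suc j)"
proof -
  interpret l: prob_space l using l by (rule PrD)
  have sets: "sets l = sets borel" using l by (rule PrD)
  \<comment> \<open>With threshold \<open>a j = t j / Suc j\<close>, \<open>Zj\<close> says that at
    least a fraction \<open>1 / Suc j\<close> of the sample lies outside \<open>K j\<close>. The
    exponential mean is at most 2 and its logarithm at most 1, which leaves a rate of at least
    \<open>a j - 1 = L + j + 1\<close>.\<close>
  define t where "t j = real (Suc j) * (L + real j + 2)" for j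
  have "\<exists>K. compact K \<and> measure l (- K) \<le> exp (- t j)" for j
  proof -
    have "emeasure l UNIV = (SUP K \<in> {K. K \<subseteq> UNIV \<and> compact K}. emeasure l K)"
      using sets by (intro inner_regular) auto
    moreover have "emeasure l UNIV = 1" using l.emeasure_space_1 Pr_space[OF l] by simp
    moreover have "ennreal (1 - exp (- t j)) < 1"
      using ennreal_less_iff[of "1 - exp (- t j)" 1] L by (simp add: t_def)
    ultimately obtain K where K: "compact K" "ennreal (1 - exp (- t j)) < emeasure l K"
      by (metis (mono_tags, lifting) less_SUP_iff mem_Collect_eq)
    have Ks: "K \<in> sets l" using K(1) sets by (simp add: compact_imp_closed)
    have "1 - exp (- t j) \<le> measure l K"
      using K(2) by (simp add: l.emeasure_eq_measure ennreal_less_iff t_def L less_imp_le)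
    then have "measure l (- K) \<le> exp (- t j)"
      using l.prob_compl[OF Ks] Pr_space[OF l] by (simp add: Compl_eq_Diff_UNIV)
    with K(1) show ?thesis by blast
  qed
  then obtain K where K: "\<And>j. compact (K j)" "\<And>j. measure l (- K j) \<le> exp (- t j)" by metis
  have Kb: "- K j \<in> sets borel" for j using K(1)[of j] by (simp add: compact_imp_closed)
  define f where "f j x = t j * indicator (- K j) x" for j and x :: 'a
  have fm: "f j \<in> borel_measurable borel" for j unfolding f_def using Kb by measurable
  have fb: "\<bar>f j x\<bar> \<le> \<bar>t j\<bar>" for j x by (auto simp: f_def indicator_def)
  define a where "a j = L + real j + 2" for j
  define Zj where "Zj n j = {w \<in> space (iid n l). (\<Sum>i<n. f j (w i)) \<ge> real n * a j}" for n j
  define Z where "Z n = (\<Union>j. Zj n j)" for n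
  have E: "ln (\<integral>x. exp (f j x) \<partial>l) \<le> 1" for j
  proof -
    have tj: "t j \<ge> 0" using L by (simp add: t_def)
    have ind: "integrable l (indicator (- K j) :: _ \<Rightarrow> real)" using Kb sets by (simp add: less_top[symmetric])
    have ei: "integrable l (\<lambda>x. exp (f j x))"
      using fm fb by (intro bounded_integrable[OF l, where B="exp \<bar>t j\<bar>"]) (auto simp: abs_le_iff)
    have "(\<integral>x. exp (f j x) \<partial>l) \<le> (\<integral>x. 1 + exp (t j) * indicator (- K j) x \<partial>l)"
    proof (rule integral_mono)
      show "integrable l (\<lambda>x. exp (f j x))" by (rule ei)
      show "integrable l (\<lambda>x. 1 + exp (t j) * indicator (- K j) x)" using ind by simp
    qed (auto simp: f_def indicator_def)
    also have "\<dots> = 1 + exp (t j) * measure l (- K j)"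
      using ind Kb sets l.prob_space by simp
    also have "\<dots> \<le> 1 + exp (t j) * exp (- t j)" using K(2) by (intro add_left_mono mult_left_mono) auto
    also have "\<dots> = 2" by (simp add: exp_minus)
    finally have 2: "(\<integral>x. exp (f j x) \<partial>l) \<le> 2" .
    have "(\<integral>x. 1 \<partial>l) \<le> (\<integral>x. exp (f j x) \<partial>l)"
      using tj by (intro integral_mono ei) (auto simp: f_def)
    then have "1 \<le> (\<integral>x. exp (f j x) \<partial>l)" using l.prob_space by simp
    then show ?thesis using 2 ln_le_minus_one[of "\<integral>x. exp (f j x) \<partial>l"] by simp
  qed
  show thesis
  proof (rule that[OF K(1)])
    fix n :: nat assume n: "n \<ge> 1"
    interpret Q: prob_space "iid n l" by (rule prob_space_iid[OF l])
    have Zs: "Zj n j \<in> sets (iid n l)" for j unfolding Zj_def by (rule chernoff(1)[OF l fm fb])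
    then show "Z n \<in> sets (iid n l)" unfolding Z_def by blast
    have bj: "measure (iid n l) (Zj n j) \<le> exp (- (real n * L)) * (1/2)^Suc j" for j
    proof -
      have "measure (iid n l) (Zj n j) \<le> exp (- (real n * (a j - ln (\<integral>x. exp (f j x) \<partial>l))))"
        unfolding Zj_def by (rule chernoff(2)[OF l fm fb])
      also have "\<dots> \<le> exp (- (real n * L) - real (Suc j))"
      proof -
        have "real n * (L + real j + 1) \<le> real n * (a j - ln (\<integral>x. exp (f j x) \<partial>l))"
          using E[of j] by (intro mult_left_mono) (auto simp: a_def)
        moreover have "1 * (real j + 1) \<le> real n * (real j + 1)" using n by (intro mult_right_mono) auto
        ultimately show ?thesis by (simp add: algebra_simps)
      qed
      also have "\<dots> = exp (- (real n * L)) * exp (-1) ^ Suc j"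
        unfolding exp_of_nat_mult[symmetric] exp_add[symmetric] by simp
      also have "\<dots> \<le> exp (- (real n * L)) * (1/2)^Suc j"
      proof (intro mult_left_mono power_mono)
        show "exp (-1) \<le> (1/2::real)" using exp_ge_add_one_self[of 1] by (simp add: exp_minus field_simps)
      qed auto
      finally show ?thesis .
    qed
    have sumb: "(\<lambda>j. exp (- (real n * L)) * (1/2)^Suc j) sums (exp (- (real n * L)) * 1)"
      by (intro sums_mult power_half_series)
    have summ: "summable (\<lambda>j. measure (iid n l) (Zj n j))"
      by (rule summable_comparison_test'[OF sums_summable[OF sumb], of 0]) (use bj in auto)
    have "measure (iid n l) (Z n) \<le> (\<Sum>j. measure (iid n l) (Zj n j))"
      unfolding Z_def using Zs summ by (intro Q.finite_measure_subadditive_countably) auto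
    also have "\<dots> \<le> (\<Sum>j. exp (- (real n * L)) * (1/2)^Suc j)"
      by (intro suminf_le summ sums_summable[OF sumb] bj)
    also have "\<dots> = exp (- (real n * L))" using sums_unique[OF sumb] by simp
    finally show "measure (iid n l) (Z n) \<le> exp (- (real n * L))" .
    fix w j assume w: "w \<in> space (iid n l)" "w \<notin> Z n"
    then have "(\<Sum>i<n. f j (w i)) < real n * a j" by (auto simp: Z_def Zj_def not_le)
    then have "t j * (\<Sum>i<n. indicator (- K j) (w i)) < real n * a j"
      by (simp add: f_def sum_distrib_left)
    then have "a j * (real (Suc j) * (\<Sum>i<n. indicator (- K j) (w i))) < a j * real n"
      by (simp add: t_def a_def algebra_simps)
    moreover have "a j > 0" using L by (simp add: a_def)
    ultimately have "real (Suc j) * (\<Sum>i<n. indicator (- K j) (w i)) < real n"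
      by (simp only: mult_less_cancel_left_pos)
    then show "(\<Sum>i<n. indicator (- K j) (w i)) / real n \<le> 1 / real (Suc j)"
      using n by (simp add: divide_le_eq le_divide_eq mult.commute)
  qed
qed

text \<open>Only a first moment is available, so \<open>Y\<close> is clipped: Chernoff's bound
  treats the bounded part, Markov's inequality the remainder, which is small in L1. The one-sided
  form is what an upper bound on a log-likelihood asks for.\<close>

lemma wlln_upper:
  fixes l :: "'a::metric_space measure"
  assumes l: "l \<in> Pr" and Y: "Y \<in> borel_measurable borel" "integrable l Y" and \<delta>: "\<delta> > 0"
  shows "(\<lambda>n. measure (iid n l) {w \<in> space (iid n l). (\<Sum>i<n. Y (w i)) > real n * ((\<integral>x. Y x \<partial>l) + \<delta>)}) \<longlonglongrightarrow> 0"
proof (rule LIMSEQ_I)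
  fix r :: real assume r: "r > 0"
  interpret l: prob_space l using l by (rule PrD)
  have sets: "sets l = sets borel" using l by (rule PrD)
  define clip where "clip k x = max (- real k) (min (real k) (Y x))" for k :: nat and x
  have cm [measurable]: "clip k \<in> borel_measurable borel" for k unfolding clip_def using Y(1) by measurable
  have cb: "\<bar>clip k x\<bar> \<le> real k" for k x by (auto simp: clip_def)
  have ci: "integrable l (clip k)" for k by (rule bounded_integrable[OF l cm cb])
  have "(\<lambda>k. \<integral>x. \<bar>Y x - clip k x\<bar> \<partial>l) \<longlonglongrightarrow> (\<integral>x. 0 \<partial>l)"
  proof (rule integral_dominated_convergence[where w="\<lambda>x. \<bar>Y x\<bar>"])
    show "AE x in l. (\<lambda>k. \<bar>Y x - clip k x\<bar>) \<longlonglongrightarrow> 0"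
    proof (rule AE_I2, rule tendsto_eventually)
      fix x
      obtain K where "\<bar>Y x\<bar> \<le> real K" using real_arch_simple by blast
      then have "clip k x = Y x" if "k \<ge> K" for k using that by (auto simp: clip_def)
      then show "\<forall>\<^sub>F k in sequentially. \<bar>Y x - clip k x\<bar> = 0"
        by (intro eventually_sequentiallyI[of K]) simp
    qed
    show "AE x in l. norm \<bar>Y x - clip k x\<bar> \<le> \<bar>Y x\<bar>" for k by (rule AE_I2) (auto simp: clip_def)
  qed (use Y ci in \<open>auto\<close>)
  \<comment> \<open>The factor 1 keeps the shift of the mean below \<open>\<delta>/4\<close>; the
    factor \<open>r/2\<close> makes Markov's bound \<open>2 * \<eta> / \<delta>\<close> smaller than
    \<open>r/2\<close>.\<close>
  then have "\<forall>\<^sub>F k in sequentially. (\<integral>x. \<bar>Y x - clip k x\<bar> \<partial>l) < min 1 (r/2) * (\<delta>/4)"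
    using r \<delta> by (auto dest!: order_tendstoD(2)[where a="min 1 (r/2) * (\<delta>/4)"])
  then obtain k where k: "(\<integral>x. \<bar>Y x - clip k x\<bar> \<partial>l) < min 1 (r/2) * (\<delta>/4)" by (auto simp: eventually_sequentially)
  define \<eta> where "\<eta> = (\<integral>x. \<bar>Y x - clip k x\<bar> \<partial>l)"
  have "min 1 (r/2) * (\<delta>/4) \<le> 1 * (\<delta>/4)" "min 1 (r/2) * (\<delta>/4) \<le> (r/2) * (\<delta>/4)"
    using \<delta> by (auto intro!: mult_right_mono)
  then have \<eta>: "\<eta> < \<delta>/4" "\<eta> < (r/2) * (\<delta>/4)" "0 \<le> \<eta>" using k by (auto simp: \<eta>_def)
  \<comment> \<open>The allowance \<open>\<delta>\<close> is spent as
    \<open>\<eta> < \<delta>/4\<close> on the shift of the mean, \<open>\<delta>/4\<close> on the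
    clipped sum and \<open>\<delta>/2\<close> on the remainder.\<close>
  define a where "a = (\<integral>x. clip k x \<partial>l) + \<delta>/4"
  have "a > (\<integral>x. clip k x \<partial>l)" using \<delta> by (simp add: a_def)
  from small_scale[OF l cm cb this] obtain s where s: "s > 0" "s * a - ln (\<integral>x. exp (s * clip k x) \<partial>l) > 0" by blast
  define b where "b = s * a - ln (\<integral>x. exp (s * clip k x) \<partial>l)"
  have "(\<lambda>n. exp (- b) ^ n) \<longlonglongrightarrow> 0" using s by (intro LIMSEQ_realpow_zero) (auto simp: b_def)
  then have "\<forall>\<^sub>F n in sequentially. exp (- b) ^ n < r / 2"
    using r by (auto dest!: order_tendstoD(2)[where a="r/2"])
  then obtain N where N: "\<And>n. n \<ge> N \<Longrightarrow> exp (- b) ^ n < r / 2" by (auto simp: eventually_sequentially)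
  have cd: "(\<integral>x. clip k x \<partial>l) - (\<integral>x. Y x \<partial>l) \<le> \<eta>"
  proof -
    have "(\<integral>x. clip k x \<partial>l) - (\<integral>x. Y x \<partial>l) = (\<integral>x. clip k x - Y x \<partial>l)" using ci Y by simp
    also have "\<dots> \<le> \<eta>" unfolding \<eta>_def using ci Y by (intro integral_mono) auto
    finally show ?thesis .
  qed
  show "\<exists>no. \<forall>n\<ge>no. norm (measure (iid n l) {w \<in> space (iid n l). (\<Sum>i<n. Y (w i)) > real n * ((\<integral>x. Y x \<partial>l) + \<delta>)} - 0) < r"
  proof (intro exI allI impI)
    fix n assume n: "n \<ge> max N 1"
    interpret Q: prob_space "iid n l" by (rule prob_space_iid[OF l])
    let ?A = "{w \<in> space (iid n l). (\<Sum>i<n. Y (w i)) > real n * ((\<integral>x. Y x \<partial>l) + \<delta>)}"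
    let ?B = "{w \<in> space (iid n l). (\<Sum>i<n. s * clip k (w i)) \<ge> real n * (s * a)}"
    let ?u = "\<lambda>w. \<Sum>i<n. ennreal \<bar>Y (w i) - clip k (w i)\<bar>"
    let ?C = "{w \<in> space (iid n l). 1 \<le> ennreal (2 / (real n * \<delta>)) * ?u w}"
    have um: "(\<lambda>w. ennreal \<bar>Y (w i) - clip k (w i)\<bar>) \<in> borel_measurable (iid n l)" if "i < n" for i
      using Y(1) that measurable_iid_component[OF l, of "\<lambda>x. Y x - clip k x" i n] by auto
    have sc: "(\<lambda>x. s * clip k x) \<in> borel_measurable borel" "\<And>x. \<bar>s * clip k x\<bar> \<le> s * real k"
      using cb s by (auto simp: abs_mult)
    have Bs: "?B \<in> sets (iid n l)" by (rule chernoff(1)[OF l sc])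
    have "measure (iid n l) ?B \<le> exp (- (real n * (s * a - ln (\<integral>x. exp (s * clip k x) \<partial>l))))"
      by (rule chernoff(2)[OF l sc])
    also have "\<dots> = exp (- b) ^ n" unfolding b_def by (simp flip: exp_of_nat_mult add: algebra_simps)
    finally have PB: "measure (iid n l) ?B < r / 2" using N[of n] n by linarith
    have Cs: "?C \<in> sets (iid n l)" using um by measurable
    have "emeasure (iid n l) ?C \<le> ennreal (2 / (real n * \<delta>)) * (\<integral>\<^sup>+w. ?u w \<partial>iid n l)"
    proof -
      have "emeasure (iid n l) ({w \<in> space (iid n l). 1 \<le> ennreal (2 / (real n * \<delta>)) * ?u w})
        \<le> ennreal (2 / (real n * \<delta>)) * (\<integral>\<^sup>+w. ?u w * indicator (space (iid n l)) w \<partial>iid n l)"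
        using um by (intro nn_integral_Markov_inequality) auto
      also have "(\<integral>\<^sup>+w. ?u w * indicator (space (iid n l)) w \<partial>iid n l) = (\<integral>\<^sup>+w. ?u w \<partial>iid n l)"
        by (intro nn_integral_cong) auto
      finally show ?thesis .
    qed
    also have "(\<integral>\<^sup>+w. ?u w \<partial>iid n l) = (\<Sum>i<n. \<integral>\<^sup>+w. ennreal \<bar>Y (w i) - clip k (w i)\<bar> \<partial>iid n l)"
      using um by (intro nn_integral_sum) auto
    also have "\<dots> = (\<Sum>i<n. ennreal \<eta>)"
    proof (rule sum.cong[OF refl])
      fix i assume i: "i \<in> {..<n}"
      have "(\<integral>\<^sup>+w. ennreal \<bar>Y (w i) - clip k (w i)\<bar> \<partial>iid n l)
        = (\<integral>\<^sup>+x. ennreal \<bar>Y x - clip k x\<bar> \<partial>distr (iid n l) l (\<lambda>w. w i))"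
        using i Y(1) sets by (subst nn_integral_distr) (auto cong: measurable_cong_sets)
      also have "distr (iid n l) l (\<lambda>w. w i) = l"
        using i l.prob_space_axioms by (intro distr_PiM_component) auto
      also have "(\<integral>\<^sup>+x. ennreal \<bar>Y x - clip k x\<bar> \<partial>l) = ennreal \<eta>"
        unfolding \<eta>_def using Y ci by (intro nn_integral_eq_integral) auto
      finally show "(\<integral>\<^sup>+w. ennreal \<bar>Y (w i) - clip k (w i)\<bar> \<partial>iid n l) = ennreal \<eta>" .
    qed
    also have "ennreal (2 / (real n * \<delta>)) * (\<Sum>i<n. ennreal \<eta>) = ennreal (2 / (real n * \<delta>) * (real n * \<eta>))"
      using \<eta>(3) \<delta> by (simp only: ennreal_mult sum_constant card_lessThan ennreal_of_nat_eq_real_of_nat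
        mult_nonneg_nonneg of_nat_0_le_iff divide_nonneg_nonneg less_imp_le zero_le_numeral)
    also have "2 / (real n * \<delta>) * (real n * \<eta>) = 2 * \<eta> / \<delta>" using n by simp
    finally have "measure (iid n l) ?C \<le> 2 * \<eta> / \<delta>"
      using \<eta>(3) \<delta> by (simp add: Q.emeasure_eq_measure ennreal_le_iff)
    also have "\<dots> < r / 2" using \<eta>(2,3) \<delta> r by (simp add: field_simps)
    finally have PC: "measure (iid n l) ?C < r / 2" .
    have sub: "?A \<subseteq> ?B \<union> ?C"
    proof (rule subsetI, rule ccontr)
      fix w assume w: "w \<in> ?A" "w \<notin> ?B \<union> ?C"
      have 1: "(\<Sum>i<n. Y (w i)) \<le> (\<Sum>i<n. clip k (w i)) + (\<Sum>i<n. \<bar>Y (w i) - clip k (w i)\<bar>)"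
        unfolding sum.distrib[symmetric] by (intro sum_mono) auto
      have "s * (\<Sum>i<n. clip k (w i)) < s * (real n * a)"
        using w by (auto simp: sum_distrib_left not_le algebra_simps)
      then have 2: "(\<Sum>i<n. clip k (w i)) < real n * a" using s by (simp only: mult_less_cancel_left_pos)
      have "ennreal (2 / (real n * \<delta>)) * ?u w < 1" using w by auto
      moreover have "ennreal (2 / (real n * \<delta>)) * ?u w = ennreal (2 / (real n * \<delta>) * (\<Sum>i<n. \<bar>Y (w i) - clip k (w i)\<bar>))"
        using \<delta> by (simp add: sum_ennreal sum_nonneg flip: ennreal_mult)
      ultimately have "2 / (real n * \<delta>) * (\<Sum>i<n. \<bar>Y (w i) - clip k (w i)\<bar>) < 1"
        using \<delta> by (simp add: sum_nonneg ennreal_less_one_iff)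
      then have 3: "(\<Sum>i<n. \<bar>Y (w i) - clip k (w i)\<bar>) < real n * (\<delta> / 2)"
        using n \<delta> by (simp add: field_simps)
      have "real n * a + real n * (\<delta>/2) = real n * (a + \<delta>/2)" by (simp add: algebra_simps)
      also have "\<dots> \<le> real n * ((\<integral>x. Y x \<partial>l) + \<delta>)"
        using cd \<eta> \<delta> unfolding a_def by (intro mult_left_mono) auto
      finally show False using w(1) 1 2 3 by auto
    qed
    have "measure (iid n l) ?A \<le> measure (iid n l) (?B \<union> ?C)"
      using sub Bs Cs by (intro Q.finite_measure_mono) auto
    also have "\<dots> \<le> measure (iid n l) ?B + measure (iid n l) ?C"
      using Bs Cs by (intro measure_Un_le)
    also have "\<dots> < r" using PB PC by simp
    finally show "norm (measure (iid n l) ?A - 0) < r" by simp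
  qed
qed

section \<open>Change of measure and completed product spaces\<close>

lemma iid_density:
  fixes l0 :: "'a::metric_space measure"
  assumes l0: "l0 \<in> Pr" and l: "l \<in> Pr" and h: "h \<in> borel_measurable borel" "l = density l0 (\<lambda>x. ennreal (h x))"
  shows "iid n l = density (iid n l0) (\<lambda>w. \<Prod>i<n. ennreal (h (w i)))"
proof -
  interpret l: prob_space l using l by (rule PrD)
  interpret product_sigma_finite "\<lambda>_::nat. l" by standard
  have hm: "(\<lambda>w. ennreal (h (w i))) \<in> borel_measurable (iid n l0)" if "i < n" for i
    using measurable_iid_component[OF l0 h(1) that] by simp
  show ?thesis
  proof (rule PiM_eqI[symmetric])
    show "sets (density (iid n l0) (\<lambda>w. \<Prod>i<n. ennreal (h (w i)))) = sets (iid n l)"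
      using sets_iid[OF l0] sets_iid[OF l] by simp
    fix A :: "nat \<Rightarrow> 'a set" assume A: "\<And>i. i \<in> {..<n} \<Longrightarrow> A i \<in> sets l"
    \<comment> \<open>The sets are filled up with \<open>UNIV\<close> outside the index range, since
      \<open>nn_integral_iid_prod\<close> asks for measurable factors at every index.\<close>
    define A' where "A' i = (if i < n then A i else UNIV)" for i
    have A': "A' i \<in> sets borel" for i using A PrD(1)[OF l] by (auto simp: A'_def)
    have Ps: "Pi\<^sub>E {..<n} A \<in> sets (iid n l0)"
      using A PrD(1)[OF l] PrD(1)[OF l0] by (intro sets_PiM_I_finite) auto
    have "emeasure (density (iid n l0) (\<lambda>w. \<Prod>i<n. ennreal (h (w i)))) (Pi\<^sub>E {..<n} A)
      = (\<integral>\<^sup>+w. (\<Prod>i<n. ennreal (h (w i))) * indicator (Pi\<^sub>E {..<n} A) w \<partial>iid n l0)"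
      using Ps hm by (intro emeasure_density) auto
    also have "\<dots> = (\<integral>\<^sup>+w. (\<Prod>i<n. ennreal (h (w i)) * indicator (A' i) (w i)) \<partial>iid n l0)"
    proof (rule nn_integral_cong)
      fix w assume "w \<in> space (iid n l0)"
      then have "indicator (Pi\<^sub>E {..<n} A) w = (\<Prod>i<n. indicator (A' i) (w i) :: ennreal)"
        by (auto simp: indicator_def space_PiM PiE_iff A'_def prod.If_cases extensional_def split: if_splits)
      then show "(\<Prod>i<n. ennreal (h (w i))) * indicator (Pi\<^sub>E {..<n} A) w
        = (\<Prod>i<n. ennreal (h (w i)) * indicator (A' i) (w i))"
        by (simp add: prod.distrib)
    qed
    also have "\<dots> = (\<Prod>i<n. \<integral>\<^sup>+x. ennreal (h x) * indicator (A' i) x \<partial>l0)"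
      using h(1) A' by (intro nn_integral_iid_prod[OF l0, of "\<lambda>i x. ennreal (h x) * indicator (A' i) x"]) auto
    also have "\<dots> = (\<Prod>i<n. emeasure l (A i))"
    proof (rule prod.cong[OF refl])
      fix i assume "i \<in> {..<n}"
      then show "(\<integral>\<^sup>+x. ennreal (h x) * indicator (A' i) x \<partial>l0) = emeasure l (A i)"
        unfolding h(2) using h(1) A' PrD(1)[OF l0]
        using \<open>i \<in> {..<n}\<close> A
        by (subst emeasure_density) (auto simp: A'_def h(2) cong: measurable_cong_sets)
    qed
    finally show "emeasure (density (iid n l0) (\<lambda>w. \<Prod>i<n. ennreal (h (w i)))) (Pi\<^sub>E {..<n} A)
      = (\<Prod>i<n. emeasure l (A i))" by simp
  qed simp
qed

lemma measure_completion_Un_null: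
  assumes "finite_measure M" "S \<in> sets M" "N' \<in> null_sets M" "N \<subseteq> N'"
  shows "measure (completion M) (S \<union> N) = measure M S"
proof -
  interpret finite_measure M by fact
  interpret c: finite_measure "completion M"
    by (rule finite_measureI) simp
  have N': "N' \<in> sets M" using assms(3) by auto
  have A: "S \<union> N \<in> sets (completion M)" using assms by (intro sets_completionI) auto
  have "measure (completion M) S \<le> measure (completion M) (S \<union> N)"
    using A by (intro c.finite_measure_mono) auto
  moreover have "measure (completion M) (S \<union> N) \<le> measure (completion M) (S \<union> N')"
    using assms N' by (intro c.finite_measure_mono) auto
  moreover have "measure M (S \<union> N') = measure M S" using assms by (intro measure_Un_null_set) auto
  ultimately show ?thesis using assms(2) N' by simp
qed

text \<open>Universally measurable strategies give events that are measurable only after completion.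
  Preimages of null sets are null, so the law of the sample also computes the probability of such
  events.\<close>

lemma measure_completion_distr:
  assumes M: "finite_measure M" and T: "T \<in> measurable M Q" and Q: "distr M Q T = Q"
    and A: "A \<in> sets (completion Q)"
  shows "measure (completion M) (T -` A \<inter> space M) = measure (completion Q) A"
proof -
  obtain S N N' where S: "A = S \<union> N" "N \<subseteq> N'" "N' \<in> null_sets Q" "S \<in> sets Q"
    using sets_completionE[OF A] by metis
  have finQ: "finite_measure Q" using finite_measure.finite_measure_distr[OF M T] Q by simp
  have em: "emeasure M (T -` B \<inter> space M) = emeasure Q B" if "B \<in> sets Q" for B
    using emeasure_distr[OF T that] Q by simp
  have "T -` N' \<inter> space M \<in> null_sets M"
    using S(3) em[of N'] measurable_sets[OF T, of N'] by (auto simp: null_sets_def)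
  moreover have "T -` A \<inter> space M = (T -` S \<inter> space M) \<union> (T -` N \<inter> space M)" using S(1) by auto
  ultimately have "measure (completion M) (T -` A \<inter> space M) = measure M (T -` S \<inter> space M)"
    using S(2,4) measurable_sets[OF T S(4)] by (simp only:) (intro measure_completion_Un_null[OF M], auto)
  also have "\<dots> = measure Q S" using em[OF S(4)] by (simp add: measure_def)
  also have "\<dots> = measure (completion Q) A"
    unfolding S(1) using S by (intro measure_completion_Un_null[OF finQ, symmetric]) auto
  finally show ?thesis .
qed

text \<open>The support of the uniform distribution is the index set only when that set is nonempty,
  hence \<open>n \<ge> 1\<close>. This allows a restricted type vector in place of the whole
  sequence.\<close>

lemma empirical_cong:
  assumes "n \<ge> 1" "\<And>i. i < n \<Longrightarrow> p i = q i"
  shows "empirical n p = empirical n q"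
proof -
  have "set_pmf (pmf_of_set {..<n}) = {..<n}"
    using assms(1) by (intro set_pmf_of_set) (auto simp: lessThan_empty_iff)
  then show ?thesis
    unfolding empirical_def using assms(2) by (intro distr_cong_AE) (auto simp: AE_measure_pmf_iff)
qed

text \<open>Under \<open>l\<close> the log-likelihood per sample has mean \<open>H\<close>, so off a
  set of vanishing probability the density of \<open>iid n l\<close> with respect to
  \<open>iid n l0\<close> is at most \<open>exp (real n * (H + \<delta>))\<close>. Dividing by it
  bounds the probability under \<open>l0\<close> from below.\<close>

lemma iid_change_of_measure:
  fixes l l0 :: "'a::metric_space measure"
  assumes l0: "l0 \<in> Pr" and l: "l \<in> Pr" and H: "rel_entropy l l0 = ereal H"
    and A: "\<And>n. n \<ge> 1 \<Longrightarrow> A n \<in> sets (completion (iid n l0))"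
    and lim: "(\<lambda>n. measure (completion (iid n l)) (A n)) \<longlonglongrightarrow> 1" and \<delta>: "\<delta> > 0"
  shows "\<forall>\<^sub>F n in sequentially. measure (completion (iid n l0)) (A n) \<ge> exp (- (real n * (H + \<delta>))) / 2"
proof -
  let ?h = "\<lambda>x. enn2real (RN_deriv l0 l x)"
  let ?Y = "\<lambda>x. ln (?h x)"
  have ent: "absolutely_continuous l0 l" "integrable l0 (\<lambda>x. ?h x * ?Y x)" "(\<integral>x. ?h x * ?Y x \<partial>l0) = H"
    using H unfolding rel_entropy_def Let_def by (auto split: if_splits)
  note h = Pr_density[OF l l0 ent(1)]
  have hl0: "?h \<in> borel_measurable l0" using h(1) PrD(1)[OF l0] by (simp cong: measurable_cong_sets)
  have Y: "?Y \<in> borel_measurable borel" using h(1) by measurable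
  have Yl0: "?Y \<in> borel_measurable l0" using Y PrD(1)[OF l0] by (simp cong: measurable_cong_sets)
  have "integrable (density l0 (\<lambda>x. ennreal (?h x))) ?Y" using ent(2) hl0 Yl0 by (subst integrable_density) auto
  then have Yi: "integrable l ?Y" using h(2) by simp
  have "(\<integral>x. ?Y x \<partial>density l0 (\<lambda>x. ennreal (?h x))) = H" using ent(3) hl0 Yl0 by (subst integral_density) auto
  then have YH: "(\<integral>x. ?Y x \<partial>l) = H" using h(2) by simp
  let ?T = "\<lambda>n. {w \<in> space (iid n l). (\<Sum>i<n. ?Y (w i)) > real n * (H + \<delta>)}"
  have "(\<lambda>n. measure (iid n l) (?T n)) \<longlonglongrightarrow> 0"
    using wlln_upper[OF l Y Yi \<delta>] YH by simp
  from tendsto_diff[OF lim this]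
  have "\<forall>\<^sub>F n in sequentially. measure (completion (iid n l)) (A n) - measure (iid n l) (?T n) > 1/2"
    by (rule order_tendstoD(1)) simp
  then show ?thesis
    using eventually_ge_at_top[of 1]
  proof eventually_elim
    case (elim n)
    interpret Q: prob_space "iid n l" by (rule prob_space_iid[OF l])
    interpret Q0: prob_space "iid n l0" by (rule prob_space_iid[OF l0])
    let ?g = "\<lambda>w. \<Prod>i<n. ennreal (?h (w i))"
    note dens = iid_density[OF l0 l h, of n]
    have gm: "?g \<in> borel_measurable (iid n l0)"
      using measurable_iid_component[OF l0 h(1)] by (intro borel_measurable_prod_ennreal) auto
    have sets: "sets (iid n l) = sets (iid n l0)" using sets_iid[OF l] sets_iid[OF l0] by simp
    \<comment> \<open>Null sets of \<open>iid n l0\<close> are null for \<open>iid n l\<close> as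
      well, so one decomposition computes the measure of \<open>A n\<close> in both
      completions.\<close>
    obtain S N N' where S: "A n = S \<union> N" "N \<subseteq> N'" "N' \<in> null_sets (iid n l0)" "S \<in> sets (iid n l0)"
      using sets_completionE[OF A[OF elim(2)]] by metis
    have N'l: "N' \<in> null_sets (iid n l)"
      using S(3) absolutely_continuousI_density[OF gm] dens by (auto simp: absolutely_continuous_def)
    have m0: "measure (completion (iid n l0)) (A n) = measure (iid n l0) S"
      unfolding S(1) by (rule measure_completion_Un_null[OF Q0.finite_measure_axioms S(4,3,2)])
    have m1: "measure (completion (iid n l)) (A n) = measure (iid n l) S"
      unfolding S(1) using S sets by (intro measure_completion_Un_null[OF Q.finite_measure_axioms _ N'l]) auto
    have Ym: "(\<lambda>w. ?Y (w i)) \<in> borel_measurable (iid n l)" if "i < n" for i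
      by (rule measurable_iid_component[OF l Y that])
    have Ts: "?T n \<in> sets (iid n l)" using Ym by measurable
    have "measure (iid n l) S \<le> measure (iid n l) (S - ?T n) + measure (iid n l) (?T n)"
    proof -
      have "measure (iid n l) S \<le> measure (iid n l) ((S - ?T n) \<union> ?T n)"
        using S(4) Ts sets by (intro Q.finite_measure_mono) auto
      also have "\<dots> \<le> measure (iid n l) (S - ?T n) + measure (iid n l) (?T n)"
        using S(4) Ts sets by (intro measure_Un_le) auto
      finally show ?thesis .
    qed
    then have half: "1/2 \<le> measure (iid n l) (S - ?T n)" using elim(1) m1 by simp
    define D where "D = S - ?T n"
    have Ds: "D \<in> sets (iid n l0)" unfolding D_def using S(4) Ts sets by auto
    have "emeasure (iid n l) D = (\<integral>\<^sup>+w. ?g w * indicator D w \<partial>iid n l0)"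
      using arg_cong[OF dens, of "\<lambda>M. emeasure M D"] emeasure_density[OF gm Ds] by (rule trans)
    also have "\<dots> \<le> (\<integral>\<^sup>+w. ennreal (exp (real n * (H + \<delta>))) * indicator S w \<partial>iid n l0)"
    proof (rule nn_integral_mono)
      fix w assume w: "w \<in> space (iid n l0)"
      show "?g w * indicator D w \<le> ennreal (exp (real n * (H + \<delta>))) * indicator S w"
      proof (cases "w \<in> D")
        case True
        have wl: "w \<in> space (iid n l)" using w sets_eq_imp_space_eq[OF sets] by simp
        have sumY: "(\<Sum>i<n. ?Y (w i)) \<le> real n * (H + \<delta>)" using True wl by (auto simp: D_def)
        have "?g w \<le> ennreal (exp (real n * (H + \<delta>)))"
        \<comment> \<open>Where some factor vanishes, exponentiating the sum of logarithms does not
          give the product; the product is 0 there and the bound is trivial.\<close>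
        proof (cases "\<exists>i<n. ?h (w i) = 0")
          case True
          then have "?g w = 0" by (intro prod_zero) auto
          then show ?thesis by (rule ord_eq_le_trans) simp
        next
          case False
          then have pos: "?h (w i) > 0" if "i < n" for i using that by (metis enn2real_nonneg less_eq_real_def)
          have "?g w = ennreal (\<Prod>i<n. ?h (w i))" by (simp add: prod_ennreal)
          also have "(\<Prod>i<n. ?h (w i)) = (\<Prod>i<n. exp (?Y (w i)))" using pos by (intro prod.cong) auto
          also have "\<dots> = exp (\<Sum>i<n. ?Y (w i))" by (simp add: exp_sum)
          finally show ?thesis using sumY by (simp add: ennreal_leI)
        qed
        then show ?thesis using True by (simp add: D_def)
      qed simp
    qed
    also have "\<dots> = ennreal (exp (real n * (H + \<delta>))) * emeasure (iid n l0) S"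
      using S(4) by (simp add: nn_integral_cmult_indicator)
    finally have "ennreal (measure (iid n l) D) \<le> ennreal (exp (real n * (H + \<delta>)) * measure (iid n l0) S)"
      by (simp add: Q.emeasure_eq_measure Q0.emeasure_eq_measure ennreal_mult)
    then have "measure (iid n l) D \<le> exp (real n * (H + \<delta>)) * measure (iid n l0) S"
      by (simp add: ennreal_le_iff)
    with half[folded D_def] have "1/2 \<le> exp (real n * (H + \<delta>)) * measure (iid n l0) S" by linarith
    then have "exp (- (real n * (H + \<delta>))) * (1/2) \<le> exp (- (real n * (H + \<delta>))) * (exp (real n * (H + \<delta>)) * measure (iid n l0) S)"
      by (intro mult_left_mono) auto
    also have "\<dots> = measure (iid n l0) S" by (simp add: exp_minus)
    finally show ?case using m0 by simp
  qed
qed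

section \<open>From exponential estimates to logarithmic rates\<close>

lemma limsup_nlog_le:
  fixes p :: "nat \<Rightarrow> real"
  assumes p: "\<forall>\<^sub>F n in sequentially. 0 \<le> p n \<and> p n \<le> K * exp (- (real n * d))" and d: "c < d"
  shows "limsup (\<lambda>n. nlog n (p n)) \<le> ereal (- c)"
proof (rule Limsup_bounded)
  \<comment> \<open>Beyond this index the gap \<open>d - c\<close> absorbs \<open>ln K\<close>, so
    constants from finite covers vanish in the limit.\<close>
  obtain N where N: "ln K / (d - c) < real N" using reals_Archimedean2 by blast
  show "\<forall>\<^sub>F n in sequentially. nlog n (p n) \<le> ereal (- c)"
    using p eventually_ge_at_top[of "max N 1"]
  proof eventually_elim
    case (elim n)
    show ?case
    proof (cases "p n = 0")
      case False
      then have pn: "p n > 0" using elim by simp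
      then have K: "K > 0" using elim zero_less_mult_pos2[of K "exp (- (real n * d))"] by (metis exp_gt_zero less_le_trans)
      have "ln (p n) \<le> ln (K * exp (- (real n * d)))" using pn elim by (subst ln_le_cancel_iff) auto
      also have "\<dots> = ln K - real n * d" using K by (simp add: ln_mult)
      also have "ln K \<le> real n * (d - c)"
      proof -
        have "ln K / (d - c) \<le> real n" using N elim by linarith
        then show ?thesis using d by (simp add: divide_le_eq)
      qed
      finally have "ln (p n) / real n \<le> - c" using elim by (simp add: field_simps)
      then show ?thesis using False by (simp add: nlog_def)
    qed (simp add: nlog_def)
  qed
qed

lemma liminf_nlog_ge:
  fixes p :: "nat \<Rightarrow> real"
  assumes p: "\<And>\<delta>. \<delta> > 0 \<Longrightarrow> \<forall>\<^sub>F n in sequentially. p n \<ge> exp (- (real n * (H + \<delta>))) / 2"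
  shows "liminf (\<lambda>n. nlog n (p n)) \<ge> ereal (- H)"
proof (rule ereal_le_epsilon2)
  fix e :: real assume e: "0 < e"
  \<comment> \<open>From this index on, half of \<open>e\<close> pays for the factor 1/2 in the
    hypothesis; the other half is used as \<open>\<delta>\<close>.\<close>
  obtain N where N: "2 * ln 2 / e < real N" using reals_Archimedean2 by blast
  have "ereal (- H - e) \<le> liminf (\<lambda>n. nlog n (p n))"
  proof (rule Liminf_bounded)
    show "\<forall>\<^sub>F n in sequentially. ereal (- H - e) \<le> nlog n (p n)"
      using p[OF half_gt_zero[OF e]] eventually_ge_at_top[of "max N 1"]
    proof eventually_elim
      case (elim n)
      have pn: "p n > 0" using elim(1) by (rule less_le_trans[rotated]) simp
      have "- (real n * (H + e/2)) - ln 2 = ln (exp (- (real n * (H + e/2))) / 2)" by (simp add: ln_div)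
      also have "\<dots> \<le> ln (p n)" using elim(1) pn by (subst ln_le_cancel_iff) auto
      finally have "- (real n * (H + e/2)) - ln 2 \<le> ln (p n)" .
      moreover have "ln 2 \<le> real n * (e/2)"
      proof -
        have "2 * ln 2 / e \<le> real n" using N elim by linarith
        then show ?thesis using e by (simp add: divide_le_eq)
      qed
      ultimately have "real n * (- H - e) \<le> ln (p n)" by (simp add: algebra_simps)
      then have "- H - e \<le> ln (p n) / real n" using elim by (simp add: le_divide_eq mult.commute)
      then show ?case using pn by (simp add: nlog_def)
    qed
  qed
  then have "ereal (- H - e) + ereal e \<le> liminf (\<lambda>n. nlog n (p n)) + ereal e" by (rule add_right_mono)
  then show "ereal (- H) \<le> liminf (\<lambda>n. nlog n (p n)) + ereal e" by simp
qed

subsection \<open>Empirical measures\<close>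

text \<open>The action type is only a metric space; its second countability comes from compactness,
  through finite nets of radius \<open>1 / real (Suc k)\<close>.\<close>

lemma compact_countable_basis:
  assumes "compact (UNIV :: 'x::metric_space set)"
  obtains \<B> :: "'x::metric_space set set" where "countable \<B>" "topological_basis \<B>"
proof -
  have "\<exists>D. finite D \<and> (UNIV :: 'x set) \<subseteq> (\<Union>c\<in>D. ball c (1 / real (Suc k)))" for k
  proof -
    have "(UNIV :: 'x set) \<subseteq> (\<Union>c\<in>UNIV. ball c (1 / real (Suc k)))"
      by (rule subsetI, rule_tac a=x in UN_I) simp_all
    from compactE_image[OF assms _ this] obtain D
      where "finite D" "(UNIV :: 'x set) \<subseteq> (\<Union>c\<in>D. ball c (1 / real (Suc k)))" by (metis open_ball)
    then show ?thesis by blast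
  qed
  then obtain D where D: "\<And>k. finite (D k)" "\<And>k. (UNIV :: 'x set) \<subseteq> (\<Union>c\<in>D k. ball c (1 / real (Suc k)))"
    by metis
  define \<B> where "\<B> = (\<Union>k. (\<lambda>c. ball c (1 / real (Suc k))) ` D k)"
  show thesis
  proof
    show "countable \<B>" unfolding \<B>_def using D(1) by (auto intro: countable_finite)
    show "topological_basis \<B>"
    proof (rule topological_basisI)
      fix b assume "b \<in> \<B>" then show "open b" by (auto simp: \<B>_def)
    next
      fix U :: "'x set" and x assume "open U" "x \<in> U"
      then obtain e where e: "e > 0" "ball x e \<subseteq> U" by (auto simp: open_contains_ball)
      obtain k where k: "1 / real (Suc k) < e / 2" using e(1) by (metis half_gt_zero nat_approx_posE)
      obtain c where c: "c \<in> D k" "x \<in> ball c (1 / real (Suc k))" using D(2)[of k] by blast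
      have "ball c (1 / real (Suc k)) \<subseteq> ball x e"
      proof
        fix y assume "y \<in> ball c (1 / real (Suc k))"
        then have "dist x y < 1 / real (Suc k) + 1 / real (Suc k)"
          using c(2) dist_triangle[of x y c] by (simp add: dist_commute)
        then show "y \<in> ball x e" using k by simp
      qed
      with c e(2) show "\<exists>B'\<in>\<B>. x \<in> B' \<and> B' \<subseteq> U" by (auto simp: \<B>_def intro!: bexI[of _ c])
    qed
  qed
qed

text \<open>Rectangles are kept because measurability of types and of actions is given separately,
  not for the pair.\<close>

lemma rectangle_basis:
  assumes "compact (UNIV :: 'x::metric_space set)"
  obtains \<B> :: "('w::polish_space \<times> 'x::metric_space) set set" where "countable \<B>" "topological_basis \<B>"
    "\<And>R. R \<in> \<B> \<Longrightarrow> \<exists>U V. open U \<and> open V \<and> R = U \<times> V"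
proof -
  obtain \<B>x :: "'x set set" where x: "countable \<B>x" "topological_basis \<B>x"
    using compact_countable_basis[OF assms] by blast
  obtain \<B>w :: "'w set set" where w: "countable \<B>w" "topological_basis \<B>w"
    using ex_countable_basis by blast
  show thesis
  proof
    show "countable ((\<lambda>(a, b). a \<times> b) ` (\<B>w \<times> \<B>x))" using x w by auto
    show "topological_basis ((\<lambda>(a, b). a \<times> b) ` (\<B>w \<times> \<B>x))" by (rule topological_basis_prod[OF w(2) x(2)])
    show "\<exists>U V. open U \<and> open V \<and> R = U \<times> V" if "R \<in> (\<lambda>(a, b). a \<times> b) ` (\<B>w \<times> \<B>x)" for R
      using that topological_basis_open[OF w(2)] topological_basis_open[OF x(2)] by auto
  qed
qed

text \<open>Otherwise the null members of a countable basis would cover \<open>G\<close>, and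
  \<open>G\<close> would be null.\<close>

lemma support_point:
  fixes m :: "'a::metric_space measure"
  assumes \<B>: "countable (\<B> :: 'a set set)" "topological_basis \<B>" and m: "m \<in> Pr" and G: "open G" "emeasure m G \<noteq> 0"
  shows "\<exists>z\<in>G. \<forall>V. open V \<longrightarrow> z \<in> V \<longrightarrow> emeasure m V \<noteq> 0"
proof (rule ccontr)
  assume "\<not> ?thesis"
  then have no: "\<forall>z\<in>G. \<exists>V. open V \<and> z \<in> V \<and> emeasure m V = 0" by simp
  have *: "\<exists>b\<in>\<B>. z \<in> b \<and> emeasure m b = 0" if z: "z \<in> G" for z
  proof -
    obtain V where V: "open V" "z \<in> V" "emeasure m V = 0" using no z by blast
    obtain b where b: "b \<in> \<B>" "z \<in> b" "b \<subseteq> V" using topological_basisE[OF \<B>(2) V(1,2)] by blast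
    have "emeasure m b \<le> emeasure m V" using V(1) b PrD(1)[OF m] by (intro emeasure_mono) auto
    then show ?thesis using V(3) b by auto
  qed
  let ?N = "\<Union>b\<in>{b \<in> \<B>. emeasure m b = 0}. b"
  have "?N \<in> null_sets m"
    using \<B> topological_basis_open[OF \<B>(2)] PrD(1)[OF m]
    by (intro null_sets_UN') (auto simp: null_sets_def)
  moreover have "G \<subseteq> ?N" using * by blast
  moreover have "G \<in> sets m" using G(1) PrD(1)[OF m] by simp
  ultimately have "G \<in> null_sets m" by (blast intro: null_sets_subset)
  then show False using G(2) by auto
qed

text \<open>Detects that \<open>m\<close> charges \<open>G\<close> through the integral of a
  continuous function, that is, by a weakly open condition.\<close>

lemma bump:
  assumes m: "m \<in> Pr" and G: "open G" "emeasure m G \<noteq> 0"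
  shows "(\<integral>x. tent 1 G x \<partial>m) > 0"
proof (rule ccontr)
  assume "\<not> ?thesis"
  moreover have "(\<integral>x. tent 1 G x \<partial>m) \<ge> 0" by (simp add: tent_bounds)
  ultimately have "(\<integral>x. tent 1 G x \<partial>m) = 0" by simp
  then have ae: "AE x in m. tent 1 G x = 0"
    using integral_nonneg_eq_0_iff_AE[OF Pr_integrable[OF m tent_Cb]] by (auto simp: tent_bounds)
  have pos: "tent 1 G x > 0" if "x \<in> G" for x
    using that G(1) infdist_pos_not_in_closed[of "- G" x] by (auto simp: tent_def closed_Compl)
  have "AE x in m. x \<notin> G" using ae by eventually_elim (use pos in force)
  then have "G \<in> null_sets m" using AE_iff_null_sets[of G m] G(1) PrD(1)[OF m] by simp
  then show False using G(2) by auto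
qed

lemma empirical_Pr: "n \<ge> 1 \<Longrightarrow> empirical n p \<in> Pr"
  unfolding Pr_def empirical_def
  by (auto intro!: prob_space.prob_space_distr measure_pmf.prob_space_axioms)

lemma integral_empirical:
  fixes f :: "'a::topological_space \<Rightarrow> real"
  assumes "n \<ge> 1" "f \<in> borel_measurable borel"
  shows "(\<integral>x. f x \<partial>empirical n p) = (\<Sum>i<n. f (p i)) / real n"
proof -
  have "{..<n} \<noteq> {}" using assms(1) by (auto simp: lessThan_empty_iff)
  then show ?thesis
    unfolding empirical_def using assms(2)
    by (subst integral_distr) (auto simp: integral_pmf_of_set)
qed

lemma measure_empirical:
  assumes "n \<ge> 1" "A \<in> sets borel"
  shows "measure (empirical n p) A = (\<Sum>i<n. indicator A (p i)) / real n"
proof -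
  have "measure (empirical n p) A = (\<integral>x. indicator A x \<partial>empirical n p)"
    using assms empirical_Pr[OF assms(1), of p] by (simp add: Pr_def)
  also have "\<dots> = (\<Sum>i<n. indicator A (p i)) / real n"
    using assms by (intro integral_empirical) auto
  finally show ?thesis .
qed

text \<open>Only one summand changes. This is why the deviation of a single player does not leave a
  weak neighbourhood once n is large.\<close>

lemma empirical_perturb:
  fixes f :: "'a::topological_space \<Rightarrow> real"
  assumes n: "n \<ge> 1" and f: "f \<in> borel_measurable borel" "\<And>x. \<bar>f x\<bar> \<le> B"
    and pq: "\<And>j. j \<noteq> i \<Longrightarrow> p j = q j"
  shows "\<bar>(\<integral>x. f x \<partial>empirical n p) - (\<integral>x. f x \<partial>empirical n q)\<bar> \<le> 2 * B / real n"
proof -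
  have "(\<Sum>j<n. f (p j) - f (q j)) = (\<Sum>j<n. if j = i then f (p i) - f (q i) else 0)"
    using pq by (intro sum.cong) auto
  also have "\<dots> = (if i < n then f (p i) - f (q i) else 0)" by simp
  finally have "\<bar>\<Sum>j<n. f (p j) - f (q j)\<bar> \<le> 2 * B"
    using f(2)[of "p i"] f(2)[of "q i"] by auto
  moreover have "(\<integral>x. f x \<partial>empirical n p) - (\<integral>x. f x \<partial>empirical n q) = (\<Sum>j<n. f (p j) - f (q j)) / real n"
    using n f(1) by (simp add: integral_empirical sum_subtractf diff_divide_distrib)
  ultimately show ?thesis using n by (simp add: divide_right_mono)
qed

lemma wmarg_Pr: "m \<in> Pr \<Longrightarrow> wmarg m \<in> Pr"
  and integral_wmarg: "m \<in> Pr \<Longrightarrow> f \<in> Cb \<Longrightarrow> (\<integral>w. f w \<partial>wmarg m) = (\<integral>z. f (fst z) \<partial>m)"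
proof -
  assume m: "m \<in> Pr"
  have fm: "fst \<in> measurable m borel"
    using PrD(1)[OF m] borel_measurable_continuous_onI[OF continuous_on_fst[OF continuous_on_id]]
    by (simp cong: measurable_cong_sets)
  show "wmarg m \<in> Pr"
    using m fm unfolding Pr_def wmarg_def by (auto intro: prob_space.prob_space_distr)
  show "(\<integral>w. f w \<partial>wmarg m) = (\<integral>z. f (fst z) \<partial>m)" if "f \<in> Cb"
    unfolding wmarg_def using fm Cb_measurable[OF that] by (subst integral_distr) auto
qed

lemma Cb_fst: "f \<in> Cb \<Longrightarrow> (\<lambda>z. f (fst z)) \<in> Cb"
  unfolding Cb_def
  by (auto intro!: continuous_on_compose2[of UNIV f] continuous_intros bounded_subset[of "range f"])

text \<open>Finitely many test functions move by less than \<open>\<eta>\<close> if every sample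
  point stays close to its place. Basis sets are used so that the lists \<open>Rs\<close> range over
  a countable family.\<close>

lemma empirical_open_nbhd:
  fixes \<B> :: "'a::metric_space set set"
  assumes \<B>: "topological_basis \<B>" and n: "n \<ge> 1" and U: "openin weak_top U" "empirical n p \<in> U"
  shows "\<exists>Rs\<in>lists \<B>. length Rs = n \<and> (\<forall>i<n. p i \<in> Rs ! i) \<and>
    (\<forall>q. (\<forall>i<n. q i \<in> Rs ! i) \<longrightarrow> empirical n q \<in> U)"
proof -
  obtain J \<eta> where J: "finite J" "J \<subseteq> Cb" "\<eta> > 0"
    "\<And>m'. m' \<in> Pr \<Longrightarrow> (\<And>f. f \<in> J \<Longrightarrow> \<bar>(\<integral>x. f x \<partial>m') - (\<integral>x. f x \<partial>empirical n p)\<bar> < \<eta>) \<Longrightarrow> m' \<in> U"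
    using weak_top_nbhd[OF U] by metis
  define G where "G i = (\<Inter>f\<in>J. {z. \<bar>f z - f (p i)\<bar> < \<eta>})" for i
  have Go: "open (G i)" for i
    unfolding G_def using J(1,2)
    by (intro open_INT ballI open_Collect_less) (auto simp: Cb_def subset_iff intro!: continuous_intros)
  have "\<exists>R\<in>\<B>. p i \<in> R \<and> R \<subseteq> G i" for i
  proof -
    have "p i \<in> G i" using J(3) by (simp add: G_def)
    then obtain R where "R \<in> \<B>" "p i \<in> R" "R \<subseteq> G i" by (rule topological_basisE[OF \<B> Go])
    then show ?thesis by blast
  qed
  then obtain R where R: "\<And>i. R i \<in> \<B>" "\<And>i. p i \<in> R i" "\<And>i. R i \<subseteq> G i" by metis
  have "empirical n q \<in> U" if q: "\<forall>i<n. q i \<in> R i" for q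
  proof (rule J(4)[OF empirical_Pr[OF n]])
    fix f assume f: "f \<in> J"
    then have fm: "f \<in> borel_measurable borel" using J(2) Cb_measurable by blast
    have "\<bar>\<Sum>i<n. f (q i) - f (p i)\<bar> \<le> (\<Sum>i<n. \<bar>f (q i) - f (p i)\<bar>)" by (rule sum_abs)
    also have "\<dots> < (\<Sum>i<n. \<eta>)"
    proof (rule sum_strict_mono)
      show "{..<n} \<noteq> {}" using n by (auto simp: lessThan_empty_iff)
      fix i assume "i \<in> {..<n}"
      then have "q i \<in> G i" using q R(3)[of i] by blast
      then show "\<bar>f (q i) - f (p i)\<bar> < \<eta>" using f by (auto simp: G_def)
    qed simp
    finally have "\<bar>\<Sum>i<n. f (q i) - f (p i)\<bar> / real n < \<eta>" using n by (simp add: field_simps)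
    moreover have "(\<integral>x. f x \<partial>empirical n q) - (\<integral>x. f x \<partial>empirical n p) = (\<Sum>i<n. f (q i) - f (p i)) / real n"
      using n fm by (simp add: integral_empirical sum_subtractf diff_divide_distrib)
    ultimately show "\<bar>(\<integral>x. f x \<partial>empirical n q) - (\<integral>x. f x \<partial>empirical n p)\<bar> < \<eta>" by simp
  qed
  then show ?thesis using R by (intro bexI[of _ "map R [0..<n]"]) auto
qed

text \<open>The preimage of a weakly open set is a countable union of measurable boxes, one for each
  admissible list of basis rectangles; the rest is induction over the generated
  sigma-algebra.\<close>

lemma empirical_weak_borel_measurable:
  fixes g1 :: "nat \<Rightarrow> 'a \<Rightarrow> 'w::polish_space" and g2 :: "nat \<Rightarrow> 'a \<Rightarrow> 'x::metric_space"
  assumes X: "compact (UNIV :: 'x set)" and n: "n \<ge> 1"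
    and g1: "\<And>i. i < n \<Longrightarrow> g1 i \<in> measurable N borel" and g2: "\<And>i. i < n \<Longrightarrow> g2 i \<in> measurable N borel"
    and A: "A \<in> weak_borel"
  shows "{\<omega> \<in> space N. empirical n (\<lambda>i. (g1 i \<omega>, g2 i \<omega>)) \<in> A} \<in> sets N"
proof -
  let ?e = "\<lambda>\<omega>. empirical n (\<lambda>i. (g1 i \<omega>, g2 i \<omega>))"
  obtain \<B> :: "('w \<times> 'x) set set" where \<B>: "countable \<B>" "topological_basis \<B>"
    "\<And>R. R \<in> \<B> \<Longrightarrow> \<exists>U V. open U \<and> open V \<and> R = U \<times> V"
    using rectangle_basis[OF X, where 'w='w] by metis
  show ?thesis
    using A unfolding weak_borel_def
  proof (induction rule: sigma_sets.induct)
    case (Basic U)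
    then have U: "openin weak_top U" by simp
    define \<G> where "\<G> = {Rs \<in> lists \<B>. length Rs = n \<and> (\<forall>q. (\<forall>i<n. q i \<in> Rs ! i) \<longrightarrow> empirical n q \<in> U)}"
    have "countable \<G>" using \<B>(1) unfolding \<G>_def by (intro countable_Collect countable_lists)
    moreover have "{\<omega> \<in> space N. \<forall>i\<in>{..<n}. (g1 i \<omega>, g2 i \<omega>) \<in> Rs ! i} \<in> sets N" if Rs: "Rs \<in> \<G>" for Rs
    proof (rule sets.sets_Collect_finite_All)
      fix i assume i: "i \<in> {..<n}"
      then have "Rs ! i \<in> \<B>" using Rs by (auto simp: \<G>_def in_lists_conv_set)
      from \<B>(3)[OF this] obtain V V' where V: "open V" "open V'" "Rs ! i = V \<times> V'" by blast
      have "{\<omega> \<in> space N. (g1 i \<omega>, g2 i \<omega>) \<in> Rs ! i} = (g1 i -` V \<inter> space N) \<inter> (g2 i -` V' \<inter> space N)"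
        using V(3) by auto
      also have "\<dots> \<in> sets N"
        using i V(1,2) by (intro sets.Int measurable_sets[OF g1] measurable_sets[OF g2]) auto
      finally show "{\<omega> \<in> space N. (g1 i \<omega>, g2 i \<omega>) \<in> Rs ! i} \<in> sets N" .
    qed simp
    ultimately have "(\<Union>Rs\<in>\<G>. {\<omega> \<in> space N. \<forall>i\<in>{..<n}. (g1 i \<omega>, g2 i \<omega>) \<in> Rs ! i}) \<in> sets N"
      by (intro sets.countable_UN') auto
    also have "(\<Union>Rs\<in>\<G>. {\<omega> \<in> space N. \<forall>i\<in>{..<n}. (g1 i \<omega>, g2 i \<omega>) \<in> Rs ! i}) = {\<omega> \<in> space N. ?e \<omega> \<in> U}"
    proof (intro equalityI subsetI)
      fix \<omega> assume "\<omega> \<in> (\<Union>Rs\<in>\<G>. {\<omega> \<in> space N. \<forall>i\<in>{..<n}. (g1 i \<omega>, g2 i \<omega>) \<in> Rs ! i})"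
      then show "\<omega> \<in> {\<omega> \<in> space N. ?e \<omega> \<in> U}" by (auto simp: \<G>_def)
    next
      fix \<omega> assume \<omega>: "\<omega> \<in> {\<omega> \<in> space N. ?e \<omega> \<in> U}"
      then have "?e \<omega> \<in> U" by simp
      from empirical_open_nbhd[OF \<B>(2) n U this] obtain Rs where Rs: "Rs \<in> lists \<B>" "length Rs = n"
        "\<forall>i<n. (g1 i \<omega>, g2 i \<omega>) \<in> Rs ! i" "\<forall>q. (\<forall>i<n. q i \<in> Rs ! i) \<longrightarrow> empirical n q \<in> U" by blast
      then have "Rs \<in> \<G>" by (simp add: \<G>_def)
      with Rs(3) \<omega> show "\<omega> \<in> (\<Union>Rs\<in>\<G>. {\<omega> \<in> space N. \<forall>i\<in>{..<n}. (g1 i \<omega>, g2 i \<omega>) \<in> Rs ! i})" by auto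
    qed
    finally show ?case .
  next
    case Empty then show ?case by simp
  next
    case (Compl a)
    have "{\<omega> \<in> space N. ?e \<omega> \<in> Pr - a} = space N - {\<omega> \<in> space N. ?e \<omega> \<in> a}"
      using empirical_Pr[OF n] by auto
    then show ?case using Compl.IH by auto
  next
    case (Union a)
    have "{\<omega> \<in> space N. ?e \<omega> \<in> (\<Union>i. a i)} = (\<Union>i. {\<omega> \<in> space N. ?e \<omega> \<in> a i})" by auto
    then show ?case using Union.IH by auto
  qed
qed

subsection \<open>Approximate equilibria\<close>

locale game =
  fixes C :: "'w::polish_space \<Rightarrow> 'x::metric_space set"
    and F :: "('w \<times> 'x) measure \<Rightarrow> 'w \<Rightarrow> 'x \<Rightarrow> real"
    and eps :: "nat \<Rightarrow> real"
  assumes X_compact: "compact (UNIV :: 'x set)"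
    and C_ne: "\<And>w. C w \<noteq> {}"
    and C_cont: "cont_corr C"
    and F_cont: "continuous_map (prod_topology weak_top (prod_topology euclidean euclidean))
                   euclideanreal (\<lambda>(m, w, x). F m w x)"
    and F_bdd: "\<exists>B. \<forall>m\<in>Pr. \<forall>w x. \<bar>F m w x\<bar> \<le> B"
    and eps_lim: "eps \<longlonglongrightarrow> 0"
begin

lemma F_nbhd:
  assumes m: "m \<in> Pr" and e: "e > 0"
  obtains U V V' where "openin weak_top U" "m \<in> U" "open V" "w \<in> V" "open V'" "x \<in> V'"
    "\<And>m' w' x'. m' \<in> U \<Longrightarrow> w' \<in> V \<Longrightarrow> x' \<in> V' \<Longrightarrow> \<bar>F m' w' x' - F m w x\<bar> < e"
proof -
  let ?T = "prod_topology weak_top (prod_topology euclidean euclidean) :: (('w \<times> 'x) measure \<times> 'w \<times> 'x) topology"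
  let ?S = "{p \<in> topspace ?T. (case p of (m, w, x) \<Rightarrow> F m w x) \<in> ball (F m w x) e}"
  have S: "openin ?T ?S" by (rule openin_continuous_map_preimage[OF F_cont]) simp
  have in_S: "(m, w, x) \<in> ?S" using m e by simp
  from S[unfolded openin_prod_topology_alt[of weak_top], rule_format, OF in_S] obtain U Q where U: "openin weak_top U" "openin (prod_topology euclidean euclidean) Q"
    "m \<in> U" "(w, x) \<in> Q" "U \<times> Q \<subseteq> ?S"
    by (elim exE conjE)
  from U(2)[unfolded openin_prod_topology_alt, rule_format, OF U(4)] obtain V V' where V: "openin euclidean V" "openin euclidean V'" "w \<in> V" "x \<in> V'" "V \<times> V' \<subseteq> Q"
    by (elim exE conjE)
  show thesis
  proof (rule that[OF U(1,3) _ V(3) _ V(4)])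
    fix m' w' x' assume "m' \<in> U" "w' \<in> V" "x' \<in> V'"
    then have "(m', w', x') \<in> ?S" using U V by blast
    then show "\<bar>F m' w' x' - F m w x\<bar> < e" by (auto simp: dist_real_def abs_minus_commute)
  qed (use V in auto)
qed

text \<open>If no neighbourhood worked, types taken from shrinking balls would converge to
  \<open>w\<close> with no feasible action in \<open>V\<close>, against the sequential continuity of
  \<open>C\<close>.\<close>

lemma lower_hemicontinuous:
  assumes y: "y \<in> C w" and V: "open V" "y \<in> V"
  obtains U where "open U" "w \<in> U" "\<And>w'. w' \<in> U \<Longrightarrow> C w' \<inter> V \<noteq> {}"
proof (rule ccontr)
  assume no: "\<not> thesis"
  have "\<exists>w'. dist w' w < 1 / real (Suc n) \<and> C w' \<inter> V = {}" for n
  proof (rule ccontr)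
    assume "\<not> ?thesis"
    then have "\<And>w'. w' \<in> ball w (1 / real (Suc n)) \<Longrightarrow> C w' \<inter> V \<noteq> {}" by (auto simp: dist_commute)
    then show False using no that[of "ball w (1 / real (Suc n))"] by simp
  qed
  then obtain wn where wn: "\<And>n. dist (wn n) w < 1 / real (Suc n)" "\<And>n. C (wn n) \<inter> V = {}" by metis
  have "wn \<longlonglongrightarrow> w"
    unfolding tendsto_dist_iff[of wn]
  proof (rule tendsto_sandwich[OF _ _ tendsto_const LIMSEQ_inverse_real_of_nat])
    show "\<forall>\<^sub>F n in sequentially. dist (wn n) w \<le> inverse (real (Suc n))"
      using wn(1) by (intro always_eventually allI) (simp add: inverse_eq_divide less_imp_le del: of_nat_Suc)
  qed simp
  then obtain r xs where rx: "\<And>k. xs k \<in> C (wn (r k))" "xs \<longlonglongrightarrow> y"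
    using C_cont y unfolding cont_corr_def by blast
  have "\<forall>\<^sub>F k in sequentially. xs k \<in> V" using topological_tendstoD[OF rx(2) V] .
  then obtain k where "xs k \<in> V" by (auto simp: eventually_sequentially)
  then show False using rx(1)[of k] wn(2)[of "r k"] by blast
qed

text \<open>Two independent measures occur because a deviation is judged at the perturbed empirical
  measure, the original action at the unperturbed one. The better action \<open>y'\<close> depends
  on the type but not on the measures.\<close>

lemma strict_nbhd:
  assumes m: "m \<in> Pr" and y: "y \<in> C w" and lt: "F m w y < F m w x"
  obtains U G d where "openin weak_top U" "m \<in> U" "open G" "(w, x) \<in> G" "d > 0"
    "\<And>w' x'. (w', x') \<in> G \<Longrightarrow> \<exists>y'\<in>C w'. \<forall>m1\<in>U. \<forall>m2\<in>U. F m2 w' y' + d < F m1 w' x'"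
proof -
  \<comment> \<open>Two errors below \<open>d\<close> leave more than \<open>d\<close> of the gap
    \<open>3 * d\<close>.\<close>
  define d where "d = (F m w x - F m w y) / 3"
  have d: "d > 0" using lt by (simp add: d_def)
  obtain U1 V1 V1' where 1: "openin weak_top U1" "m \<in> U1" "open V1" "w \<in> V1" "open V1'" "x \<in> V1'"
    "\<And>m' w' x'. m' \<in> U1 \<Longrightarrow> w' \<in> V1 \<Longrightarrow> x' \<in> V1' \<Longrightarrow> \<bar>F m' w' x' - F m w x\<bar> < d"
    using F_nbhd[OF m d, of w x] by blast
  obtain U2 V2 V2' where 2: "openin weak_top U2" "m \<in> U2" "open V2" "w \<in> V2" "open V2'" "y \<in> V2'"
    "\<And>m' w' x'. m' \<in> U2 \<Longrightarrow> w' \<in> V2 \<Longrightarrow> x' \<in> V2' \<Longrightarrow> \<bar>F m' w' x' - F m w y\<bar> < d"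
    using F_nbhd[OF m d, of w y] by blast
  obtain V3 where 3: "open V3" "w \<in> V3" "\<And>w'. w' \<in> V3 \<Longrightarrow> C w' \<inter> V2' \<noteq> {}"
    using lower_hemicontinuous[OF y 2(5,6)] by blast
  show thesis
  proof (rule that[of "U1 \<inter> U2" "(V1 \<inter> V2 \<inter> V3) \<times> V1'" d])
    fix w' x' assume wx: "(w', x') \<in> (V1 \<inter> V2 \<inter> V3) \<times> V1'"
    then obtain y' where y': "y' \<in> C w'" "y' \<in> V2'" using 3(3)[of w'] by blast
    have "F m2 w' y' + d < F m1 w' x'" if "m1 \<in> U1 \<inter> U2" "m2 \<in> U1 \<inter> U2" for m1 m2
    proof -
      have "\<bar>F m1 w' x' - F m w x\<bar> < d" "\<bar>F m2 w' y' - F m w y\<bar> < d"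
        using 1(7)[of m1 w' x'] 2(7)[of m2 w' y'] that wx y'(2) by auto
      moreover have "3 * d = F m w x - F m w y" by (simp add: d_def)
      ultimately show ?thesis by linarith
    qed
    then show "\<exists>y'\<in>C w'. \<forall>m1\<in>U1 \<inter> U2. \<forall>m2\<in>U1 \<inter> U2. F m2 w' y' + d < F m1 w' x'" using y'(1) by blast
  qed (use 1 2 3 d in \<open>auto intro: open_Times\<close>)
qed

text \<open>The failure of the equilibrium conditions, written with a strict improvement instead of
  an infimum so that openness can be checked pointwise.\<close>

definition deviating :: "('w \<times> 'x) measure \<Rightarrow> ('w \<times> 'x) set" where
  "deviating m = {(w, x). x \<notin> C w \<or> (\<exists>y\<in>C w. F m w y < F m w x)}"

text \<open>The closed graph of \<open>C\<close> handles infeasible actions,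
  \<open>strict_nbhd\<close> the profitable deviations. Openness lets a positive mass of deviations
  be located at a support point.\<close>

lemma open_deviating:
  assumes m: "m \<in> Pr"
  shows "open (deviating m)"
proof (subst open_subopen, intro ballI)
  fix z assume z: "z \<in> deviating m"
  obtain w x where wx: "z = (w, x)" by (cases z)
  show "\<exists>T. open T \<and> z \<in> T \<and> T \<subseteq> deviating m"
  proof (cases "x \<in> C w")
    case False
    have "open (- {(w, x). x \<in> C w})" using C_cont by (auto simp: cont_corr_def open_Compl)
    then show ?thesis
      by (rule_tac x="- {(w, x). x \<in> C w}" in exI) (use False wx in \<open>auto simp: deviating_def\<close>)
  next
    case True
    then obtain y where y: "y \<in> C w" "F m w y < F m w x" using z wx by (auto simp: deviating_def)
    obtain U G d where G: "openin weak_top U" "m \<in> U" "open G" "(w, x) \<in> G" "d > 0"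
      "\<And>w' x'. (w', x') \<in> G \<Longrightarrow> \<exists>y'\<in>C w'. \<forall>m1\<in>U. \<forall>m2\<in>U. F m2 w' y' + d < F m1 w' x'"
      using strict_nbhd[OF m y] by metis
    have "G \<subseteq> deviating m"
    proof
      fix z' assume "z' \<in> G"
      then obtain w' x' where z': "z' = (w', x')" "(w', x') \<in> G" by (cases z') auto
      from G(6)[OF z'(2)] obtain y' where "y' \<in> C w'" "F m w' y' + d < F m w' x'" using G(2) by blast
      then show "z' \<in> deviating m" using z'(1) G(5) by (auto simp: deviating_def intro!: bexI[of _ y'])
    qed
    with G wx show ?thesis by blast
  qed
qed

lemma F_bdd_below: "(\<And>y. m y \<in> Pr) \<Longrightarrow> bdd_below ((\<lambda>y. F (m y) w y) ` S)"
proof -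
  obtain B where "\<And>m w x. m \<in> Pr \<Longrightarrow> \<bar>F m w x\<bar> \<le> B" using F_bdd by blast
  then show "(\<And>y. m y \<in> Pr) \<Longrightarrow> ?thesis" by (intro bdd_belowI2[where m="-B"]) (auto simp: abs_le_iff minus_le_iff)
qed

lemma MFE_if_null_deviating:
  assumes m: "m \<in> Pr" and null: "emeasure m (deviating m) = 0"
  shows "m \<in> MFE C F (wmarg m)"
proof -
  have "deviating m \<in> null_sets m"
    using null open_deviating[OF m] PrD(1)[OF m] by (auto simp: null_sets_def)
  then have "AE z in m. z \<notin> deviating m" by (rule AE_not_in)
  then have "AE z in m. snd z \<in> C (fst z) \<and> F m (fst z) (snd z) = (INF y\<in>C (fst z). F m (fst z) y)"
  proof eventually_elim
    case (elim z)
    then have "\<not> (snd z \<notin> C (fst z) \<or> (\<exists>y\<in>C (fst z). F m (fst z) y < F m (fst z) (snd z)))"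
      unfolding deviating_def by (cases z) simp
    then have z: "snd z \<in> C (fst z)" "\<And>y. y \<in> C (fst z) \<Longrightarrow> F m (fst z) (snd z) \<le> F m (fst z) y"
      by (simp_all add: not_less)
    have "F m (fst z) (snd z) = (INF y\<in>C (fst z). F m (fst z) y)"
      by (rule antisym[OF cINF_greatest[OF C_ne z(2)] cINF_lower[OF F_bdd_below z(1)]]) (auto intro: m)
    with z show ?case by simp
  qed
  with m show ?thesis by (simp add: MFE_def)
qed

text \<open>Near a non-equilibrium \<open>m\<close> some player sits close to a support point of the
  deviating set. Such a player either uses an infeasible action or can gain a fixed
  \<open>d\<close>, which eventually exceeds \<open>eps n\<close>.\<close>

lemma not_MFE_nbhd:
  assumes m: "m \<in> Pr" and no: "m \<notin> MFE C F (wmarg m)"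
  obtains U N where "openin weak_top U" "m \<in> U"
    "\<And>n w x. n \<ge> N \<Longrightarrow> eps_nash C F (eps n) n w x \<Longrightarrow> empirical n (\<lambda>i. (w i, x i)) \<notin> U"
proof -
  obtain \<B> :: "('w \<times> 'x) set set" where \<B>: "countable \<B>" "topological_basis \<B>"
    by (rule rectangle_basis[OF X_compact, where 'w='w])
  have "emeasure m (deviating m) \<noteq> 0" using MFE_if_null_deviating[OF m] no by blast
  from support_point[OF \<B> m open_deviating[OF m] this]
  obtain z where z: "z \<in> deviating m" "\<And>V. open V \<Longrightarrow> z \<in> V \<Longrightarrow> emeasure m V \<noteq> 0" by metis
  obtain w x where wx: "z = (w, x)" by (cases z)
  have pos_open: "openin weak_top {m' \<in> Pr. (\<integral>z. tent 1 G z \<partial>m') > 0}" for G :: "('w \<times> 'x) set"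
    using openin_weak_top_integral[OF tent_Cb, of "{0<..}" 1 G] by simp
  show thesis
  proof (cases "x \<in> C w")
    case False
    define G where "G = - {(w, x). x \<in> C w}"
    have G: "open G" using C_cont by (auto simp: cont_corr_def open_Compl G_def)
    have zG: "z \<in> G" using False wx by (simp add: G_def)
    show thesis
    proof (rule that[OF pos_open, of G 1])
      show "m \<in> {m' \<in> Pr. (\<integral>z. tent 1 G z \<partial>m') > 0}" using m bump[OF m G z(2)[OF G zG]] by simp
      fix n :: nat and w x assume n: "n \<ge> 1" and nash: "eps_nash C F (eps n) n w x"
      have "(\<integral>z. tent 1 G z \<partial>empirical n (\<lambda>i. (w i, x i))) = (\<Sum>i<n. tent 1 G (w i, x i)) / real n"
        by (rule integral_empirical[OF n Cb_measurable[OF tent_Cb]])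
      also have "(\<Sum>i<n. tent 1 G (w i, x i)) = 0"
        using nash by (intro sum.neutral ballI tent_outside) (auto simp: eps_nash_def G_def)
      finally show "empirical n (\<lambda>i. (w i, x i)) \<notin> {m' \<in> Pr. (\<integral>z. tent 1 G z \<partial>m') > 0}" by simp
    qed
  next
    case True
    then obtain y where y: "y \<in> C w" "F m w y < F m w x" using z(1) wx by (auto simp: deviating_def)
    obtain U G d where G: "openin weak_top U" "m \<in> U" "open G" "(w, x) \<in> G" "d > 0"
      "\<And>w' x'. (w', x') \<in> G \<Longrightarrow> \<exists>y'\<in>C w'. \<forall>m1\<in>U. \<forall>m2\<in>U. F m2 w' y' + d < F m1 w' x'"
      using strict_nbhd[OF m y] by metis
    obtain J \<eta> where J: "finite J" "J \<subseteq> Cb" "\<eta> > 0"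
      "\<And>m'. m' \<in> Pr \<Longrightarrow> (\<And>f. f \<in> J \<Longrightarrow> \<bar>(\<integral>x. f x \<partial>m') - (\<integral>x. f x \<partial>m)\<bar> < \<eta>) \<Longrightarrow> m' \<in> U"
      using weak_top_nbhd[OF G(1,2)] by blast
    \<comment> \<open>Positive mass near the support point produces an actual player there. The
      radius \<open>\<eta>/2\<close> leaves another \<open>\<eta>/2\<close> for the move of that
      player, so the perturbed measure still lies in \<open>U\<close>.\<close>
    define V where "V = {m' \<in> Pr. (\<integral>z. tent 1 G z \<partial>m') > 0} \<inter>
      (\<Inter>f\<in>J. {m' \<in> Pr. (\<integral>z. f z \<partial>m') \<in> ball (\<integral>z. f z \<partial>m) (\<eta>/2)})"
    have Vo: "openin weak_top V"
    \<comment> \<open>An empty intersection is the set of all measures, which is not contained in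
      \<open>Pr\<close> and hence not weakly open.\<close>
    proof (cases "J = {}")
      case True then show ?thesis using pos_open by (simp add: V_def)
    next
      case False
      have "openin weak_top (\<Inter>f\<in>J. {m' \<in> Pr. (\<integral>z. f z \<partial>m') \<in> ball (\<integral>z. f z \<partial>m) (\<eta>/2)})"
        using J False by (intro openin_Inter) (auto intro!: openin_weak_top_integral simp del: mem_ball)
      then show ?thesis unfolding V_def by (intro openin_Int pos_open)
    qed
    have mV: "m \<in> V" using m J(3) bump[OF m G(3) z(2)[OF G(3)]] G(4) wx by (simp add: V_def)
    have "\<exists>N. \<forall>n\<ge>N. \<forall>i p q. (\<forall>j. j \<noteq> i \<longrightarrow> p j = q j) \<longrightarrow>
      \<bar>(\<integral>x. f x \<partial>empirical n p) - (\<integral>x. f x \<partial>empirical n q)\<bar> < \<eta>/2" if "f \<in> J" for f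
    proof -
      have fC: "f \<in> Cb" using that J by blast
      obtain B where B: "B > 0" "\<And>x. \<bar>f x\<bar> \<le> B" using CbE[OF fC] by metis
      obtain N where N: "4 * B / \<eta> < real N" using reals_Archimedean2 by blast
      show ?thesis
      proof (intro exI[of _ "max N 1"] allI impI)
        fix n i and p q :: "nat \<Rightarrow> 'w \<times> 'x" assume n: "max N 1 \<le> n" and pq: "\<forall>j. j \<noteq> i \<longrightarrow> p j = q j"
        have "\<bar>(\<integral>x. f x \<partial>empirical n p) - (\<integral>x. f x \<partial>empirical n q)\<bar> \<le> 2 * B / real n"
          using n pq by (intro empirical_perturb[OF _ Cb_measurable[OF fC] B(2)]) auto
        also have "\<dots> < \<eta> / 2"
        proof -
          have "4 * B / \<eta> < real n" using N n by linarith
          then show ?thesis using n J(3) by (simp add: field_simps)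
        qed
        finally show "\<bar>(\<integral>x. f x \<partial>empirical n p) - (\<integral>x. f x \<partial>empirical n q)\<bar> < \<eta> / 2" .
      qed
    qed
    then obtain N where N: "\<And>f n i p q. f \<in> J \<Longrightarrow> n \<ge> N f \<Longrightarrow> (\<And>j. j \<noteq> i \<Longrightarrow> p j = q j) \<Longrightarrow>
      \<bar>(\<integral>x. f x \<partial>empirical n p) - (\<integral>x. f x \<partial>empirical n q)\<bar> < \<eta>/2" by metis
    obtain N2 where N2: "\<And>n. n \<ge> N2 \<Longrightarrow> eps n < d"
      using order_tendstoD(2)[OF eps_lim G(5)] by (auto simp: eventually_sequentially)
    \<comment> \<open>From this index on, empirical measures are probabilities,
      \<open>eps n < d\<close>, and one deviation moves every integral from \<open>J\<close> by less
      than \<open>\<eta>/2\<close>.\<close>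
    define N' where "N' = Max (insert 1 (insert N2 (N ` J)))"
    have N': "N' \<ge> 1" "N' \<ge> N2" "\<And>f. f \<in> J \<Longrightarrow> N' \<ge> N f" unfolding N'_def by (rule Max_ge; simp add: J(1))+
    show thesis
    proof (rule that[OF Vo mV, of N'], rule notI)
      fix n w x assume n: "n \<ge> N'" and nash: "eps_nash C F (eps n) n w x"
        and V: "empirical n (\<lambda>i. (w i, x i)) \<in> V"
      let ?p = "\<lambda>i. (w i, x i)"
      have n1: "n \<ge> 1" using n N' by simp
      have "(\<Sum>i<n. tent 1 G (?p i)) / real n > 0"
        using V integral_empirical[OF n1 Cb_measurable[OF tent_Cb[of 1 G]], of ?p] by (simp add: V_def)
      then obtain i where i: "i < n" "tent 1 G (?p i) \<noteq> 0"
        by (metis (no_types, lifting) div_0 lessThan_iff less_irrefl sum.neutral)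
      then have "?p i \<in> G" using tent_outside by metis
      then obtain y where y: "y \<in> C (w i)" "\<And>m1 m2. m1 \<in> U \<Longrightarrow> m2 \<in> U \<Longrightarrow> F m2 (w i) y + d < F m1 (w i) (x i)"
        using G(6) by blast
      let ?q = "\<lambda>y j. (w j, (x(i := y)) j)"
      have close: "\<bar>(\<integral>z. f z \<partial>empirical n ?p) - (\<integral>z. f z \<partial>m)\<bar> < \<eta>/2" if "f \<in> J" for f
        using V that by (auto simp: V_def dist_real_def abs_minus_commute)
      have m1: "empirical n ?p \<in> U"
        using close J(3) by (intro J(4) empirical_Pr n1) force
      have m2: "empirical n (?q y) \<in> U"
      proof (rule J(4)[OF empirical_Pr[OF n1]])
        fix f assume f: "f \<in> J"
        have "\<bar>(\<integral>z. f z \<partial>empirical n (?q y)) - (\<integral>z. f z \<partial>empirical n ?p)\<bar> < \<eta>/2"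
          using N'(3)[OF f] n by (intro N[OF f, of _ i]) auto
        with close[OF f] show "\<bar>(\<integral>z. f z \<partial>empirical n (?q y)) - (\<integral>z. f z \<partial>m)\<bar> < \<eta>" by linarith
      qed
      have "(INF y\<in>C (w i). F (empirical n (?q y)) (w i) y) \<le> F (empirical n (?q y)) (w i) y"
        by (rule cINF_lower[OF F_bdd_below y(1)]) (rule empirical_Pr[OF n1])
      moreover have "F (empirical n ?p) (w i) (x i) - (INF y\<in>C (w i). F (empirical n (?q y)) (w i) y) \<le> eps n"
        using nash i(1) by (simp add: eps_nash_def)
      moreover have "eps n < d" using N2 n N' by simp
      ultimately show False using y(2)[OF m1 m2] by linarith
    qed
  qed
qed

text \<open>The event is covered by a measurable set, so that no measurability of \<open>A\<close> is involved.\<close>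
definition exp_negligible :: "'w measure \<Rightarrow> real \<Rightarrow> ('w \<times> 'x) measure set \<Rightarrow> bool" where
  "exp_negligible l c A \<longleftrightarrow> (\<exists>d>c. \<exists>K N Z. \<forall>n\<ge>N. Z n \<in> sets (iid n l) \<and>
     measure (iid n l) (Z n) \<le> K * exp (- (real n * d)) \<and>
     (\<forall>w\<in>space (iid n l). \<forall>x. eps_nash C F (eps n) n w x \<longrightarrow>
        empirical n (\<lambda>i. (w i, x i)) \<in> A \<longrightarrow> w \<in> Z n))"

section \<open>Calculus of exponentially negligible sets\<close>

lemma exp_negligibleI:
  assumes "d > c" "\<And>n. n \<ge> N \<Longrightarrow> Z n \<in> sets (iid n l)"
    "\<And>n. n \<ge> N \<Longrightarrow> measure (iid n l) (Z n) \<le> K * exp (- (real n * d))"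
    "\<And>n w x. n \<ge> N \<Longrightarrow> w \<in> space (iid n l) \<Longrightarrow> eps_nash C F (eps n) n w x \<Longrightarrow>
       empirical n (\<lambda>i. (w i, x i)) \<in> A \<Longrightarrow> w \<in> Z n"
  shows "exp_negligible l c A"
proof -
  have "\<forall>n\<ge>N. Z n \<in> sets (iid n l) \<and> measure (iid n l) (Z n) \<le> K * exp (- (real n * d)) \<and>
     (\<forall>w\<in>space (iid n l). \<forall>x. eps_nash C F (eps n) n w x \<longrightarrow>
        empirical n (\<lambda>i. (w i, x i)) \<in> A \<longrightarrow> w \<in> Z n)"
    using assms(2-) by blast
  with assms(1) show ?thesis unfolding exp_negligible_def by blast
qed

lemma exp_negligibleE:
  assumes "exp_negligible l c A"
  obtains d K N Z where "d > c" "\<And>n. n \<ge> N \<Longrightarrow> Z n \<in> sets (iid n l)"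
    "\<And>n. n \<ge> N \<Longrightarrow> measure (iid n l) (Z n) \<le> K * exp (- (real n * d))"
    "\<And>n w x. n \<ge> N \<Longrightarrow> w \<in> space (iid n l) \<Longrightarrow> eps_nash C F (eps n) n w x \<Longrightarrow>
       empirical n (\<lambda>i. (w i, x i)) \<in> A \<Longrightarrow> w \<in> Z n"
proof -
  from assms obtain d K N Z where "d > c" and *: "\<forall>n\<ge>N. Z n \<in> sets (iid n l) \<and>
     measure (iid n l) (Z n) \<le> K * exp (- (real n * d)) \<and>
     (\<forall>w\<in>space (iid n l). \<forall>x. eps_nash C F (eps n) n w x \<longrightarrow>
        empirical n (\<lambda>i. (w i, x i)) \<in> A \<longrightarrow> w \<in> Z n)"
    unfolding exp_negligible_def by blast
  show thesis by (rule that[OF \<open>d > c\<close>, of N Z K]) (use * in simp_all)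
qed

lemma exp_negligible_subset:
  assumes "exp_negligible l c B" "A \<subseteq> B"
  shows "exp_negligible l c A"
proof -
  obtain d K N Z where 1: "d > c" "\<And>n. n \<ge> N \<Longrightarrow> Z n \<in> sets (iid n l)"
    "\<And>n. n \<ge> N \<Longrightarrow> measure (iid n l) (Z n) \<le> K * exp (- (real n * d))"
    "\<And>n w x. n \<ge> N \<Longrightarrow> w \<in> space (iid n l) \<Longrightarrow> eps_nash C F (eps n) n w x \<Longrightarrow>
       empirical n (\<lambda>i. (w i, x i)) \<in> B \<Longrightarrow> w \<in> Z n"
    by (rule exp_negligibleE[OF assms(1)]) (rule that)
  show ?thesis by (rule exp_negligibleI[OF 1(1-3)]) (use assms(2) 1(4) in blast)+
qed

text \<open>Serves the neighbourhoods of non-equilibria: the empty set is a cover, so any rate is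
  allowed.\<close>

lemma exp_negligible_never:
  assumes "\<And>n w x. n \<ge> N \<Longrightarrow> eps_nash C F (eps n) n w x \<Longrightarrow> empirical n (\<lambda>i. (w i, x i)) \<notin> A"
  shows "exp_negligible l c A"
  by (rule exp_negligibleI[where d="c+1" and N=N and Z="\<lambda>_. {}" and K=0]) (use assms in auto)

lemma exp_negligible_Un:
  assumes l: "l \<in> Pr" and A: "exp_negligible l c A" and B: "exp_negligible l c B"
  shows "exp_negligible l c (A \<union> B)"
proof -
  obtain d K N Z where 1: "d > c" "\<And>n. n \<ge> N \<Longrightarrow> Z n \<in> sets (iid n l)"
    "\<And>n. n \<ge> N \<Longrightarrow> measure (iid n l) (Z n) \<le> K * exp (- (real n * d))"
    "\<And>n w x. n \<ge> N \<Longrightarrow> w \<in> space (iid n l) \<Longrightarrow> eps_nash C F (eps n) n w x \<Longrightarrow>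
       empirical n (\<lambda>i. (w i, x i)) \<in> A \<Longrightarrow> w \<in> Z n"
    by (rule exp_negligibleE[OF A]) (rule that)
  obtain d' K' N' Z' where 2: "d' > c" "\<And>n. n \<ge> N' \<Longrightarrow> Z' n \<in> sets (iid n l)"
    "\<And>n. n \<ge> N' \<Longrightarrow> measure (iid n l) (Z' n) \<le> K' * exp (- (real n * d'))"
    "\<And>n w x. n \<ge> N' \<Longrightarrow> w \<in> space (iid n l) \<Longrightarrow> eps_nash C F (eps n) n w x \<Longrightarrow>
       empirical n (\<lambda>i. (w i, x i)) \<in> B \<Longrightarrow> w \<in> Z' n"
    by (rule exp_negligibleE[OF B]) (rule that)
  \<comment> \<open>The constants may be negative; absolute values keep the bounds monotone when
    both rates are lowered to the smaller one.\<close>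
  have le: "k * exp (- (real n * e)) \<le> \<bar>k\<bar> * exp (- (real n * min d d'))" if "e \<ge> min d d'" for k e n
  proof -
    have "k * exp (- (real n * e)) \<le> \<bar>k\<bar> * exp (- (real n * e))" by (intro mult_right_mono) auto
    also have "\<dots> \<le> \<bar>k\<bar> * exp (- (real n * min d d'))"
      using that mult_left_mono[OF that, of "real n"] by (intro mult_left_mono) auto
    finally show ?thesis .
  qed
  show ?thesis
  proof (rule exp_negligibleI[where d="min d d'" and N="max N N'" and Z="\<lambda>n. Z n \<union> Z' n" and K="\<bar>K\<bar> + \<bar>K'\<bar>"])
    fix n assume n: "n \<ge> max N N'"
    interpret prob_space "iid n l" by (rule prob_space_iid[OF l])
    show "Z n \<union> Z' n \<in> sets (iid n l)" using 1(2) 2(2) n by auto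
    have "measure (iid n l) (Z n \<union> Z' n) \<le> measure (iid n l) (Z n) + measure (iid n l) (Z' n)"
      using 1(2) 2(2) n by (intro measure_Un_le) auto
    also have "\<dots> \<le> \<bar>K\<bar> * exp (- (real n * min d d')) + \<bar>K'\<bar> * exp (- (real n * min d d'))"
      using n by (intro add_mono order_trans[OF 1(3) le] order_trans[OF 2(3) le]) auto
    finally show "measure (iid n l) (Z n \<union> Z' n) \<le> (\<bar>K\<bar> + \<bar>K'\<bar>) * exp (- (real n * min d d'))"
      by (simp only: distrib_right)
    fix w x assume "w \<in> space (iid n l)" "eps_nash C F (eps n) n w x" "empirical n (\<lambda>i. (w i, x i)) \<in> A \<union> B"
    then show "w \<in> Z n \<union> Z' n" using 1(4)[of n w x] 2(4)[of n w x] n by auto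
  qed (use 1(1) 2(1) in auto)
qed

lemma exp_negligible_Union:
  assumes "l \<in> Pr" "finite \<U>" "\<And>U. U \<in> \<U> \<Longrightarrow> exp_negligible l c U"
  shows "exp_negligible l c (\<Union>\<U>)"
  using assms(2,3)
proof (induction rule: finite_induct)
  case empty show ?case by (rule exp_negligible_never[of 0]) simp
next
  case (insert U \<U>) then show ?case using exp_negligible_Un[OF assms(1)] by auto
qed

text \<open>The level \<open>a\<close> gives away half of the surplus \<open>dv f v l - c\<close>:
  measures with marginal \<open>v\<close> lie strictly above it, so the half-space is a
  neighbourhood of them, and Chernoff's rate still exceeds \<open>c\<close>.\<close>

lemma exp_negligible_halfspace:
  assumes l: "l \<in> Pr" and f: "f \<in> Cb" and dv: "dv f v l > c"
  defines "a \<equiv> (\<integral>x. f x \<partial>v) - (dv f v l - c) / 2"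
  shows "exp_negligible l c {m \<in> Pr. (\<integral>z. f (fst z) \<partial>m) > a}"
proof -
  obtain B where B: "\<And>x. \<bar>f x\<bar> \<le> B" using CbE[OF f] by metis
  note ch = chernoff[OF l Cb_measurable[OF f] B, of _ a]
  show ?thesis
  proof (rule exp_negligibleI[where d="a - ln (\<integral>x. exp (f x) \<partial>l)" and N=1 and K=1
        and Z="\<lambda>n. {w \<in> space (iid n l). (\<Sum>i<n. f (w i)) \<ge> real n * a}"])
    show "a - ln (\<integral>x. exp (f x) \<partial>l) > c" using dv by (simp add: a_def dv_def field_simps)
    fix n w and x :: "nat \<Rightarrow> 'x" assume n: "(n::nat) \<ge> 1" and w: "w \<in> space (iid n l)"
      and e: "empirical n (\<lambda>i. (w i, x i)) \<in> {m \<in> Pr. (\<integral>z. f (fst z) \<partial>m) > a}"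
    have "(\<integral>z. f (fst z) \<partial>empirical n (\<lambda>i. (w i, x i :: 'x))) = (\<Sum>i<n. f (w i)) / real n"
      using integral_empirical[OF n Cb_measurable[OF Cb_fst[OF f]], of "\<lambda>i. (w i, x i :: 'x)"] by simp
    then show "w \<in> {w \<in> space (iid n l). (\<Sum>i<n. f (w i)) \<ge> real n * a}"
      using e w n mult_left_mono[of a "\<integral>z. f (fst z) \<partial>empirical n (\<lambda>i. (w i, x i))" "real n"] by simp
  qed (use ch in simp_all)
qed

text \<open>Outside a tight set exponential tightness applies. The rest is compact, and each of its
  points has a negligible open neighbourhood: either it repels approximate equilibria, or
  \<open>sep\<close> provides a half-space.\<close>

lemma exp_negligible_closed:
  assumes l: "l \<in> Pr" and A: "closedin weak_top A"
    and sep: "\<And>m. m \<in> A \<Longrightarrow> m \<in> MFE C F (wmarg m) \<Longrightarrow> \<exists>f\<in>Cb. dv f (wmarg m) l > c"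
  shows "exp_negligible l c A"
proof -
  have APr: "A \<subseteq> Pr" using closedin_subset[OF A] by simp
  \<comment> \<open>The level \<open>\<bar>c\<bar> + 1\<close> is nonnegative, as
    \<open>exp_tight\<close> demands, and exceeds \<open>c\<close>, which may be negative.\<close>
  obtain K Z where K: "\<And>j. compact (K j :: 'w set)"
    "\<And>n. n \<ge> 1 \<Longrightarrow> Z n \<in> sets (iid n l)"
    "\<And>n. n \<ge> 1 \<Longrightarrow> measure (iid n l) (Z n) \<le> exp (- (real n * (\<bar>c\<bar> + 1)))"
    "\<And>n w j. n \<ge> 1 \<Longrightarrow> w \<in> space (iid n l) \<Longrightarrow> w \<notin> Z n \<Longrightarrow>
       (\<Sum>i<n. indicator (- K j) (w i)) / real n \<le> 1 / real (Suc j)"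
    by (rule exp_tight[OF l, of "\<bar>c\<bar> + 1"]) (simp, rule that)
  define T where "T j = K j \<times> (UNIV :: 'x set)" for j
  have T: "compact (T j)" for j unfolding T_def by (intro compact_Times K X_compact)
  have far: "exp_negligible l c (A - tight_set T)"
  proof (rule exp_negligibleI[where d="\<bar>c\<bar> + 1" and N=1 and Z=Z and K=1])
    fix n w and x :: "nat \<Rightarrow> 'x" assume n: "(n::nat) \<ge> 1" and w: "w \<in> space (iid n l)"
      and e: "empirical n (\<lambda>i. (w i, x i)) \<in> A - tight_set T"
    show "w \<in> Z n"
    proof (rule ccontr)
      assume "w \<notin> Z n"
      note b = K(4)[OF n w this]
      have "measure (empirical n (\<lambda>i. (w i, x i))) (- T j) \<le> 1 / real (Suc j)" for j
      proof -
        have "- T j \<in> sets borel" using T[of j] by (simp add: compact_imp_closed)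
        then have "measure (empirical n (\<lambda>i. (w i, x i))) (- T j) = (\<Sum>i<n. indicator (- T j) (w i, x i)) / real n"
          by (rule measure_empirical[OF n])
        also have "(\<Sum>i<n. indicator (- T j) (w i, x i)) = (\<Sum>i<n. indicator (- K j) (w i) :: real)"
          by (intro sum.cong) (auto simp: T_def indicator_def)
        finally show ?thesis using b[of j] by simp
      qed
      then show False using e empirical_Pr[OF n] by (auto simp: tight_set_def)
    qed
  qed (use K(2,3) in simp_all)
  have near: "\<exists>U. openin weak_top U \<and> m \<in> U \<and> exp_negligible l c U" if m: "m \<in> A" for m
  proof (cases "m \<in> MFE C F (wmarg m)")
    case False
    have mP: "m \<in> Pr" using m APr by blast
    obtain U N where U: "openin weak_top U" "m \<in> U"
      "\<And>n w x. n \<ge> N \<Longrightarrow> eps_nash C F (eps n) n w x \<Longrightarrow> empirical n (\<lambda>i. (w i, x i)) \<notin> U"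
      by (rule not_MFE_nbhd[OF mP False]) (rule that)
    show ?thesis using U(1,2) exp_negligible_never[OF U(3), where l=l and c=c] by blast
  next
    case True
    have mP: "m \<in> Pr" using m APr by blast
    obtain f where f: "f \<in> Cb" "dv f (wmarg m) l > c" using sep[OF m True] by blast
    let ?a = "(\<integral>x. f x \<partial>wmarg m) - (dv f (wmarg m) l - c) / 2"
    let ?U = "{m \<in> Pr. (\<integral>z. f (fst z) \<partial>m) > ?a}"
    have "openin weak_top ?U"
      using openin_weak_top_integral[OF Cb_fst[OF f(1)], of "{?a<..}"] by simp
    moreover have "m \<in> ?U" using mP f(2) integral_wmarg[OF mP f(1)] by simp
    moreover have "exp_negligible l c ?U" by (rule exp_negligible_halfspace[OF l f])
    ultimately show ?thesis by blast
  qed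
  have comp: "compactin weak_top (A \<inter> tight_set T)"
    by (rule closed_Int_compactin[OF A compactin_tight_set[OF T]])
  \<comment> \<open>Taking all negligible open sets as the cover makes every finite subfamily
    consist of negligible sets without choosing neighbourhoods.\<close>
  let ?\<U> = "{U. openin weak_top U \<and> exp_negligible l c U}"
  have "Ball ?\<U> (openin weak_top) \<and> A \<inter> tight_set T \<subseteq> \<Union>?\<U>" using near by blast
  with comp[unfolded compactin_def, THEN conjunct2, THEN spec, of ?\<U>]
  have "\<exists>\<F>. finite \<F> \<and> \<F> \<subseteq> ?\<U> \<and> A \<inter> tight_set T \<subseteq> \<Union>\<F>" by (rule mp)
  then obtain \<F> where \<F>: "finite \<F>" "\<F> \<subseteq> ?\<U>" "A \<inter> tight_set T \<subseteq> \<Union>\<F>"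
    by blast
  have "exp_negligible l c (\<Union>\<F> \<union> (A - tight_set T))"
    using \<F> by (intro exp_negligible_Un[OF l] far exp_negligible_Union[OF l]) auto
  then show ?thesis by (rule exp_negligible_subset) (use \<F> in blast)
qed

end

subsection \<open>The large deviation bounds\<close>

text \<open>All probabilities are moved to the space of type vectors, where
  \<open>iid n lam0\<close> can be compared with \<open>iid n l\<close> for another law
  \<open>l\<close>.\<close>

theorem theorem3p9:
  fixes C :: "'w::polish_space \<Rightarrow> 'x::metric_space set"
    and F :: "('w \<times> 'x) measure \<Rightarrow> 'w \<Rightarrow> 'x \<Rightarrow> real"
    and eps :: "nat \<Rightarrow> real"
    and M :: "'a measure"
    and W :: "nat \<Rightarrow> 'a \<Rightarrow> 'w"
    and lam0 :: "'w measure"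
    and xh :: "nat \<Rightarrow> (nat \<Rightarrow> 'w) \<Rightarrow> nat \<Rightarrow> 'x"
    and A :: "('w \<times> 'x) measure set"
  assumes X_compact: "compact (UNIV :: 'x set)"
    and C_ne: "\<And>w. C w \<noteq> {}"
    and C_closed: "\<And>w. closed (C w)"
    and C_cont: "cont_corr C"
    and F_cont: "continuous_map (prod_topology weak_top (prod_topology euclidean euclidean))
                   euclideanreal (\<lambda>(m, w, x). F m w x)"
    and F_bdd: "\<exists>B. \<forall>m\<in>Pr. \<forall>w x. \<bar>F m w x\<bar> \<le> B"
    and eps_nonneg: "\<And>n. eps n \<ge> 0"
    and eps_lim: "eps \<longlonglongrightarrow> 0"
    and M_prob: "prob_space M"
    and W_meas: "\<And>i. W i \<in> measurable M borel"
    and W_indep: "prob_space.indep_vars M (\<lambda>_. borel) W UNIV"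
    and W_law: "\<And>i. distr M borel (W i) = lam0"
    and xh_nash: "\<And>n w. w \<in> PiE {..<n} (\<lambda>_. UNIV) \<Longrightarrow> eps_nash C F (eps n) n w (xh n w)"
    and xh_meas: "\<And>n i. i < n \<Longrightarrow>
                   univ_measurable (PiM {..<n} (\<lambda>_. borel)) borel (\<lambda>w. xh n w i)"
    and A_sub: "A \<subseteq> Pr"
    and A_meas: "A \<in> weak_borel"
  defines "\<mu> \<equiv> (\<lambda>n \<omega>. empirical n
              (\<lambda>i. (W i \<omega>, xh n (restrict (\<lambda>j. W j \<omega>) {..<n}) i)))"
  shows
    "limsup (\<lambda>n. nlog n (measure (completion M) {\<omega> \<in> space M. \<mu> n \<omega> \<in> A}))
       \<le> - (INF m \<in> (weak_top closure_of A) \<inter> MFE_all C F. rel_entropy (wmarg m) lam0)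
     \<and> liminf (\<lambda>n. nlog n (measure (completion M) {\<omega> \<in> space M. \<mu> n \<omega> \<in> A}))
       \<ge> - (INF lam \<in> {lam \<in> Pr. MFE C F lam \<subseteq> weak_top interior_of A}. rel_entropy lam lam0)
     \<and> ((\<forall>lam\<in>Pr. absolutely_continuous lam0 lam \<longrightarrow> (\<exists>m. MFE C F lam = {m})) \<longrightarrow>
        liminf (\<lambda>n. nlog n (measure (completion M) {\<omega> \<in> space M. \<mu> n \<omega> \<in> A}))
        \<ge> - (INF m \<in> (weak_top interior_of A) \<inter> MFE_all C F. rel_entropy (wmarg m) lam0))"
proof -
  interpret M: prob_space M by (rule M_prob)
  interpret game C F eps
    using X_compact C_ne C_cont F_cont F_bdd eps_lim by unfold_locales
  have lam0: "lam0 \<in> Pr"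
    using M.prob_space_distr[OF W_meas[of 0]] W_law[of 0] by (auto simp: Pr_def)
  \<comment> \<open>A set of type vectors that does not depend on their law, so the same event can
    be measured under \<open>lam0\<close> and under \<open>l\<close>.\<close>
  define S where "S n D = {w \<in> PiE {..<n} (\<lambda>_. UNIV). empirical n (\<lambda>i. (w i, xh n w i)) \<in> D}" for n D
  define p where "p n = measure (completion M) {\<omega> \<in> space M. \<mu> n \<omega> \<in> A}" for n
  have S_sets: "S n A \<in> sets (completion (iid n l))" if l: "l \<in> Pr" and n: "n \<ge> 1" for n l
  proof -
    have comp: "(\<lambda>w. w i) \<in> measurable (completion (iid n l)) borel" if "i < n" for i
      using measurable_component_singleton[of i "{..<n}" "\<lambda>_. l"] that PrD(1)[OF l]
      by (intro measurable_completion) (simp cong: measurable_cong_sets)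
    have strat: "(\<lambda>w. xh n w i) \<in> measurable (completion (iid n l)) borel" if "i < n" for i
      using xh_meas[OF that] prob_space_iid[OF l] sets_iid[OF l] unfolding univ_measurable_def by blast
    from empirical_weak_borel_measurable[where ?g1.0="\<lambda>i w. w i" and ?g2.0="\<lambda>i w. xh n w i", OF X_compact n comp strat A_meas]
    show ?thesis using space_iid[OF l] by (simp add: S_def)
  qed
  have p_eq: "p n = measure (completion (iid n lam0)) (S n A)" if n: "n \<ge> 1" for n
  proof -
    let ?T = "\<lambda>\<omega>. \<lambda>i\<in>{..<n}. W i \<omega>"
    have ne: "{..<n} \<noteq> {}" using n by (auto simp: lessThan_empty_iff)
    have "distr M (PiM {..<n} (\<lambda>_. borel)) ?T = PiM {..<n} (\<lambda>i. distr M borel (W i))"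
      using M.indep_vars_iff_distr_eq_PiM'[OF ne, where M'="\<lambda>_. borel" and X=W] W_meas M.indep_vars_subset[OF W_indep, of "{..<n}"]
      by simp
    also have "\<dots> = iid n lam0" using W_law by simp
    finally have "distr M (PiM {..<n} (\<lambda>_. borel)) ?T = iid n lam0" .
    moreover have "distr M (PiM {..<n} (\<lambda>_. borel)) ?T = distr M (iid n lam0) ?T"
      using sets_iid[OF lam0, of n] by (intro distr_cong) auto
    ultimately have distr: "distr M (iid n lam0) ?T = iid n lam0" by simp
    have "?T \<in> measurable M (iid n borel)" using W_meas by (intro measurable_restrict)
    then have Tm: "?T \<in> measurable M (iid n lam0)"
      using measurable_cong_sets[OF refl sets_iid[OF lam0, of n]] by blast
    have "{\<omega> \<in> space M. \<mu> n \<omega> \<in> A} = ?T -` S n A \<inter> space M"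
    proof -
      \<comment> \<open>The restricted vector agrees with the sample on the indices that the
        empirical measure sees.\<close>
      have "\<mu> n \<omega> = empirical n (\<lambda>i. (?T \<omega> i, xh n (?T \<omega>) i))" for \<omega>
        unfolding \<mu>_def by (rule empirical_cong[OF n]) simp
      then show ?thesis by (auto simp: S_def)
    qed
    then show ?thesis
      unfolding p_def using measure_completion_distr[OF M.finite_measure_axioms Tm distr S_sets[OF lam0 n]]
      by simp
  qed
  have nash: "eps_nash C F (eps n) n w (xh n w)" if "l \<in> Pr" "w \<in> space (iid n l)" for n w l
    using xh_nash[of w n] that space_iid[of l n] by simp
  have cover: "\<exists>d>c. \<exists>K. \<forall>\<^sub>F n in sequentially. \<exists>Z\<in>sets (iid n l). S n D \<subseteq> Z \<and>
      measure (iid n l) Z \<le> K * exp (- (real n * d))"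
    if l: "l \<in> Pr" and neg: "exp_negligible l c D" for l c D
  proof -
    obtain d K N Z where Z: "d > c" "\<And>n. n \<ge> N \<Longrightarrow> Z n \<in> sets (iid n l)"
      "\<And>n. n \<ge> N \<Longrightarrow> measure (iid n l) (Z n) \<le> K * exp (- (real n * d))"
      "\<And>n w x. n \<ge> N \<Longrightarrow> w \<in> space (iid n l) \<Longrightarrow> eps_nash C F (eps n) n w x \<Longrightarrow>
       empirical n (\<lambda>i. (w i, x i)) \<in> D \<Longrightarrow> w \<in> Z n"
      by (rule exp_negligibleE[OF neg]) (rule that)
    have "S n D \<subseteq> Z n" if n: "n \<ge> N" for n
    proof
      fix w assume w: "w \<in> S n D"
      then have ws: "w \<in> space (iid n l)" using space_iid[OF l] by (simp add: S_def)
      show "w \<in> Z n" using Z(4)[OF n ws nash[OF l ws]] w by (simp add: S_def)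
    qed
    then have "\<forall>\<^sub>F n in sequentially. \<exists>Z\<in>sets (iid n l). S n D \<subseteq> Z \<and>
        measure (iid n l) Z \<le> K * exp (- (real n * d))"
      using Z(2,3) by (intro eventually_sequentiallyI[of N]) blast
    with Z(1) show ?thesis by blast
  qed
  have upper: "limsup (\<lambda>n. nlog n (p n))
       \<le> - (INF m \<in> (weak_top closure_of A) \<inter> MFE_all C F. rel_entropy (wmarg m) lam0)" (is "?L \<le> - ?I")
  proof (rule ccontr)
    define I where "I = ?I"
    assume "\<not> ?L \<le> - ?I"
    then have "- I < ?L" unfolding I_def by (simp only: not_le)
    \<comment> \<open>A real \<open>r\<close> strictly between the two sides gives a finite rate
      \<open>- r\<close> below the infimum, also when the infimum is \<infinity>.\<close>
    then obtain r where r: "- I < ereal r" "ereal r < ?L" using ereal_dense2 by blast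
    then have c: "ereal (- r) < I" by (cases I) auto
    have "exp_negligible lam0 (- r) (weak_top closure_of A)"
    proof (rule exp_negligible_closed[OF lam0 closedin_closure_of])
      fix m assume m: "m \<in> weak_top closure_of A" "m \<in> MFE C F (wmarg m)"
      then have mP: "m \<in> Pr" by (simp add: MFE_def)
      then have "m \<in> MFE_all C F" using m(2) wmarg_Pr by (auto simp: MFE_all_def)
      then have "I \<le> rel_entropy (wmarg m) lam0" unfolding I_def using m(1) by (intro INF_lower) auto
      with c have "ereal (- r) < rel_entropy (wmarg m) lam0" by (rule less_le_trans)
      then show "\<exists>f\<in>Cb. dv f (wmarg m) lam0 > - r" by (rule rel_entropy_imp_dv[OF wmarg_Pr[OF mP] lam0])
    qed
    then have "exp_negligible lam0 (- r) A"
      by (rule exp_negligible_subset) (use A_sub closure_of_subset[of A weak_top] in simp)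
    from cover[OF lam0 this] obtain d K where d: "d > - r"
      "\<forall>\<^sub>F n in sequentially. \<exists>Z\<in>sets (iid n lam0). S n A \<subseteq> Z \<and>
        measure (iid n lam0) Z \<le> K * exp (- (real n * d))" by blast
    have "\<forall>\<^sub>F n in sequentially. 0 \<le> p n \<and> p n \<le> K * exp (- (real n * d))"
      using d(2) eventually_ge_at_top[of 1]
    proof eventually_elim
      case (elim n)
      interpret Qc: prob_space "completion (iid n lam0)"
        by (rule prob_space.prob_space_completion[OF prob_space_iid[OF lam0]])
      obtain Z where Z: "Z \<in> sets (iid n lam0)" "S n A \<subseteq> Z" "measure (iid n lam0) Z \<le> K * exp (- (real n * d))"
        using elim(1) by blast
      then have "p n \<le> measure (iid n lam0) Z"
        using Qc.finite_measure_mono[of "S n A" Z] p_eq[OF elim(2)] by simp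
      with Z(3) p_eq[OF elim(2)] show ?case by simp
    qed
    from limsup_nlog_le[OF this d(1)] r(2) show False by simp
  qed
  have lower1: "- rel_entropy l lam0 \<le> liminf (\<lambda>n. nlog n (p n))"
    if l: "l \<in> Pr" and sub: "MFE C F l \<subseteq> weak_top interior_of A" for l
  proof (cases "rel_entropy l lam0 = \<infinity>")
    case False
    then obtain H where H: "rel_entropy l lam0 = ereal H"
      unfolding rel_entropy_def Let_def by (auto split: if_splits)
    \<comment> \<open>Every equilibrium in \<open>?D\<close> has a marginal other than
      \<open>l\<close>, so rate 0 is enough: under \<open>l\<close> the empirical measures avoid
      \<open>?D\<close> with probability tending to 1.\<close>
    let ?D = "Pr - weak_top interior_of A"
    have "closedin weak_top ?D"
      using openin_interior_of[of weak_top A] closedin_diff[OF closedin_topspace] by fastforce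
    then have "exp_negligible l 0 ?D"
    proof (rule exp_negligible_closed[OF l])
      fix m assume m: "m \<in> ?D" "m \<in> MFE C F (wmarg m)"
      then have "wmarg m \<noteq> l" using sub by auto
      then show "\<exists>f\<in>Cb. dv f (wmarg m) l > 0"
        using m(1) by (intro dv_separates[OF wmarg_Pr l]) auto
    qed
    from cover[OF l this] obtain d K where d: "d > 0"
      "\<forall>\<^sub>F n in sequentially. \<exists>Z\<in>sets (iid n l). S n ?D \<subseteq> Z \<and>
        measure (iid n l) Z \<le> K * exp (- (real n * d))" by blast
    have "(\<lambda>n. K * exp (- d) ^ n) \<longlonglongrightarrow> K * 0"
      using d(1) by (intro tendsto_mult tendsto_const LIMSEQ_realpow_zero) auto
    then have Klim: "(\<lambda>n. K * exp (- (real n * d))) \<longlonglongrightarrow> 0"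
      by (simp flip: exp_of_nat_mult)
    have "(\<lambda>n. measure (completion (iid n l)) (S n A)) \<longlonglongrightarrow> 1"
    proof (rule tendsto_sandwich)
      show "(\<lambda>n. 1 - K * exp (- (real n * d))) \<longlonglongrightarrow> 1" using tendsto_diff[OF tendsto_const Klim, of 1] by simp
      show "\<forall>\<^sub>F n in sequentially. measure (completion (iid n l)) (S n A) \<le> 1"
        using prob_space.prob_le_1[OF prob_space.prob_space_completion[OF prob_space_iid[OF l]]] by simp
      show "\<forall>\<^sub>F n in sequentially. 1 - K * exp (- (real n * d)) \<le> measure (completion (iid n l)) (S n A)"
        using d(2) eventually_ge_at_top[of 1]
      proof eventually_elim
        case (elim n)
        interpret Q: prob_space "iid n l" by (rule prob_space_iid[OF l])
        interpret Qc: prob_space "completion (iid n l)" by (rule Q.prob_space_completion)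
        obtain Z where Z: "Z \<in> sets (iid n l)" "S n ?D \<subseteq> Z" "measure (iid n l) Z \<le> K * exp (- (real n * d))"
          using elim(1) by blast
        have "space (iid n l) - Z \<subseteq> S n A"
        proof
          fix w assume w: "w \<in> space (iid n l) - Z"
          then have "w \<in> PiE {..<n} (\<lambda>_. UNIV)" "w \<notin> S n ?D" using Z(2) space_iid[OF l, of n] by auto
          then show "w \<in> S n A"
            using empirical_Pr[OF elim(2)] interior_of_subset[of weak_top A] unfolding S_def by blast
        qed
        then have "measure (completion (iid n l)) (space (iid n l) - Z) \<le> measure (completion (iid n l)) (S n A)"
          using S_sets[OF l elim(2)] by (intro Qc.finite_measure_mono)
        then show ?case using Z(1,3) Q.prob_compl[OF Z(1)] by simp
      qed
    qed simp
    note lim = this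
    have "\<forall>\<^sub>F n in sequentially. p n \<ge> exp (- (real n * (H + \<delta>))) / 2" if "\<delta> > 0" for \<delta>
    proof -
      have "\<forall>\<^sub>F n in sequentially. measure (completion (iid n lam0)) (S n A) \<ge> exp (- (real n * (H + \<delta>))) / 2"
        by (rule iid_change_of_measure[OF lam0 l H _ lim that]) (rule S_sets[OF lam0])
      with eventually_ge_at_top[of 1] show ?thesis by eventually_elim (simp add: p_eq)
    qed
    from liminf_nlog_ge[of H p, OF this] show ?thesis by (simp add: H)
  qed simp
  have flip: "- a \<le> b \<longleftrightarrow> - b \<le> a" for a b :: ereal by (rule ereal_uminus_le_reorder)
  have lower: "- (INF lam \<in> {lam \<in> Pr. MFE C F lam \<subseteq> weak_top interior_of A}. rel_entropy lam lam0)
      \<le> liminf (\<lambda>n. nlog n (p n))"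
    by (rule flip[THEN iffD2], rule INF_greatest, rule flip[THEN iffD1], rule lower1) auto
  have lower': "- (INF m \<in> (weak_top interior_of A) \<inter> MFE_all C F. rel_entropy (wmarg m) lam0)
      \<le> liminf (\<lambda>n. nlog n (p n))"
    if single: "\<forall>lam\<in>Pr. absolutely_continuous lam0 lam \<longrightarrow> (\<exists>m. MFE C F lam = {m})"
  proof (rule flip[THEN iffD2], rule INF_greatest)
    fix m assume m: "m \<in> (weak_top interior_of A) \<inter> MFE_all C F"
    then have mM: "m \<in> MFE C F (wmarg m)" "wmarg m \<in> Pr" by (auto simp: MFE_all_def MFE_def)
    show "- liminf (\<lambda>n. nlog n (p n)) \<le> rel_entropy (wmarg m) lam0"
    proof (cases "absolutely_continuous lam0 (wmarg m)")
      case True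
      then obtain m' where "MFE C F (wmarg m) = {m'}" using single mM(2) by blast
      \<comment> \<open>By uniqueness, \<open>m\<close> lying in the interior of \<open>A\<close>
        means that all equilibria with its marginal do. In the other case, without absolute
        continuity, the entropy is infinite and the bound trivial.\<close>
      then have "MFE C F (wmarg m) = {m}" using mM(1) by simp
      then have "- rel_entropy (wmarg m) lam0 \<le> liminf (\<lambda>n. nlog n (p n))"
        using m by (intro lower1[OF mM(2)]) auto
      then show ?thesis by (rule flip[THEN iffD1])
    qed (simp add: rel_entropy_def)
  qed
  show ?thesis using upper lower lower' unfolding p_def by blast
qed

end
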